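(* Let $a,b,\sigma,\rho$ be real constants, $q\in(0,1)$, and let $(X(t))_{t\ge 0}$ be the process uniquely defined by the stochastic pantograph equation $$dX(t)=\{aX(t)+bX(qt)\}\,dt+\{\sigma X(t)+\rho X(qt)\}\,dB(t),\quad t\ge 0,\qquad X(0)=X_0 .$$ (i) Let $\rho=0$ and $\mathbb{E}[|X_0|^2]<\infty$. If $a+|b|<0$, there exist $C>0$ and $\alpha<0$ such that $$\mathbb{E}(|X(t)|)\le C\,\mathbb{E}(|X_0|)\,(1+t)^{\alpha},\quad t\ge 0,$$ with $\alpha$ given by $$\alpha=\frac{1}{\log q}\log\left(\frac{-a}{|b|}\right).$$ (ii) Let $\rho\neq 0$ and $\mathbb{E}[|X_0|^4]<\infty$. If $2a+\sigma^2+\rho^2+2|b+\sigma\rho|<0$, there exist $C>0$ and $\alpha<0$ such that $$\mathbb{E}(|X(t)|^2)\le C\,\mathbb{E}(|X_0|^2)\,(1+t)^{\alpha},\quad t\ge 0,$$ with $\alpha$ given by $$\alpha=\frac{2}{\log q}\log\left(\frac{1}{\rho^2}\left(\sqrt{|b+\sigma\rho|^2-\rho^2(2a+\sigma^2)}-|b+\sigma\rho|\right)\right).$$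
   Context: $(B(t))_{t\ge0}$ is a standard one-dimensional Wiener process on a filtered probability space $(\Omega,\mathcal{F},\mathbb{P})$, the filtration being the natural filtration of $B$. The initial value $X_0$ is a real random variable, independent of $B$, with $\mathbb{E}(|X_0|^2)<\infty$. The process $X$ is the pathwise unique strong solution of the equation (understood in the integrated Itô sense); its existence and uniqueness are known. *)

theory Defs
  imports "HOL-Probability.Probability"
begin

text \<open>
  Processes are functions \<open>X :: real \<Rightarrow> 'a \<Rightarrow> real\<close> (time first), of which only the times
  \<open>t \<ge> 0\<close> are relevant.
\<close>

definition wiener_process :: "'a measure \<Rightarrow> (real \<Rightarrow> 'a \<Rightarrow> real) \<Rightarrow> bool" where
  "wiener_process M B \<longleftrightarrow>
     (\<forall>t\<ge>0. B t \<in> borel_measurable M) \<and>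
     (AE \<omega> in M. B 0 \<omega> = 0) \<and>
     (AE \<omega> in M. continuous_on {0..} (\<lambda>t. B t \<omega>)) \<and>
     (\<forall>s t. 0 \<le> s \<and> s < t \<longrightarrow>
        distributed M lborel (\<lambda>\<omega>. B t \<omega> - B s \<omega>) (normal_density 0 (sqrt (t - s)))) \<and>
     (\<forall>n (u :: nat \<Rightarrow> real). 0 \<le> u 0 \<and> (\<forall>i<n. u i \<le> u (Suc i)) \<longrightarrow>
        prob_space.indep_vars M (\<lambda>_. borel) (\<lambda>i \<omega>. B (u (Suc i)) \<omega> - B (u i) \<omega>) {..<n})"

definition independent_of_process ::
    "'a measure \<Rightarrow> ('a \<Rightarrow> real) \<Rightarrow> (real \<Rightarrow> 'a \<Rightarrow> real) \<Rightarrow> bool" where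
  "independent_of_process M X0 B \<longleftrightarrow>
     prob_space.indep_set M
       (sets (vimage_algebra (space M) X0 borel))
       (sets (vimage_algebra (space M) (\<lambda>\<omega>. \<lambda>t\<in>{0..}. B t \<omega>) (Pi\<^sub>M {0..} (\<lambda>_. borel))))"

text \<open>
  The natural filtration of \<open>B\<close>, enlarged by the (random) initial value, without which a solution
  starting at \<open>X0\<close> could not be adapted, and by the null sets.
\<close>

definition natural_filtration ::
    "'a measure \<Rightarrow> ('a \<Rightarrow> real) \<Rightarrow> (real \<Rightarrow> 'a \<Rightarrow> real) \<Rightarrow> real \<Rightarrow> 'a measure" where
  "natural_filtration M X0 B t =
     sigma (space M)
       ({X0 -` A \<inter> space M | A. A \<in> sets borel} \<union>
        {B s -` A \<inter> space M | s A. 0 \<le> s \<and> s \<le> t \<and> A \<in> sets borel} \<union>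
        null_sets M)"

definition adapted_process :: "(real \<Rightarrow> 'a measure) \<Rightarrow> (real \<Rightarrow> 'a \<Rightarrow> real) \<Rightarrow> bool" where
  "adapted_process F X \<longleftrightarrow> (\<forall>t\<ge>0. X t \<in> borel_measurable (F t))"

definition measurable_process :: "'a measure \<Rightarrow> (real \<Rightarrow> 'a \<Rightarrow> real) \<Rightarrow> bool" where
  "measurable_process M X \<longleftrightarrow>
     (\<lambda>(t, \<omega>). X t \<omega>) \<in> borel_measurable (restrict_space borel {0..} \<Otimes>\<^sub>M M)"

definition converges_in_probability ::
    "'a measure \<Rightarrow> (nat \<Rightarrow> 'a \<Rightarrow> real) \<Rightarrow> ('a \<Rightarrow> real) \<Rightarrow> bool" where
  "converges_in_probability M Y Z \<longleftrightarrow>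
     (\<forall>n. Y n \<in> borel_measurable M) \<and> Z \<in> borel_measurable M \<and>
     (\<forall>\<epsilon>>0. (\<lambda>n. measure M {\<omega> \<in> space M. \<bar>Y n \<omega> - Z \<omega>\<bar> > \<epsilon>}) \<longlonglongrightarrow> 0)"

text \<open>
  A simple process equals \<open>coeff i\<close> on \<open>[knot i, knot (i + 1))\<close> for \<open>i < pieces\<close>, and 0 elsewhere.
\<close>

record 'a simple_process =
  pieces :: nat
  knot :: "nat \<Rightarrow> real"
  coeff :: "nat \<Rightarrow> 'a \<Rightarrow> real"

definition adapted_simple :: "'a measure \<Rightarrow> (real \<Rightarrow> 'a measure) \<Rightarrow> 'a simple_process \<Rightarrow> bool" where
  "adapted_simple M F h \<longleftrightarrow>
     0 \<le> knot h 0 \<and>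
     (\<forall>i < pieces h. knot h i < knot h (Suc i)) \<and>
     (\<forall>i < pieces h. coeff h i \<in> borel_measurable (F (knot h i))) \<and>
     (\<forall>i < pieces h. \<exists>K. \<forall>\<omega>\<in>space M. \<bar>coeff h i \<omega>\<bar> \<le> K)"

definition simple_value :: "'a simple_process \<Rightarrow> real \<Rightarrow> 'a \<Rightarrow> real" where
  "simple_value h s \<omega> =
     (\<Sum>i<pieces h. coeff h i \<omega> * indicator {knot h i..<knot h (Suc i)} s)"

definition simple_ito_integral ::
    "(real \<Rightarrow> 'a \<Rightarrow> real) \<Rightarrow> 'a simple_process \<Rightarrow> real \<Rightarrow> 'a \<Rightarrow> real" where
  "simple_ito_integral B h t \<omega> =
     (\<Sum>i<pieces h. coeff h i \<omega> * (B (min t (knot h (Suc i))) \<omega> - B (min t (knot h i)) \<omega>))"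

text \<open>
  \<open>J\<close> is a version of the Ito integral of \<open>G\<close> over \<open>[0,t]\<close>, for measurable adapted integrands
  with almost surely square integrable paths. The Bochner integral in the approximation condition
  is a genuine one for almost every \<open>\<omega>\<close>, because the paths of \<open>G\<close> and of the bounded simple
  processes are square integrable on \<open>[0,t]\<close>.
\<close>

definition has_ito_integral ::
    "'a measure \<Rightarrow> (real \<Rightarrow> 'a measure) \<Rightarrow> (real \<Rightarrow> 'a \<Rightarrow> real) \<Rightarrow> (real \<Rightarrow> 'a \<Rightarrow> real) \<Rightarrow>
     real \<Rightarrow> ('a \<Rightarrow> real) \<Rightarrow> bool" where
  "has_ito_integral M F B G t J \<longleftrightarrow>
     measurable_process M G \<and> adapted_process F G \<and>
     (AE \<omega> in M. set_integrable lborel {0..t} (\<lambda>s. (G s \<omega>)\<^sup>2)) \<and>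
     (\<exists>h :: nat \<Rightarrow> 'a simple_process.
        (\<forall>n. adapted_simple M F (h n)) \<and>
        converges_in_probability M
          (\<lambda>n \<omega>. LINT s:{0..t}|lborel. (simple_value (h n) s \<omega> - G s \<omega>)\<^sup>2) (\<lambda>_. 0) \<and>
        converges_in_probability M (\<lambda>n. simple_ito_integral B (h n) t) J)"

text \<open>
  A strong solution of
  \<open>dX(t) = (a X(t) + b X(q t)) dt + (\<sigma> X(t) + \<rho> X(q t)) dB(t)\<close>, \<open>X(0) = X0\<close>.
\<close>

definition pantograph_solution ::
    "'a measure \<Rightarrow> (real \<Rightarrow> 'a \<Rightarrow> real) \<Rightarrow> ('a \<Rightarrow> real) \<Rightarrow> real \<Rightarrow> real \<Rightarrow> real \<Rightarrow> real \<Rightarrow> real \<Rightarrow>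
     (real \<Rightarrow> 'a \<Rightarrow> real) \<Rightarrow> bool" where
  "pantograph_solution M B X0 a b \<sigma> \<rho> q X \<longleftrightarrow>
     measurable_process M X \<and>
     adapted_process (natural_filtration M X0 B) X \<and>
     (AE \<omega> in M. continuous_on {0..} (\<lambda>t. X t \<omega>)) \<and>
     (AE \<omega> in M. X 0 \<omega> = X0 \<omega>) \<and>
     (\<exists>J. \<forall>t\<ge>0.
        has_ito_integral M (natural_filtration M X0 B) B
          (\<lambda>s \<omega>. \<sigma> * X s \<omega> + \<rho> * X (q * s) \<omega>) t (J t) \<and>
        (AE \<omega> in M. X t \<omega> =
           X0 \<omega> + (LINT s:{0..t}|lborel. a * X s \<omega> + b * X (q * s) \<omega>) + J t \<omega>))"

end

theory Submission
  imports Defs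
begin

text \<open>
  No Ito formula is used. The Ito integral is a limit in probability of Riemann sums along any grids
  with vanishing mesh, because a discrete stochastic integral is small in probability as soon as its
  quadratic variation is. Hence \<open>X t\<close> is a limit in probability of Euler sums started at any
  \<open>s \<le> t\<close>, and every second moment estimate follows from the discrete isometry and Fatou's lemma;
  finiteness of the second moment comes from cutting off where \<open>\<bar>X\<bar>\<close> has exceeded a level.

  Expanding over one short step gives upper right Dini derivatives:
  \<open>m = E \<bar>X\<bar>\<^sup>2\<close> satisfies
  \<open>m' \<le> (2a + \<sigma>\<^sup>2) m(t) + 2 \<bar>b + \<sigma>\<rho>\<bar> \<surd>(m(t) m(qt)) + \<rho>\<^sup>2 m(qt)\<close>, and for \<open>\<rho> = 0\<close> the
  mean \<open>p = E \<bar>X\<bar>\<close> satisfies \<open>p' \<le> a p(t) + \<bar>b\<bar> p(qt)\<close>. For a large shift \<open>c\<close> the function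
  \<open>(t + c) powr \<alpha>\<close> is a strict supersolution of these inequalities on the whole half-line.
\<close>

section \<open>Partitions and Brownian increments\<close>

text \<open>About the solution only path properties and limits in probability are known:
  \<open>has_ito_integral\<close> provides, for each time separately, one unspecified approximating
  sequence, with no moments and no continuity in time, so that optional stopping is not at hand.
  Euler sums on freely chosen grids have coefficients frozen at times when they are known, and there
  moments can be computed. For the second moment an expansion with error of order h^(3/2) results
  directly. For the mean, an Euler step is off by order h in L1, and its factor 1 + a h + \<sigma>
  (B t - B s) may be negative, so the absolute value does not pass. The second order term of the
  Milstein scheme repairs both defects; this works since for \<open>\<rho>\<close> = 0 the noise is
  a multiple of X alone, without delay. In the comparison the algebraic part vanishes on t powr
  \<alpha>, but a decaying power has a negative derivative, which must be dominated. Since q (t + c)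
  < q t + c, the shift gains a relative amount of order 1 / (t + c), the same order as the
  derivative, and a large c settles the constants.\<close>

lemma finite_set_enumeration:
  fixes D :: "real set"
  assumes "finite D" "D \<noteq> {}"
  obtains u :: "nat \<Rightarrow> real" and m where "strict_mono_on {..m} u" "u ` {..m} = D"
proof -
  define xs where "xs = sorted_list_of_set D"
  have xs: "sorted_wrt (<) xs" "set xs = D" "xs \<noteq> []"
    using assms by (auto simp: xs_def)
  have "{..length xs - 1} = {..<length xs}"
    using xs(3) by (cases xs) (auto simp: lessThan_Suc_atMost)
  then have "(!) xs ` {..length xs - 1} = D"
    using xs(2) nth_image[of "length xs" xs] by (simp add: lessThan_atLeast0)
  moreover have "strict_mono_on {..length xs - 1} ((!) xs)"
    using xs(1,3) by (cases xs) (auto simp: strict_mono_on_def sorted_wrt_iff_nth_less)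
  ultimately show thesis using that by blast
qed

lemma finite_set_enumeration_interval:
  fixes D :: "real set"
  assumes "finite D" "a \<in> D" "b \<in> D" "D \<subseteq> {a..b}"
  obtains u :: "nat \<Rightarrow> real" and m where "strict_mono_on {..m} u" "u ` {..m} = D" "u 0 = a" "u m = b"
proof -
  obtain u and m :: nat where u: "strict_mono_on {..m} u" "u ` {..m} = D"
  proof -
    have "D \<noteq> {}" using assms(2) by auto
    then show thesis using finite_set_enumeration[OF assms(1)] that by metis
  qed
  have m: "u 0 \<le> u i" "u i \<le> u m" if "i \<le> m" for i
    using strict_mono_on_leD[OF u(1)] that by auto
  have "u 0 \<in> D" "u m \<in> D"
    using u(2) by auto
  moreover obtain i j where "i \<le> m" "u i = a" "j \<le> m" "u j = b"
    using u(2) assms(2,3) by blast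
  ultimately have "u 0 = a" "u m = b"
    using m assms(4) by (metis atLeastAtMost_iff order_antisym subsetD)+
  then show thesis using that u by blast
qed

text \<open>Selecting the cells by a condition on their left ends, not by index bounds, makes the
  cells of a refinement that lie in [x, y) recognisable without knowing the indices of x and
  y.\<close>

lemma sum_increments_between:
  fixes f :: "real \<Rightarrow> 'b::ab_group_add" and u :: "nat \<Rightarrow> real"
  assumes u: "strict_mono_on {..m} u"
    and "x \<in> u ` {..m}" "y \<in> u ` {..m}" "x \<le> y"
  shows "(\<Sum>j | j < m \<and> x \<le> u j \<and> u j < y. f (u (Suc j)) - f (u j)) = f y - f x"
proof -
  obtain k l where kl: "k \<le> m" "x = u k" "l \<le> m" "y = u l"
    using assms by auto
  have le: "u i \<le> u j \<longleftrightarrow> i \<le> j" "u i < u j \<longleftrightarrow> i < j" if "i \<le> m" "j \<le> m" for i j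
    using strict_mono_on_less_eq[OF u, of i j] strict_mono_on_less[OF u, of i j] that by auto
  have "{j. j < m \<and> x \<le> u j \<and> u j < y} = {k..<l}"
    using kl by (auto simp: le)
  moreover have "k \<le> l" using le kl \<open>x \<le> y\<close> by simp
  ultimately show ?thesis
    using sum_Suc_diff'[of k l "\<lambda>j. f (u j)"] kl(2,4) by simp
qed

section \<open>Independence of Brownian increments from the enlarged filtration\<close>

locale wiener_with_initial = prob_space M
  for M :: "'a measure" +
  fixes B :: "real \<Rightarrow> 'a \<Rightarrow> real" and X0 :: "'a \<Rightarrow> real"
  assumes wiener: "wiener_process M B"
    and X0_measurable [measurable]: "X0 \<in> borel_measurable M"
    and X0_independent: "independent_of_process M X0 B"
begin

abbreviation \<F> :: "real \<Rightarrow> 'a measure" where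
  "\<F> \<equiv> natural_filtration M X0 B"

lemma B_measurable [measurable]: "0 \<le> t \<Longrightarrow> B t \<in> borel_measurable M"
  using wiener unfolding wiener_process_def by blast

lemma B_0: "AE \<omega> in M. B 0 \<omega> = 0"
  using wiener unfolding wiener_process_def by blast

lemma B_increment_distributed: "0 \<le> s \<Longrightarrow> s < t \<Longrightarrow>
    distributed M lborel (\<lambda>\<omega>. B t \<omega> - B s \<omega>) (normal_density 0 (sqrt (t - s)))"
  using wiener unfolding wiener_process_def by blast

lemma B_increments_indep: "0 \<le> u 0 \<Longrightarrow> (\<And>i. i < n \<Longrightarrow> u i \<le> u (Suc i)) \<Longrightarrow>
    indep_vars (\<lambda>_. borel) (\<lambda>i \<omega>. B (u (Suc i)) \<omega> - B (u i) \<omega>) {..<n}"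
  using wiener unfolding wiener_process_def by blast

text \<open>\<open>wiener_process\<close> only speaks about consecutive increments along a grid.
  Sorting the times of \<open>J\<close> together with 0 and s turns a condition on finitely many
  values of B into one on increments up to s, and these are independent of the increment after
  s.\<close>

lemma B_cylinder_indep_increment:
  assumes "0 \<le> s" "s \<le> t" "finite J" "J \<subseteq> {0..s}" and C: "\<And>v. C v \<in> sets borel"
    and U: "U \<in> sets borel"
  defines "H \<equiv> {\<omega> \<in> space M. B t \<omega> - B s \<omega> \<in> U}"
    and "E \<equiv> {\<omega> \<in> space M. \<forall>v\<in>J. B v \<omega> \<in> C v}"
  shows "prob (E \<inter> H) = prob E * prob H"
proof -
  have [simp]: "0 \<le> s" "0 \<le> t" using assms(1,2) by auto
  have J0: "0 \<le> v" if "v \<in> J" for v using that assms(4) by auto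
  obtain u0 and m :: nat where u0: "strict_mono_on {..m} u0" "u0 ` {..m} = insert 0 (insert s J)" "u0 0 = 0" "u0 m = s"
  proof -
    have "insert 0 (insert s J) \<subseteq> {0..s}" "finite (insert 0 (insert s J))"
      using assms(1-4) by auto
    then show thesis
      using finite_set_enumeration_interval[of "insert 0 (insert s J)" 0 s] that by blast
  qed
  \<comment> \<open>Appending t after the last time s makes \<open>Y m\<close> the increment from s
    to t, while \<open>Y i\<close> with i < m involves times up to s only.\<close>
  define u where "u = u0(Suc m := t)"
  define Y where "Y = (\<lambda>i \<omega>. B (u (Suc i)) \<omega> - B (u i) \<omega>)"
  have "indep_vars (\<lambda>_. borel) Y {..<Suc m}"
    unfolding Y_def
  proof (rule B_increments_indep)
    show "u i \<le> u (Suc i)" if "i < Suc m" for i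
      using that u0(4) \<open>s \<le> t\<close> strict_mono_on_leD[OF u0(1), of i "Suc i"]
      by (cases "i = m") (auto simp: u_def)
  qed (simp add: u_def u0)
  then have ind: "indep_var (PiM {..<m} (\<lambda>_. borel)) (\<lambda>\<omega>. \<lambda>i\<in>{..<m}. Y i \<omega>)
                     (PiM {m} (\<lambda>_. borel)) (\<lambda>\<omega>. \<lambda>i\<in>{m}. Y i \<omega>)"
    by (rule indep_var_restrict) auto
  define X where "X = {g \<in> space (PiM {..<m} (\<lambda>_. borel :: real measure)).
      \<forall>v\<in>J. (\<Sum>i | i < m \<and> 0 \<le> u0 i \<and> u0 i < v. g i) \<in> C v}"
  define Z where "Z = {g \<in> space (PiM {m} (\<lambda>_. borel :: real measure)). g m \<in> U}"
  have [measurable]: "\<And>v. C v \<in> sets borel" "U \<in> sets borel" "countable J"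
    using C U countable_finite[OF \<open>finite J\<close>] by auto
  have X: "X \<in> sets (PiM {..<m} (\<lambda>_. borel))"
    unfolding X_def using \<open>finite J\<close> by measurable
  have Z: "Z \<in> sets (PiM {m} (\<lambda>_. borel))"
    unfolding Z_def by measurable
  note * = indep_varD[OF ind X Z]
  have Ym: "Y m = (\<lambda>\<omega>. B t \<omega> - B s \<omega>)"
    by (simp add: Y_def u_def u0)
  have h: "(\<lambda>\<omega>. \<lambda>i\<in>{m}. Y i \<omega>) -` Z \<inter> space M = H"
    by (auto simp: Z_def H_def Ym space_PiM)
  \<comment> \<open>B starts at 0 only almost surely, so values are sums of increments only almost
    surely; the preimage of \<open>X\<close> agrees with \<open>E\<close> up to a null set.\<close>
  have B_eq: "B 0 \<omega> = 0 \<Longrightarrow> (\<Sum>i | i < m \<and> 0 \<le> u0 i \<and> u0 i < v. Y i \<omega>) = B v \<omega>" if "v \<in> J" for \<omega> v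
  proof -
    assume "B 0 \<omega> = 0"
    have "(\<Sum>i | i < m \<and> 0 \<le> u0 i \<and> u0 i < v. Y i \<omega>)
        = (\<Sum>i | i < m \<and> 0 \<le> u0 i \<and> u0 i < v. B (u0 (Suc i)) \<omega> - B (u0 i) \<omega>)"
      by (rule sum.cong) (auto simp: Y_def u_def)
    also have "\<dots> = B v \<omega> - B 0 \<omega>"
      using sum_increments_between[OF u0(1), of 0 v "\<lambda>x. B x \<omega>"] that u0(2) J0 by simp
    finally show ?thesis using \<open>B 0 \<omega> = 0\<close> by simp
  qed
  have ae: "AE \<omega> in M. \<omega> \<in> (\<lambda>\<omega>. \<lambda>i\<in>{..<m}. Y i \<omega>) -` X \<inter> space M \<longleftrightarrow> \<omega> \<in> E"
    using B_0
  proof eventually_elim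
    case (elim \<omega>)
    have "(\<Sum>i | i < m \<and> 0 \<le> u0 i \<and> u0 i < v. (\<lambda>i\<in>{..<m}. Y i \<omega>) i) = B v \<omega>" if "v \<in> J" for v
      by (subst B_eq[OF that elim, symmetric]) (rule sum.cong, auto)
    then show ?case
      by (auto simp: X_def E_def space_PiM)
  qed
  have [measurable]: "E \<in> events"
    unfolding E_def using J0 \<open>finite J\<close> by measurable
  have [measurable]: "H \<in> events"
    unfolding H_def by measurable
  have rv: "random_variable (PiM {..<m} (\<lambda>_. borel)) (\<lambda>\<omega>. \<lambda>i\<in>{..<m}. Y i \<omega>)"
    using indep_var_rv1[OF ind] .
  have ev: "(\<lambda>\<omega>. \<lambda>i\<in>{..<m}. Y i \<omega>) -` X \<inter> space M \<in> events"
    by (rule measurable_sets[OF rv X])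
  have 1: "prob ((\<lambda>\<omega>. \<lambda>i\<in>{..<m}. Y i \<omega>) -` X \<inter> space M) = prob E"
    by (rule finite_measure_eq_AE[OF ae ev]) simp
  have eq: "(\<lambda>x. (\<lambda>i\<in>{..<m}. Y i x, \<lambda>i\<in>{m}. Y i x)) -` (X \<times> Z) \<inter> space M
     = ((\<lambda>\<omega>. \<lambda>i\<in>{..<m}. Y i \<omega>) -` X \<inter> space M) \<inter> H"
    unfolding h[symmetric] by auto
  have 2: "prob (((\<lambda>\<omega>. \<lambda>i\<in>{..<m}. Y i \<omega>) -` X \<inter> space M) \<inter> H) = prob (E \<inter> H)"
    by (rule finite_measure_eq_AE) (use ae ev in \<open>auto elim!: eventually_mono\<close>)
  show ?thesis
    using * unfolding eq h 1 2 .
qed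

lemma space_filtration [simp]: "space (\<F> t) = space M"
  by (simp add: natural_filtration_def space_measure_of_conv)

lemma filtration_generators_subset:
  "{X0 -` A \<inter> space M | A. A \<in> sets borel} \<union>
   {B s -` A \<inter> space M | s A. 0 \<le> s \<and> s \<le> t \<and> A \<in> sets borel} \<union> null_sets M \<subseteq> events"
  using measurable_sets[OF X0_measurable] measurable_sets[OF B_measurable] by (auto simp: null_sets_def)

lemma sets_filtration:
  "sets (\<F> t) = sigma_sets (space M)
     ({X0 -` A \<inter> space M | A. A \<in> sets borel} \<union>
      {B s -` A \<inter> space M | s A. 0 \<le> s \<and> s \<le> t \<and> A \<in> sets borel} \<union> null_sets M)"
  unfolding natural_filtration_def
  by (rule sets_measure_of) (use filtration_generators_subset sets.sets_into_space in blast)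

lemma sets_filtration_subset: "sets (\<F> t) \<subseteq> events"
  unfolding sets_filtration by (rule sets.sigma_sets_subset) (rule filtration_generators_subset)

lemma sets_filtration_mono: "s \<le> t \<Longrightarrow> sets (\<F> s) \<subseteq> sets (\<F> t)"
  unfolding sets_filtration
  by (intro sigma_sets_mono' Un_mono subset_refl Collect_mono) (blast intro: order_trans)

lemma measurable_filtration_mono: "Z \<in> borel_measurable (\<F> s) \<Longrightarrow> s \<le> t \<Longrightarrow> Z \<in> borel_measurable (\<F> t)"
  using sets_filtration_mono by (auto simp: measurable_def)

lemma measurable_filtration_M: "Z \<in> borel_measurable (\<F> s) \<Longrightarrow> Z \<in> borel_measurable M"
  using sets_filtration_subset by (auto simp: measurable_def)

lemma B_measurable_filtration: "0 \<le> s \<Longrightarrow> s \<le> t \<Longrightarrow> B s \<in> borel_measurable (\<F> t)"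
  by (auto simp: measurable_def sets_filtration intro!: sigma_sets.Basic)

text \<open>Null sets among the generators stand in the way of an intersection-stable generator made
  of cylinders. Agreement up to a null set is preserved by complements and countable unions, so each
  event of \<open>\<F> s\<close> can be exchanged for one generated by cylinders.\<close>

lemma filtration_set_AE_eq:
  assumes "E \<in> sets (\<F> s)"
  shows "\<exists>E' \<in> sigma_sets (space M)
      {{\<omega> \<in> space M. X0 \<omega> \<in> A \<and> (\<forall>v\<in>J. B v \<omega> \<in> C v)} | A J C.
         A \<in> sets borel \<and> finite J \<and> J \<subseteq> {0..s} \<and> (\<forall>v. C v \<in> sets borel)}.
     AE \<omega> in M. \<omega> \<in> E \<longleftrightarrow> \<omega> \<in> E'"
  (is "\<exists>E' \<in> sigma_sets _ ?G. _")
  using assms unfolding sets_filtration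
proof (induction rule: sigma_sets.induct)
  case (Basic E)
  then consider A where "A \<in> sets borel" "E = X0 -` A \<inter> space M"
    | v A where "0 \<le> v" "v \<le> s" "A \<in> sets borel" "E = B v -` A \<inter> space M"
    | "E \<in> null_sets M" by blast
  then show ?case
  proof cases
    case 1
    have "E = {\<omega> \<in> space M. X0 \<omega> \<in> A \<and> (\<forall>v\<in>{}. B v \<omega> \<in> UNIV)}"
      using 1 by auto
    then have "E \<in> ?G" using 1 by (intro CollectI exI[of _ A] exI[of _ "{}"] exI[of _ "\<lambda>_. UNIV"]) auto
    then show ?thesis by (intro bexI[of _ E] sigma_sets.Basic) auto
  next
    case 2
    have "E = {\<omega> \<in> space M. X0 \<omega> \<in> UNIV \<and> (\<forall>v\<in>{v}. B v \<omega> \<in> A)}"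
      using 2 by auto
    then have "E \<in> ?G" using 2 by (intro CollectI exI[of _ UNIV] exI[of _ "{v}"] exI[of _ "\<lambda>_. A"]) auto
    then show ?thesis by (intro bexI[of _ E] sigma_sets.Basic) auto
  next
    case 3
    then show ?thesis by (intro bexI[of _ "{}"] sigma_sets.Empty) (use AE_not_in[OF 3] in auto)
  qed
next
  case Empty
  show ?case by (intro bexI[of _ "{}"] sigma_sets.Empty) auto
next
  case (Compl E)
  then obtain E' where "E' \<in> sigma_sets (space M) ?G" "AE \<omega> in M. \<omega> \<in> E \<longleftrightarrow> \<omega> \<in> E'" by blast
  then show ?case
    by (intro bexI[of _ "space M - E'"] sigma_sets.Compl) (auto elim!: eventually_mono)
next
  case (Union E)
  then have "\<forall>i. \<exists>E'. E' \<in> sigma_sets (space M) ?G \<and> (AE \<omega> in M. \<omega> \<in> E i \<longleftrightarrow> \<omega> \<in> E')" by blast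
  from choice[OF this] obtain E' where E': "\<And>i. E' i \<in> sigma_sets (space M) ?G"
    "\<And>i. AE \<omega> in M. \<omega> \<in> E i \<longleftrightarrow> \<omega> \<in> E' i" by blast
  have "AE \<omega> in M. \<forall>i. \<omega> \<in> E i \<longleftrightarrow> \<omega> \<in> E' i"
    using E'(2) by (simp add: AE_all_countable)
  then show ?case
    by (intro bexI[of _ "\<Union>i. E' i"] sigma_sets.Union E') (auto elim!: eventually_mono)
qed

text \<open>The orthogonality in all discrete stochastic integrals rests on this. Cylinders that
  also restrict X0 are stable under intersection; for them independence is checked in two stages, X0
  against the path and past increments against the next one. It extends to the generated
  sigma-algebra, and to \<open>\<F> s\<close> by \<open>filtration_set_AE_eq\<close>.\<close>

lemma filtration_indep_increment:
  assumes "0 \<le> s" "s \<le> t" and Z: "Z \<in> borel_measurable (\<F> s)"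
  shows "indep_var borel Z borel (\<lambda>\<omega>. B t \<omega> - B s \<omega>)"
proof -
  define H where "H U = {\<omega> \<in> space M. B t \<omega> - B s \<omega> \<in> U}" for U
  define G where "G = {{\<omega> \<in> space M. X0 \<omega> \<in> A \<and> (\<forall>v\<in>J. B v \<omega> \<in> C v)} | A J C.
     A \<in> sets borel \<and> finite J \<and> J \<subseteq> {0..s} \<and> (\<forall>v. C v \<in> sets borel)}"
  have [simp]: "0 \<le> t" "0 \<le> s" using assms by auto
  have [measurable]: "Z \<in> borel_measurable M" by (rule measurable_filtration_M[OF Z])
  have H_ev [measurable]: "H U \<in> events" if [measurable]: "U \<in> sets borel" for U
    unfolding H_def by measurable
  \<comment> \<open>The sigma-algebra of the path of B in which
    \<open>independent_of_process\<close> is phrased; cylinders in B and events about increments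
    belong to it.\<close>
  define \<B> where "\<B> = vimage_algebra (space M) (\<lambda>\<omega>. \<lambda>t\<in>{0..}. B t \<omega>) (Pi\<^sub>M {0..} (\<lambda>_. borel :: real measure))"
  have B\<B> [measurable]: "B v \<in> borel_measurable \<B>" if "0 \<le> v" for v
  proof -
    have "(\<lambda>\<omega>. \<lambda>t\<in>{0..}. B t \<omega>) \<in> measurable \<B> (Pi\<^sub>M {0..} (\<lambda>_. borel))"
      unfolding \<B>_def by (rule measurable_vimage_algebra1) (auto simp: space_PiM)
    from measurable_compose[OF this measurable_component_singleton[of v]] show ?thesis
      using that by simp
  qed
  have space_\<B> [simp]: "space \<B> = space M" by (simp add: \<B>_def)
  have X0_ind: "prob ({\<omega> \<in> space M. X0 \<omega> \<in> A} \<inter> E) = prob {\<omega> \<in> space M. X0 \<omega> \<in> A} * prob E"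
    if "A \<in> sets borel" "E \<in> sets \<B>" for A E
  proof (rule indep_setD)
    show "indep_set (sets (vimage_algebra (space M) X0 borel)) (sets \<B>)"
      using X0_independent by (simp add: independent_of_process_def \<B>_def)
    have "X0 -` A \<inter> space M \<in> sets (vimage_algebra (space M) X0 borel)"
      by (rule in_vimage_algebra) fact
    also have "X0 -` A \<inter> space M = {\<omega> \<in> space M. X0 \<omega> \<in> A}" by auto
    finally show "{\<omega> \<in> space M. X0 \<omega> \<in> A} \<in> sets (vimage_algebra (space M) X0 borel)" .
  qed fact
  have "indep_set G (H ` sets borel)"
  proof (rule indep_setI)
    show "G \<subseteq> events"
    proof
      fix E assume "E \<in> G"
      then obtain A J C where E: "E = {\<omega> \<in> space M. X0 \<omega> \<in> A \<and> (\<forall>v\<in>J. B v \<omega> \<in> C v)}"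
        "A \<in> sets borel" "finite J" "J \<subseteq> {0..s}" "\<forall>v. C v \<in> sets borel"
        unfolding G_def by blast
      have [measurable]: "A \<in> sets borel" "\<And>v. C v \<in> sets borel" using E by auto
      have J0: "0 \<le> v" if "v \<in> J" for v using that E by auto
      show "E \<in> events"
        unfolding E(1) using \<open>finite J\<close> J0 by measurable
    qed
    show "H ` sets borel \<subseteq> events" by auto
    fix E E' assume "E \<in> G" "E' \<in> H ` sets borel"
    then obtain U where U [measurable]: "U \<in> sets borel" and E': "E' = H U" by auto
    obtain A J C where E: "E = {\<omega> \<in> space M. X0 \<omega> \<in> A \<and> (\<forall>v\<in>J. B v \<omega> \<in> C v)}"
      "A \<in> sets borel" "finite J" "J \<subseteq> {0..s}" and C: "\<And>v. C v \<in> sets borel"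
      using \<open>E \<in> G\<close> unfolding G_def by blast
    have [measurable]: "A \<in> sets borel" "\<And>v. C v \<in> sets borel" using E C by auto
    have J0: "0 \<le> v" if "v \<in> J" for v using that E by auto
    define K where "K = {\<omega> \<in> space M. \<forall>v\<in>J. B v \<omega> \<in> C v}"
    have K: "K = {\<omega> \<in> space \<B>. \<forall>v\<in>J. B v \<omega> \<in> C v}" by (simp add: K_def)
    have K\<B>: "K \<in> sets \<B>" unfolding K using \<open>finite J\<close> J0 by measurable
    have H: "H U = {\<omega> \<in> space \<B>. B t \<omega> - B s \<omega> \<in> U}" by (simp add: H_def)
    have H\<B>: "H U \<in> sets \<B>" unfolding H by measurable
    \<comment> \<open>X0 is split off against the path event \<open>K \<inter> H U\<close> as a
      whole; \<open>K\<close> and \<open>H U\<close> are separated afterwards.\<close>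
    have "E \<inter> E' = {\<omega> \<in> space M. X0 \<omega> \<in> A} \<inter> (K \<inter> H U)" "E = {\<omega> \<in> space M. X0 \<omega> \<in> A} \<inter> K"
      unfolding E E' K_def by auto
    moreover have "prob (K \<inter> H U) = prob K * prob (H U)"
      unfolding K_def H_def by (rule B_cylinder_indep_increment[OF assms(1,2) E(3,4) C U])
    ultimately show "prob (E \<inter> E') = prob E * prob E'"
      using X0_ind[OF E(2) K\<B>] X0_ind[OF E(2) sets.Int[OF K\<B> H\<B>]] E' by simp
  qed
  moreover have "Int_stable G"
  proof (rule Int_stableI)
    fix E E' assume "E \<in> G" "E' \<in> G"
    then obtain A J C A' J' C' where E: "E = {\<omega> \<in> space M. X0 \<omega> \<in> A \<and> (\<forall>v\<in>J. B v \<omega> \<in> C v)}"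
      "A \<in> sets borel" "finite J" "J \<subseteq> {0..s}" "\<forall>v. C v \<in> sets borel"
      and E': "E' = {\<omega> \<in> space M. X0 \<omega> \<in> A' \<and> (\<forall>v\<in>J'. B v \<omega> \<in> C' v)}"
      "A' \<in> sets borel" "finite J'" "J' \<subseteq> {0..s}" "\<forall>v. C' v \<in> sets borel"
      unfolding G_def by blast
    \<comment> \<open>A time restricted by only one of the two cylinders gets the vacuous condition
      \<open>UNIV\<close> from the other.\<close>
    have eq: "E \<inter> E' = {\<omega> \<in> space M. X0 \<omega> \<in> A \<inter> A' \<and>
        (\<forall>v\<in>J \<union> J'. B v \<omega> \<in> (if v \<in> J then C v else UNIV) \<inter> (if v \<in> J' then C' v else UNIV))}"
      unfolding E(1) E'(1) by auto
    show "E \<inter> E' \<in> G"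
      unfolding G_def eq using E E'
      by (intro CollectI exI[of _ "A \<inter> A'"] exI[of _ "J \<union> J'"]
          exI[of _ "\<lambda>v. (if v \<in> J then C v else UNIV) \<inter> (if v \<in> J' then C' v else UNIV)"]) auto
  qed
  moreover have "Int_stable (H ` sets borel)"
  proof (rule Int_stableI)
    fix E E' assume "E \<in> H ` sets borel" "E' \<in> H ` sets borel"
    then obtain U U' where "U \<in> sets borel" "U' \<in> sets borel" "E = H U" "E' = H U'" by auto
    then show "E \<inter> E' \<in> H ` sets borel"
      by (intro image_eqI[of _ _ "U \<inter> U'"]) (auto simp: H_def)
  qed
  ultimately have ind: "indep_set (sigma_sets (space M) G) (sigma_sets (space M) (H ` sets borel))"
    by (rule indep_set_sigma_sets)
  have main: "prob (E \<inter> H U) = prob E * prob (H U)" if E: "E \<in> sets (\<F> s)" and U [measurable]: "U \<in> sets borel" for E U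
  proof -
    obtain E' where E': "E' \<in> sigma_sets (space M) G" "AE \<omega> in M. \<omega> \<in> E \<longleftrightarrow> \<omega> \<in> E'"
      using filtration_set_AE_eq[OF E] unfolding G_def by blast
    have [measurable]: "E' \<in> events" "E \<in> events"
      using indep_setD_ev1[OF ind] E'(1) E sets_filtration_subset by auto
    have "prob (E' \<inter> H U) = prob E' * prob (H U)"
      by (rule indep_setD[OF ind E'(1)]) (use that in auto)
    moreover have "prob (E' \<inter> H U) = prob (E \<inter> H U)" "prob E' = prob E"
      by (rule finite_measure_eq_AE; use E'(2) in \<open>auto elim!: eventually_mono\<close>)+
    ultimately show ?thesis by simp
  qed
  have vimage: "(\<lambda>\<omega>. B t \<omega> - B s \<omega>) -` U \<inter> space M = H U" for U
    by (auto simp: H_def)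
  show ?thesis
    unfolding indep_var_eq
  proof (intro conjI indep_set_sigma_sets indep_setI)
    show "Int_stable {Z -` A \<inter> space M |A. A \<in> sets borel}"
    proof (rule Int_stableI)
      fix E E' assume "E \<in> {Z -` A \<inter> space M |A. A \<in> sets borel}" "E' \<in> {Z -` A \<inter> space M |A. A \<in> sets borel}"
      then obtain A A' where "A \<in> sets borel" "A' \<in> sets borel" "E = Z -` A \<inter> space M" "E' = Z -` A' \<inter> space M"
        by auto
      then show "E \<inter> E' \<in> {Z -` A \<inter> space M |A. A \<in> sets borel}"
        by (intro CollectI exI[of _ "A \<inter> A'"]) auto
    qed
    have "{(\<lambda>\<omega>. B t \<omega> - B s \<omega>) -` A \<inter> space M |A. A \<in> sets borel} = H ` sets borel"
      unfolding vimage by blast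
    then show "Int_stable {(\<lambda>\<omega>. B t \<omega> - B s \<omega>) -` A \<inter> space M |A. A \<in> sets borel}"
      using \<open>Int_stable (H ` sets borel)\<close> by (simp only:)
    fix a b assume "a \<in> {Z -` A \<inter> space M |A. A \<in> sets borel}"
      "b \<in> {(\<lambda>\<omega>. B t \<omega> - B s \<omega>) -` A \<inter> space M |A. A \<in> sets borel}"
    then obtain A U where "A \<in> sets borel" "U \<in> sets borel" "a = Z -` A \<inter> space M" "b = H U"
      unfolding vimage by blast
    then show "prob (a \<inter> b) = prob a * prob b"
      using main[of a U] measurable_sets[OF Z, of A] by auto
  qed auto
qed

end

section \<open>Square integrability and discrete stochastic integrals\<close>

text \<open>Over an arbitrary measure, because it serves for random variables and, with
  \<open>lborel\<close>, for paths as functions of time.\<close>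

definition square_integrable :: "'a measure \<Rightarrow> ('a \<Rightarrow> real) \<Rightarrow> bool" where
  "square_integrable M Z \<longleftrightarrow> Z \<in> borel_measurable M \<and> integrable M (\<lambda>\<omega>. (Z \<omega>)\<^sup>2)"

lemma square_integrableD:
  assumes "square_integrable M Z"
  shows "Z \<in> borel_measurable M" "integrable M (\<lambda>\<omega>. (Z \<omega>)\<^sup>2)"
  using assms by (auto simp: square_integrable_def)

lemma square_integrable_mult_integrable:
  assumes "square_integrable M X" "square_integrable M Y"
  shows "integrable M (\<lambda>\<omega>. X \<omega> * Y \<omega>)"
proof (rule Bochner_Integration.integrable_bound)
  show "integrable M (\<lambda>\<omega>. (X \<omega>)\<^sup>2 + (Y \<omega>)\<^sup>2)"
    using assms by (auto simp: square_integrable_def)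
  have "\<bar>x * y\<bar> \<le> x\<^sup>2 + y\<^sup>2" for x y :: real
    using sum_squares_bound[of "\<bar>x\<bar>" "\<bar>y\<bar>"] zero_le_power2[of x] mult_nonneg_nonneg[of "\<bar>x\<bar>" "\<bar>y\<bar>"]
    by (simp add: abs_mult del: mult_nonneg_nonneg zero_le_mult_iff)
  then show "AE \<omega> in M. norm (X \<omega> * Y \<omega>) \<le> norm ((X \<omega>)\<^sup>2 + (Y \<omega>)\<^sup>2)"
    by simp
qed (use assms in \<open>auto simp: square_integrable_def\<close>)

lemma square_integrable_cmult [intro]:
  "square_integrable M X \<Longrightarrow> square_integrable M (\<lambda>\<omega>. c * X \<omega>)"
  by (auto simp: square_integrable_def power_mult_distrib)

lemma square_integrable_add [intro]:
  assumes "square_integrable M X" "square_integrable M Y"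
  shows "square_integrable M (\<lambda>\<omega>. X \<omega> + Y \<omega>)"
  using assms square_integrable_mult_integrable[OF assms]
  by (auto simp: square_integrable_def power2_sum mult.assoc)

lemma square_integrable_diff [intro]:
  assumes "square_integrable M X" "square_integrable M Y"
  shows "square_integrable M (\<lambda>\<omega>. X \<omega> - Y \<omega>)"
  using square_integrable_add[OF assms(1) square_integrable_cmult[OF assms(2), of "-1"]] by simp

lemma square_integrable_zero [intro]: "square_integrable M (\<lambda>_. 0)"
  by (simp add: square_integrable_def)

lemma square_integrable_sum [intro]:
  "(\<And>i. i \<in> I \<Longrightarrow> square_integrable M (X i)) \<Longrightarrow> square_integrable M (\<lambda>\<omega>. \<Sum>i\<in>I. X i \<omega>)"
  by (induction I rule: infinite_finite_induct) auto

lemma (in finite_measure) square_integrable_integrable: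
  "square_integrable M X \<Longrightarrow> integrable M X"
  using square_integrable_imp_integrable by (auto simp: square_integrable_def)

text \<open>Comes from the nonnegativity of E (X + t Y)^2 as a quadratic polynomial in t, evaluated
  at its minimiser.\<close>

lemma Cauchy_Schwarz_expectation:
  assumes X: "square_integrable M X" and Y: "square_integrable M Y"
  shows "\<bar>\<integral>\<omega>. X \<omega> * Y \<omega> \<partial>M\<bar> \<le> sqrt (\<integral>\<omega>. (X \<omega>)\<^sup>2 \<partial>M) * sqrt (\<integral>\<omega>. (Y \<omega>)\<^sup>2 \<partial>M)"
proof -
  let ?a = "\<integral>\<omega>. (X \<omega>)\<^sup>2 \<partial>M" and ?b = "\<integral>\<omega>. X \<omega> * Y \<omega> \<partial>M" and ?c = "\<integral>\<omega>. (Y \<omega>)\<^sup>2 \<partial>M"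
  have q: "0 \<le> ?a + 2 * t * ?b + t\<^sup>2 * ?c" for t :: real
  proof -
    have "0 \<le> (\<integral>\<omega>. (X \<omega> + t * Y \<omega>)\<^sup>2 \<partial>M)"
      by simp
    also have "\<dots> = (\<integral>\<omega>. (X \<omega>)\<^sup>2 + 2 * t * (X \<omega> * Y \<omega>) + t\<^sup>2 * (Y \<omega>)\<^sup>2 \<partial>M)"
      by (intro Bochner_Integration.integral_cong) (auto simp: power2_eq_square algebra_simps)
    also have "\<dots> = ?a + 2 * t * ?b + t\<^sup>2 * ?c"
      using square_integrableD(2)[OF X] square_integrableD(2)[OF Y] square_integrable_mult_integrable[OF X Y]
      by simp
    finally show ?thesis .
  qed
  have "?b\<^sup>2 \<le> ?a * ?c"
  proof (cases "?c = 0")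
    case True
    have "?b = 0"
    proof (rule ccontr)
      \<comment> \<open>Without a quadratic term the polynomial is affine, and with a nonzero slope
        it would take the value -1 at t = - (?a + 1) / (2 ?b).\<close>
      assume "?b \<noteq> 0"
      then have "0 \<le> ?a + (- (2 * ?a) - 2) / 2"
        using q[of "- (?a + 1) / (2 * ?b)"] True by simp
      then show False by (simp add: diff_divide_distrib)
    qed
    then show ?thesis using True by simp
  next
    case False
    then have "0 < ?c" by (simp add: order_less_le)
    then show ?thesis
      using q[of "- ?b / ?c"] by (simp add: field_simps power2_eq_square)
  qed
  then have "sqrt (?b\<^sup>2) \<le> sqrt (?a * ?c)" by (rule real_sqrt_le_mono)
  then show ?thesis by (simp add: real_sqrt_mult)
qed

lemma (in prob_space) expectation_abs_le_sqrt:
  assumes "square_integrable M X"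
  shows "expectation (\<lambda>\<omega>. \<bar>X \<omega>\<bar>) \<le> sqrt (expectation (\<lambda>\<omega>. (X \<omega>)\<^sup>2))"
proof -
  have 1: "square_integrable M (\<lambda>\<omega>. \<bar>X \<omega>\<bar>)" "square_integrable M (\<lambda>_. 1)"
    using assms by (auto simp: square_integrable_def)
  show ?thesis
    using Cauchy_Schwarz_expectation[OF 1] by (simp add: prob_space)
qed

lemma expectation_square_add_le:
  assumes X: "square_integrable M X" and Y: "square_integrable M Y"
  shows "(\<integral>\<omega>. (X \<omega> + Y \<omega>)\<^sup>2 \<partial>M) \<le> 2 * (\<integral>\<omega>. (X \<omega>)\<^sup>2 \<partial>M) + 2 * (\<integral>\<omega>. (Y \<omega>)\<^sup>2 \<partial>M)"
proof -
  have "(x + y)\<^sup>2 \<le> 2 * x\<^sup>2 + 2 * y\<^sup>2" for x y :: real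
    using sum_squares_bound[of x y] by (simp add: power2_sum)
  then have "(\<integral>\<omega>. (X \<omega> + Y \<omega>)\<^sup>2 \<partial>M) \<le> (\<integral>\<omega>. 2 * (X \<omega>)\<^sup>2 + 2 * (Y \<omega>)\<^sup>2 \<partial>M)"
    using square_integrableD(2)[OF X] square_integrableD(2)[OF Y] square_integrableD(2)[OF square_integrable_add[OF X Y]]
    by (intro integral_mono) auto
  then show ?thesis
    using square_integrableD(2)[OF X] square_integrableD(2)[OF Y] by simp
qed

section \<open>Moments of increments and discrete stochastic integrals\<close>

context wiener_with_initial
begin

lemma B_increment_power_integrable:
  assumes "0 \<le> s" "s \<le> t"
  shows "integrable M (\<lambda>\<omega>. (B t \<omega> - B s \<omega>) ^ k)"
proof (cases "s = t")
  case False
  then have d: "distributed M lborel (\<lambda>\<omega>. B t \<omega> - B s \<omega>) (normal_density 0 (sqrt (t - s)))"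
    using assms B_increment_distributed by auto
  have "integrable lborel (\<lambda>x. normal_density 0 (sqrt (t - s)) x * x ^ k)"
    using integrable_normal_moment[of "sqrt (t - s)" 0 k] False assms by simp
  then show ?thesis
    using distributed_integrable[OF d, of "\<lambda>x. x ^ k"] by simp
qed simp

lemma B_increment_moments:
  assumes "0 \<le> s" "s \<le> t"
  shows "expectation (\<lambda>\<omega>. B t \<omega> - B s \<omega>) = 0"
    and "expectation (\<lambda>\<omega>. (B t \<omega> - B s \<omega>)\<^sup>2) = t - s"
    and "expectation (\<lambda>\<omega>. (B t \<omega> - B s \<omega>) ^ 4) = 3 * (t - s)\<^sup>2"
proof -
  have "expectation (\<lambda>\<omega>. B t \<omega> - B s \<omega>) = 0 \<and> expectation (\<lambda>\<omega>. (B t \<omega> - B s \<omega>)\<^sup>2) = t - s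
    \<and> expectation (\<lambda>\<omega>. (B t \<omega> - B s \<omega>) ^ 4) = 3 * (t - s)\<^sup>2"
  proof (cases "s = t")
    case False
    then have d: "distributed M lborel (\<lambda>\<omega>. B t \<omega> - B s \<omega>) (normal_density 0 (sqrt (t - s)))"
      and pos: "0 < sqrt (t - s)"
      using assms B_increment_distributed by auto
    have eq: "expectation (\<lambda>\<omega>. (B t \<omega> - B s \<omega>) ^ k) = (\<integral>x. normal_density 0 (sqrt (t - s)) x * x ^ k \<partial>lborel)" for k
      using distributed_integral[OF d, of "\<lambda>x. x ^ k"] by simp
    have "expectation (\<lambda>\<omega>. (B t \<omega> - B s \<omega>) ^ (2 * 1)) = t - s"
      using has_bochner_integral_integral_eq[OF normal_moment_even[OF pos, of 0 1]] False assms
      unfolding eq by (simp add: fact_numeral)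
    moreover have "expectation (\<lambda>\<omega>. (B t \<omega> - B s \<omega>) ^ (2 * 2)) = 3 * (t - s)\<^sup>2"
      using has_bochner_integral_integral_eq[OF normal_moment_even[OF pos, of 0 2]] False assms
      unfolding eq by (simp add: fact_numeral power_divide power2_eq_square field_simps)
    moreover have "expectation (\<lambda>\<omega>. (B t \<omega> - B s \<omega>) ^ 1) = 0"
      using integral_normal_moment_nz_1[OF pos, of 0]
      unfolding eq by simp
    ultimately show ?thesis by simp
  qed simp
  then show "expectation (\<lambda>\<omega>. B t \<omega> - B s \<omega>) = 0" "expectation (\<lambda>\<omega>. (B t \<omega> - B s \<omega>)\<^sup>2) = t - s"
    "expectation (\<lambda>\<omega>. (B t \<omega> - B s \<omega>) ^ 4) = 3 * (t - s)\<^sup>2"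
    by auto
qed

text \<open>Independence enters the moment computations through this product rule. The powers 1, 2
  and 4 yield vanishing cross terms, the isometry, and the variance of squared increments.\<close>

lemma filtration_mult_increment_power:
  assumes "0 \<le> s" "s \<le> t" and Z: "Z \<in> borel_measurable (\<F> s)" "integrable M Z"
  shows "integrable M (\<lambda>\<omega>. Z \<omega> * (B t \<omega> - B s \<omega>) ^ k)"
    and "expectation (\<lambda>\<omega>. Z \<omega> * (B t \<omega> - B s \<omega>) ^ k)
      = expectation Z * expectation (\<lambda>\<omega>. (B t \<omega> - B s \<omega>) ^ k)"
proof -
  have "indep_var borel (id \<circ> Z) borel ((\<lambda>x. x ^ k) \<circ> (\<lambda>\<omega>. B t \<omega> - B s \<omega>))"
    by (rule indep_var_compose[OF filtration_indep_increment[OF assms(1-3)]]) auto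
  then have ind: "indep_var borel Z borel (\<lambda>\<omega>. (B t \<omega> - B s \<omega>) ^ k)"
    by (simp add: comp_def)
  show "integrable M (\<lambda>\<omega>. Z \<omega> * (B t \<omega> - B s \<omega>) ^ k)"
    by (rule indep_var_integrable[OF ind Z(2) B_increment_power_integrable[OF assms(1,2)]])
  show "expectation (\<lambda>\<omega>. Z \<omega> * (B t \<omega> - B s \<omega>) ^ k)
      = expectation Z * expectation (\<lambda>\<omega>. (B t \<omega> - B s \<omega>) ^ k)"
    by (rule indep_var_lebesgue_integral[OF ind Z(2) B_increment_power_integrable[OF assms(1,2)]])
qed

lemma square_integrable_mult_increment:
  assumes "0 \<le> s" "s \<le> t" and Z: "Z \<in> borel_measurable (\<F> s)" "square_integrable M Z"
  shows "square_integrable M (\<lambda>\<omega>. Z \<omega> * (B t \<omega> - B s \<omega>))"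
    and "expectation (\<lambda>\<omega>. (Z \<omega> * (B t \<omega> - B s \<omega>))\<^sup>2) = expectation (\<lambda>\<omega>. (Z \<omega>)\<^sup>2) * (t - s)"
proof -
  have Z2: "(\<lambda>\<omega>. (Z \<omega>)\<^sup>2) \<in> borel_measurable (\<F> s)" using Z(1) by measurable
  have [simp]: "0 \<le> t" "0 \<le> s" using assms by auto
  have [measurable]: "Z \<in> borel_measurable M" using Z(2) by (simp add: square_integrable_def)
  note * = filtration_mult_increment_power[OF assms(1,2) Z2 square_integrableD(2)[OF Z(2)], of 2]
  show "square_integrable M (\<lambda>\<omega>. Z \<omega> * (B t \<omega> - B s \<omega>))"
    using * by (simp add: square_integrable_def power_mult_distrib)
  show "expectation (\<lambda>\<omega>. (Z \<omega> * (B t \<omega> - B s \<omega>))\<^sup>2) = expectation (\<lambda>\<omega>. (Z \<omega>)\<^sup>2) * (t - s)"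
    using * B_increment_moments(2)[OF assms(1,2)] by (simp add: power_mult_distrib)
qed

lemma martingale_transform:
  assumes "0 \<le> v 0" and v: "\<And>i. i < m \<Longrightarrow> v i \<le> v (Suc i)"
    and c: "\<And>i. i < m \<Longrightarrow> c i \<in> borel_measurable (\<F> (v i))"
    and Z: "Z \<in> borel_measurable (\<F> (v 0))"
  shows "0 \<le> v m \<and> v 0 \<le> v m \<and> (\<lambda>\<omega>. Z \<omega> + (\<Sum>i<m. c i \<omega> * (B (v (Suc i)) \<omega> - B (v i) \<omega>))) \<in> borel_measurable (\<F> (v m))"
  using v c
proof (induction m)
  case (Suc m)
  then have IH: "0 \<le> v m" "v 0 \<le> v m"
    "(\<lambda>\<omega>. Z \<omega> + (\<Sum>i<m. c i \<omega> * (B (v (Suc i)) \<omega> - B (v i) \<omega>))) \<in> borel_measurable (\<F> (v m))"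
    by auto
  have mm: "v m \<le> v (Suc m)" using Suc by auto
  have v1: "0 \<le> v (Suc m)" using IH mm by linarith
  have [measurable]: "(\<lambda>\<omega>. Z \<omega> + (\<Sum>i<m. c i \<omega> * (B (v (Suc i)) \<omega> - B (v i) \<omega>))) \<in> borel_measurable (\<F> (v (Suc m)))"
    "B (v (Suc m)) \<in> borel_measurable (\<F> (v (Suc m)))" "B (v m) \<in> borel_measurable (\<F> (v (Suc m)))"
    "c m \<in> borel_measurable (\<F> (v (Suc m)))"
    using IH mm v1 Suc.prems by (auto intro: measurable_filtration_mono[OF IH(3)] B_measurable_filtration
      measurable_filtration_mono[of "c m" "v m"])
  have "(\<lambda>\<omega>. (Z \<omega> + (\<Sum>i<m. c i \<omega> * (B (v (Suc i)) \<omega> - B (v i) \<omega>))) + c m \<omega> * (B (v (Suc m)) \<omega> - B (v m) \<omega>))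
     \<in> borel_measurable (\<F> (v (Suc m)))"
    by measurable
  then show ?case
    using IH mm by (simp add: add.assoc)
qed (use assms in auto)

text \<open>Terms of different cells are orthogonal, because the later increment is centred and
  independent of everything before it. The starting value \<open>Z\<close>, known at time
  \<open>v 0\<close>, is orthogonal to the sum for the same reason; carrying it along later removes
  the cross term between the state at s and the noise after s.\<close>

lemma martingale_transform_isometry:
  assumes "0 \<le> v 0" and v: "\<And>i. i < m \<Longrightarrow> v i \<le> v (Suc i)"
    and c: "\<And>i. i < m \<Longrightarrow> c i \<in> borel_measurable (\<F> (v i))" "\<And>i. i < m \<Longrightarrow> square_integrable M (c i)"
    and Z: "Z \<in> borel_measurable (\<F> (v 0))" "square_integrable M Z"
  defines "I \<equiv> \<lambda>m \<omega>. \<Sum>i<m. c i \<omega> * (B (v (Suc i)) \<omega> - B (v i) \<omega>)"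
  shows "square_integrable M (\<lambda>\<omega>. Z \<omega> + I m \<omega>) \<and>
    expectation (\<lambda>\<omega>. (Z \<omega> + I m \<omega>)\<^sup>2)
      = expectation (\<lambda>\<omega>. (Z \<omega>)\<^sup>2) + (\<Sum>i<m. expectation (\<lambda>\<omega>. (c i \<omega>)\<^sup>2) * (v (Suc i) - v i))"
  using v c
proof (induction m)
  case 0
  then show ?case using Z by (simp add: I_def)
next
  case (Suc m)
  let ?Y = "\<lambda>\<omega>. Z \<omega> + I m \<omega>" and ?D = "\<lambda>\<omega>. B (v (Suc m)) \<omega> - B (v m) \<omega>"
  have IH: "square_integrable M ?Y" "expectation (\<lambda>\<omega>. (?Y \<omega>)\<^sup>2)
      = expectation (\<lambda>\<omega>. (Z \<omega>)\<^sup>2) + (\<Sum>i<m. expectation (\<lambda>\<omega>. (c i \<omega>)\<^sup>2) * (v (Suc i) - v i))"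
    using Suc by auto
  have m: "0 \<le> v m" "v m \<le> v (Suc m)" and Y: "?Y \<in> borel_measurable (\<F> (v m))"
    using martingale_transform[of v m c Z] assms(1) Suc.prems Z(1) by (auto simp: I_def)
  have cm: "c m \<in> borel_measurable (\<F> (v m))" "square_integrable M (c m)"
    using Suc.prems by auto
  have Yc: "(\<lambda>\<omega>. ?Y \<omega> * c m \<omega>) \<in> borel_measurable (\<F> (v m))" "integrable M (\<lambda>\<omega>. ?Y \<omega> * c m \<omega>)"
    using Y cm square_integrable_mult_integrable[OF IH(1) cm(2)] by auto
  have sq: "square_integrable M (\<lambda>\<omega>. c m \<omega> * ?D \<omega>)"
    and Ecd: "expectation (\<lambda>\<omega>. (c m \<omega> * ?D \<omega>)\<^sup>2) = expectation (\<lambda>\<omega>. (c m \<omega>)\<^sup>2) * (v (Suc m) - v m)"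
    using square_integrable_mult_increment[OF m cm] by auto
  have cross: "integrable M (\<lambda>\<omega>. ?Y \<omega> * c m \<omega> * ?D \<omega>)" "expectation (\<lambda>\<omega>. ?Y \<omega> * c m \<omega> * ?D \<omega>) = 0"
    using filtration_mult_increment_power[OF m Yc, of 1] B_increment_moments(1)[OF m] by auto
  have eq: "Z \<omega> + I (Suc m) \<omega> = ?Y \<omega> + c m \<omega> * ?D \<omega>" for \<omega>
    by (simp add: I_def add.assoc)
  have "expectation (\<lambda>\<omega>. (?Y \<omega> + c m \<omega> * ?D \<omega>)\<^sup>2)
    = expectation (\<lambda>\<omega>. (?Y \<omega>)\<^sup>2 + 2 * (?Y \<omega> * c m \<omega> * ?D \<omega>) + (c m \<omega> * ?D \<omega>)\<^sup>2)"
    by (intro Bochner_Integration.integral_cong) (auto simp: power2_eq_square algebra_simps)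
  also have "\<dots> = expectation (\<lambda>\<omega>. (?Y \<omega>)\<^sup>2) + expectation (\<lambda>\<omega>. (c m \<omega>)\<^sup>2) * (v (Suc m) - v m)"
    using square_integrableD(2)[OF IH(1)] cross square_integrableD(2)[OF sq] Ecd by simp
  finally show ?case
    unfolding eq using IH(2) square_integrable_add[OF IH(1) sq] by simp
qed

text \<open>Truncating the coefficients as soon as the quadratic variation exceeds \<open>\<delta>\<close> preserves
  adaptedness and does not change the sum on the event that the quadratic variation is at most \<open>\<delta>\<close>.\<close>

lemma martingale_transform_prob_bound:
  assumes "0 \<le> v 0" and v: "\<And>i. i < m \<Longrightarrow> v i < v (Suc i)"
    and c: "\<And>i. i < m \<Longrightarrow> c i \<in> borel_measurable (\<F> (v i))"
    and "0 < \<epsilon>" "0 < \<delta>"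
  shows "prob {\<omega> \<in> space M. \<bar>\<Sum>i<m. c i \<omega> * (B (v (Suc i)) \<omega> - B (v i) \<omega>)\<bar> > \<epsilon>}
    \<le> prob {\<omega> \<in> space M. (\<Sum>i<m. (c i \<omega>)\<^sup>2 * (v (Suc i) - v i)) > \<delta>} + \<delta> / \<epsilon>\<^sup>2"
proof -
  define Q where "Q j \<omega> = (\<Sum>i<j. (c i \<omega>)\<^sup>2 * (v (Suc i) - v i))" for j \<omega>
  \<comment> \<open>The test counts cell i itself. As \<open>c i\<close> is known at time
    \<open>v i\<close>, the truncated coefficient is still adapted, and the accumulated variation
    never overshoots \<delta>.\<close>
  define c' where "c' i \<omega> = (if Q (Suc i) \<omega> \<le> \<delta> then c i \<omega> else 0)" for i \<omega>
  define I where "I \<omega> = (\<Sum>i<m. c i \<omega> * (B (v (Suc i)) \<omega> - B (v i) \<omega>))" for \<omega>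
  define I' where "I' \<omega> = (\<Sum>i<m. c' i \<omega> * (B (v (Suc i)) \<omega> - B (v i) \<omega>))" for \<omega>
  have v_le: "v i \<le> v j" if "i \<le> j" "j \<le> m" for i j
    using that(1,2)
  proof (induction j rule: dec_induct)
    case (step n)
    then show ?case using v[of n] by auto
  qed simp
  have v0: "0 \<le> v i" if "i \<le> m" for i
    using v_le[of 0 i] that assms(1) by auto
  have cM: "c i \<in> borel_measurable (\<F> (v j))" if "i \<le> j" "j < m" for i j
    using measurable_filtration_mono[OF c v_le] that by auto
  have Q_meas: "Q (Suc j) \<in> borel_measurable (\<F> (v j))" if "j < m" for j
    unfolding Q_def by (intro borel_measurable_sum borel_measurable_times borel_measurable_power borel_measurable_const cM)
      (use that in auto)
  have c'_meas: "c' j \<in> borel_measurable (\<F> (v j))" if "j < m" for j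
  proof -
    have [measurable]: "Q (Suc j) \<in> borel_measurable (\<F> (v j))" "c j \<in> borel_measurable (\<F> (v j))"
      using Q_meas c that by auto
    show ?thesis unfolding c'_def by measurable
  qed
  have Q_mono: "Q i \<omega> \<le> Q j \<omega>" if "i \<le> j" "j \<le> m" for i j \<omega>
    unfolding Q_def using that v by (intro sum_mono2) (auto intro!: mult_nonneg_nonneg simp: less_imp_le)
  have Q'_le: "(\<Sum>i<j. (c' i \<omega>)\<^sup>2 * (v (Suc i) - v i)) \<le> \<delta>" if "j \<le> m" for j \<omega>
    using that
  proof (induction j)
    case (Suc j)
    show ?case
    proof (cases "Q (Suc j) \<omega> \<le> \<delta>")
      case True
      then have "c' i \<omega> = c i \<omega>" if "i < Suc j" for i
        using Q_mono[of "Suc i" "Suc j" \<omega>] that Suc.prems by (auto simp: c'_def)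
      then show ?thesis using True by (simp add: Q_def)
    next
      case False
      then show ?thesis using Suc by (simp add: c'_def)
    qed
  qed (use \<open>0 < \<delta>\<close> in simp)
  \<comment> \<open>Cells have positive length and each term of the truncated variation is at most
    \<delta>, so the truncated coefficients are bounded, whatever the integrability of
    \<open>c\<close>.\<close>
  have c'_bound: "(c' i \<omega>)\<^sup>2 \<le> \<delta> / (v (Suc i) - v i)" if "i < m" for i \<omega>
  proof -
    have "(c' i \<omega>)\<^sup>2 * (v (Suc i) - v i) \<le> (\<Sum>i<m. (c' i \<omega>)\<^sup>2 * (v (Suc i) - v i))"
      using that v by (intro member_le_sum) (auto intro!: mult_nonneg_nonneg simp: less_imp_le)
    also have "\<dots> \<le> \<delta>" by (rule Q'_le) simp
    finally show ?thesis using v[OF that] by (simp add: field_simps)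
  qed
  have c'_sq: "square_integrable M (c' i)" if "i < m" for i
    unfolding square_integrable_def
  proof
    show meas: "random_variable borel (c' i)"
      using c'_meas[OF that] measurable_filtration_M by auto
    show "integrable M (\<lambda>\<omega>. (c' i \<omega>)\<^sup>2)"
      by (rule integrable_const_bound[of _ "\<delta> / (v (Suc i) - v i)"]) (use meas c'_bound[OF that] in auto)
  qed
  have iso: "square_integrable M I'" "expectation (\<lambda>\<omega>. (I' \<omega>)\<^sup>2) = (\<Sum>i<m. expectation (\<lambda>\<omega>. (c' i \<omega>)\<^sup>2) * (v (Suc i) - v i))"
    using martingale_transform_isometry[of v m c' "\<lambda>_. 0"] assms(1) v c'_meas c'_sq
    by (auto simp: I'_def[abs_def] less_imp_le)
  have "expectation (\<lambda>\<omega>. (I' \<omega>)\<^sup>2) = expectation (\<lambda>\<omega>. \<Sum>i<m. (c' i \<omega>)\<^sup>2 * (v (Suc i) - v i))"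
    unfolding iso(2) using square_integrableD(2)[OF c'_sq] by simp
  also have "\<dots> \<le> expectation (\<lambda>_. \<delta>)"
    using square_integrableD(2)[OF c'_sq] Q'_le[of m] by (intro integral_mono) auto
  finally have E: "expectation (\<lambda>\<omega>. (I' \<omega>)\<^sup>2) \<le> \<delta>" by (simp add: prob_space)
  have [measurable]: "c i \<in> borel_measurable M" "B (v i) \<in> borel_measurable M" "B (v (Suc i)) \<in> borel_measurable M"
    if "i < m" for i
    using measurable_filtration_M[OF c[OF that]] B_measurable v0 that by auto
  have [measurable]: "I \<in> borel_measurable M" "Q m \<in> borel_measurable M"
    unfolding I_def Q_def by (auto intro!: borel_measurable_sum borel_measurable_times borel_measurable_diff borel_measurable_power simp: v0)
  have [measurable]: "I' \<in> borel_measurable M" using iso(1) by (simp add: square_integrable_def)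
  \<comment> \<open>Where the variation is at most \<delta> the two sums coincide, and elsewhere the
    first event occurs. The truncated sum is left to Markov's inequality for its square.\<close>
  have "prob {\<omega> \<in> space M. \<bar>I \<omega>\<bar> > \<epsilon>} \<le> prob ({\<omega> \<in> space M. Q m \<omega> > \<delta>} \<union> {\<omega> \<in> space M. (I' \<omega>)\<^sup>2 \<ge> \<epsilon>\<^sup>2})"
  proof (rule finite_measure_mono)
    have "I \<omega> = I' \<omega>" if "Q m \<omega> \<le> \<delta>" for \<omega>
    proof -
      have "c' i \<omega> = c i \<omega>" if "i < m" for i
        using Q_mono[of "Suc i" m \<omega>] that \<open>Q m \<omega> \<le> \<delta>\<close> by (auto simp: c'_def)
      then show ?thesis by (simp add: I_def I'_def)
    qed
    moreover have "\<epsilon>\<^sup>2 \<le> x\<^sup>2" if "\<epsilon> < \<bar>x\<bar>" for x :: real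
      using that \<open>0 < \<epsilon>\<close> by (simp add: abs_le_square_iff[symmetric])
    ultimately show "{\<omega> \<in> space M. \<bar>I \<omega>\<bar> > \<epsilon>} \<subseteq> {\<omega> \<in> space M. Q m \<omega> > \<delta>} \<union> {\<omega> \<in> space M. (I' \<omega>)\<^sup>2 \<ge> \<epsilon>\<^sup>2}"
      by (smt (verit) Collect_mono_iff Un_def mem_Collect_eq subsetI)
  qed measurable
  also have "\<dots> \<le> prob {\<omega> \<in> space M. Q m \<omega> > \<delta>} + prob {\<omega> \<in> space M. (I' \<omega>)\<^sup>2 \<ge> \<epsilon>\<^sup>2}"
    by (rule measure_Un_le) measurable
  also have "prob {\<omega> \<in> space M. (I' \<omega>)\<^sup>2 \<ge> \<epsilon>\<^sup>2} \<le> expectation (\<lambda>\<omega>. (I' \<omega>)\<^sup>2) / \<epsilon>\<^sup>2"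
    using integral_Markov_inequality_measure[of M "\<lambda>\<omega>. (I' \<omega>)\<^sup>2" "{}" "\<epsilon>\<^sup>2"] square_integrableD(2)[OF iso(1)] \<open>0 < \<epsilon>\<close>
    by simp
  also have "\<dots> \<le> \<delta> / \<epsilon>\<^sup>2"
    using E by (simp add: divide_right_mono)
  finally show ?thesis
    by (simp add: I_def Q_def)
qed

end

section \<open>Convergence in probability\<close>

context prob_space
begin

lemma converges_in_probabilityD:
  assumes "converges_in_probability M Y Z"
  shows "\<And>n. Y n \<in> borel_measurable M" "Z \<in> borel_measurable M"
    "\<epsilon> > 0 \<Longrightarrow> (\<lambda>n. prob {\<omega> \<in> space M. \<bar>Y n \<omega> - Z \<omega>\<bar> > \<epsilon>}) \<longlonglongrightarrow> 0"
  using assms unfolding converges_in_probability_def by blast+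

lemma converges_in_probability_squeeze:
  assumes "\<And>n. Y n \<in> borel_measurable M" "Z \<in> borel_measurable M"
    and "\<And>\<epsilon>. \<epsilon> > 0 \<Longrightarrow> \<exists>p. p \<longlonglongrightarrow> 0 \<and> (\<forall>\<^sub>F n in sequentially. prob {\<omega> \<in> space M. \<bar>Y n \<omega> - Z \<omega>\<bar> > \<epsilon>} \<le> p n)"
  shows "converges_in_probability M Y Z"
  unfolding converges_in_probability_def
proof (intro conjI allI impI)
  fix \<epsilon> :: real assume "\<epsilon> > 0"
  then obtain p where p: "p \<longlonglongrightarrow> 0" "\<forall>\<^sub>F n in sequentially. prob {\<omega> \<in> space M. \<bar>Y n \<omega> - Z \<omega>\<bar> > \<epsilon>} \<le> p n"
    using assms(3) by blast
  show "(\<lambda>n. prob {\<omega> \<in> space M. \<bar>Y n \<omega> - Z \<omega>\<bar> > \<epsilon>}) \<longlonglongrightarrow> 0"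
    by (rule tendsto_sandwich[OF _ p(2) tendsto_const p(1)]) simp
qed fact+

lemma AE_imp_converges_in_probability:
  assumes [measurable]: "\<And>n. Y n \<in> borel_measurable M" "Z \<in> borel_measurable M"
    and ae: "AE \<omega> in M. (\<lambda>n. Y n \<omega>) \<longlonglongrightarrow> Z \<omega>"
  shows "converges_in_probability M Y Z"
  unfolding converges_in_probability_def
proof (intro conjI allI impI)
  fix \<epsilon> :: real assume "\<epsilon> > 0"
  let ?E = "\<lambda>n. {\<omega> \<in> space M. \<bar>Y n \<omega> - Z \<omega>\<bar> > \<epsilon>}"
  have "(\<lambda>n. expectation (indicator (?E n))) \<longlonglongrightarrow> expectation (\<lambda>_. 0 :: real)"
  proof (rule integral_dominated_convergence[where w = "\<lambda>_. 1"])
    show "AE \<omega> in M. (\<lambda>n. indicator (?E n) \<omega> :: real) \<longlonglongrightarrow> 0"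
      using ae
    proof eventually_elim
      case (elim \<omega>)
      have "\<forall>\<^sub>F n in sequentially. dist (Y n \<omega>) (Z \<omega>) < \<epsilon>"
        using tendstoD[OF elim \<open>\<epsilon> > 0\<close>] .
      then have "\<forall>\<^sub>F n in sequentially. indicator (?E n) \<omega> = (0 :: real)"
        by eventually_elim (auto simp: dist_real_def)
      then show ?case by (rule tendsto_eventually)
    qed
  qed auto
  moreover have "expectation (indicator (?E n)) = prob (?E n)" for n by simp
  ultimately show "(\<lambda>n. prob (?E n)) \<longlonglongrightarrow> 0" by simp
qed auto

lemma converges_in_probability_add:
  assumes Y: "converges_in_probability M Y Z" and Y': "converges_in_probability M Y' Z'"
  shows "converges_in_probability M (\<lambda>n \<omega>. Y n \<omega> + Y' n \<omega>) (\<lambda>\<omega>. Z \<omega> + Z' \<omega>)"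
proof (rule converges_in_probability_squeeze)
  note [measurable] = converges_in_probabilityD(1,2)[OF Y] converges_in_probabilityD(1,2)[OF Y']
  show "(\<lambda>\<omega>. Y n \<omega> + Y' n \<omega>) \<in> borel_measurable M" "(\<lambda>\<omega>. Z \<omega> + Z' \<omega>) \<in> borel_measurable M" for n
    by auto
  fix \<epsilon> :: real assume "\<epsilon> > 0"
  let ?p = "\<lambda>n. prob {\<omega> \<in> space M. \<bar>Y n \<omega> - Z \<omega>\<bar> > \<epsilon> / 2} + prob {\<omega> \<in> space M. \<bar>Y' n \<omega> - Z' \<omega>\<bar> > \<epsilon> / 2}"
  have "?p \<longlonglongrightarrow> 0 + 0"
    using \<open>\<epsilon> > 0\<close> by (intro tendsto_add converges_in_probabilityD(3)[OF Y] converges_in_probabilityD(3)[OF Y']) auto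
  moreover have "prob {\<omega> \<in> space M. \<bar>Y n \<omega> + Y' n \<omega> - (Z \<omega> + Z' \<omega>)\<bar> > \<epsilon>} \<le> ?p n" for n
  proof -
    have "prob {\<omega> \<in> space M. \<bar>Y n \<omega> + Y' n \<omega> - (Z \<omega> + Z' \<omega>)\<bar> > \<epsilon>}
      \<le> prob ({\<omega> \<in> space M. \<bar>Y n \<omega> - Z \<omega>\<bar> > \<epsilon> / 2} \<union> {\<omega> \<in> space M. \<bar>Y' n \<omega> - Z' \<omega>\<bar> > \<epsilon> / 2})"
    proof (intro finite_measure_mono subsetI)
      fix \<omega> assume "\<omega> \<in> {\<omega> \<in> space M. \<bar>Y n \<omega> + Y' n \<omega> - (Z \<omega> + Z' \<omega>)\<bar> > \<epsilon>}"
      then have "\<omega> \<in> space M" "\<bar>(Y n \<omega> - Z \<omega>) + (Y' n \<omega> - Z' \<omega>)\<bar> > \<epsilon>"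
        by (auto simp: algebra_simps)
      then show "\<omega> \<in> {\<omega> \<in> space M. \<bar>Y n \<omega> - Z \<omega>\<bar> > \<epsilon> / 2} \<union> {\<omega> \<in> space M. \<bar>Y' n \<omega> - Z' \<omega>\<bar> > \<epsilon> / 2}"
        using abs_triangle_ineq[of "Y n \<omega> - Z \<omega>" "Y' n \<omega> - Z' \<omega>"] by auto
    qed auto
    also have "\<dots> \<le> ?p n" by (rule measure_Un_le) auto
    finally show ?thesis .
  qed
  ultimately show "\<exists>p. p \<longlonglongrightarrow> 0 \<and> (\<forall>\<^sub>F n in sequentially.
      prob {\<omega> \<in> space M. \<bar>Y n \<omega> + Y' n \<omega> - (Z \<omega> + Z' \<omega>)\<bar> > \<epsilon>} \<le> p n)"
    by (intro exI[of _ ?p]) auto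
qed

lemma converges_in_probability_mult_bounded:
  assumes Y: "converges_in_probability M Y Z" and [measurable]: "A \<in> borel_measurable M"
    and "0 < c" and bound: "\<And>\<omega>. \<omega> \<in> space M \<Longrightarrow> \<bar>A \<omega>\<bar> \<le> c"
  shows "converges_in_probability M (\<lambda>n \<omega>. A \<omega> * Y n \<omega>) (\<lambda>\<omega>. A \<omega> * Z \<omega>)"
proof (rule converges_in_probability_squeeze)
  note [measurable] = converges_in_probabilityD(1,2)[OF Y]
  show "(\<lambda>\<omega>. A \<omega> * Y n \<omega>) \<in> borel_measurable M" "(\<lambda>\<omega>. A \<omega> * Z \<omega>) \<in> borel_measurable M" for n
    by auto
  fix \<epsilon> :: real assume "\<epsilon> > 0"
  let ?p = "\<lambda>n. prob {\<omega> \<in> space M. \<bar>Y n \<omega> - Z \<omega>\<bar> > \<epsilon> / c}"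
  have "?p \<longlonglongrightarrow> 0"
    using \<open>\<epsilon> > 0\<close> \<open>0 < c\<close> by (intro converges_in_probabilityD(3)[OF Y]) auto
  moreover have "prob {\<omega> \<in> space M. \<bar>A \<omega> * Y n \<omega> - A \<omega> * Z \<omega>\<bar> > \<epsilon>} \<le> ?p n" for n
  proof (rule finite_measure_mono)
    show "{\<omega> \<in> space M. \<bar>A \<omega> * Y n \<omega> - A \<omega> * Z \<omega>\<bar> > \<epsilon>} \<subseteq> {\<omega> \<in> space M. \<bar>Y n \<omega> - Z \<omega>\<bar> > \<epsilon> / c}"
    proof safe
      fix \<omega> assume \<omega>: "\<omega> \<in> space M" "\<bar>A \<omega> * Y n \<omega> - A \<omega> * Z \<omega>\<bar> > \<epsilon>"
      have "\<bar>A \<omega> * Y n \<omega> - A \<omega> * Z \<omega>\<bar> = \<bar>A \<omega>\<bar> * \<bar>Y n \<omega> - Z \<omega>\<bar>"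
        by (simp add: abs_mult[symmetric] right_diff_distrib)
      also have "\<dots> \<le> c * \<bar>Y n \<omega> - Z \<omega>\<bar>"
        by (intro mult_right_mono bound \<omega>) simp
      finally show "\<epsilon> / c < \<bar>Y n \<omega> - Z \<omega>\<bar>"
        using \<omega> \<open>0 < c\<close> by (simp add: field_simps)
    qed
  qed simp
  ultimately show "\<exists>p. p \<longlonglongrightarrow> 0 \<and> (\<forall>\<^sub>F n in sequentially.
      prob {\<omega> \<in> space M. \<bar>A \<omega> * Y n \<omega> - A \<omega> * Z \<omega>\<bar> > \<epsilon>} \<le> p n)"
    by (intro exI[of _ ?p]) auto
qed

lemma converges_in_probability_const:
  "Z \<in> borel_measurable M \<Longrightarrow> converges_in_probability M (\<lambda>_. Z) Z"
  by (rule AE_imp_converges_in_probability) auto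

lemma converges_in_probability_cmult:
  assumes "converges_in_probability M Y Z"
  shows "converges_in_probability M (\<lambda>n \<omega>. c * Y n \<omega>) (\<lambda>\<omega>. c * Z \<omega>)"
  by (rule converges_in_probability_mult_bounded[OF assms, of "\<lambda>_. c" "\<bar>c\<bar> + 1"]) auto

lemma converges_in_probability_diff:
  assumes "converges_in_probability M Y Z" "converges_in_probability M Y' Z'"
  shows "converges_in_probability M (\<lambda>n \<omega>. Y n \<omega> - Y' n \<omega>) (\<lambda>\<omega>. Z \<omega> - Z' \<omega>)"
  using converges_in_probability_add[OF assms(1) converges_in_probability_cmult[OF assms(2), of "-1"]] by simp

lemma converges_in_probability_cong_AE:
  assumes Y: "converges_in_probability M Y Z"
    and [measurable]: "\<And>n. Y' n \<in> borel_measurable M" "Z' \<in> borel_measurable M"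
    and ae: "\<And>n. AE \<omega> in M. Y n \<omega> = Y' n \<omega>" "AE \<omega> in M. Z \<omega> = Z' \<omega>"
  shows "converges_in_probability M Y' Z'"
  unfolding converges_in_probability_def
proof (intro conjI allI impI)
  note [measurable] = converges_in_probabilityD(1,2)[OF Y]
  fix \<epsilon> :: real assume "\<epsilon> > 0"
  have "prob {\<omega> \<in> space M. \<bar>Y n \<omega> - Z \<omega>\<bar> > \<epsilon>} = prob {\<omega> \<in> space M. \<bar>Y' n \<omega> - Z' \<omega>\<bar> > \<epsilon>}" for n
    by (rule finite_measure_eq_AE) (use ae(1)[of n] ae(2) in \<open>auto elim: eventually_elim2\<close>)
  then show "(\<lambda>n. prob {\<omega> \<in> space M. \<bar>Y' n \<omega> - Z' \<omega>\<bar> > \<epsilon>}) \<longlonglongrightarrow> 0"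
    using converges_in_probabilityD(3)[OF Y \<open>\<epsilon> > 0\<close>] by simp
qed auto

text \<open>Truncating the distance at 1 turns convergence in probability into convergence in L1,
  which supplies an almost surely convergent subsequence; below 1 the truncation is
  invisible.\<close>

lemma converges_in_probability_AE_subseq:
  assumes Y: "converges_in_probability M Y Z"
  shows "\<exists>r. strict_mono r \<and> (AE \<omega> in M. (\<lambda>n. Y (r n) \<omega>) \<longlonglongrightarrow> Z \<omega>)"
proof -
  note [measurable] = converges_in_probabilityD(1,2)[OF Y]
  define u where "u n \<omega> = min 1 \<bar>Y n \<omega> - Z \<omega>\<bar>" for n \<omega>
  have [measurable]: "u n \<in> borel_measurable M" for n
    unfolding u_def by measurable
  have u: "0 \<le> u n \<omega>" "u n \<omega> \<le> 1" for n \<omega> by (auto simp: u_def)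
  have int: "integrable M (u n)" for n
    by (rule integrable_const_bound[of _ 1]) (use u in auto)
  have lim: "(\<lambda>n. expectation (\<lambda>\<omega>. norm (u n \<omega>))) \<longlonglongrightarrow> 0"
  proof (rule LIMSEQ_I)
    fix \<epsilon> :: real assume "\<epsilon> > 0"
    let ?E = "\<lambda>n. {\<omega> \<in> space M. \<bar>Y n \<omega> - Z \<omega>\<bar> > \<epsilon> / 2}"
    obtain N where N: "\<And>n. n \<ge> N \<Longrightarrow> prob (?E n) < \<epsilon> / 2"
      using LIMSEQ_D[OF converges_in_probabilityD(3)[OF Y, of "\<epsilon> / 2"], of "\<epsilon> / 2"] \<open>\<epsilon> > 0\<close> by auto
    have "expectation (u n) < \<epsilon>" if "n \<ge> N" for n
    proof -
      define E where "E = ?E n"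
      have E [measurable]: "E \<in> events" unfolding E_def by measurable
      have i [simp]: "integrable M (indicat_real E)"
        by (rule integrable_real_indicator) (auto simp: less_top[symmetric])
      have "expectation (u n) \<le> expectation (\<lambda>\<omega>. \<epsilon> / 2 + indicat_real E \<omega>)"
      proof (rule integral_mono[OF int])
        show "u n \<omega> \<le> \<epsilon> / 2 + indicat_real E \<omega>" if "\<omega> \<in> space M" for \<omega>
          using that \<open>\<epsilon> > 0\<close> by (cases "\<omega> \<in> E") (auto simp: u_def E_def min_def)
      qed simp
      also have "\<dots> = \<epsilon> / 2 + prob (?E n)"
        unfolding E_def[symmetric] by (simp add: prob_space)
      finally show ?thesis using N[OF that] by simp
    qed
    moreover have "0 \<le> expectation (u n)" for n using u by simp
    ultimately show "\<exists>N. \<forall>n\<ge>N. norm (expectation (\<lambda>\<omega>. norm (u n \<omega>)) - 0) < \<epsilon>"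
      using u by auto
  qed
  obtain r where r: "strict_mono r" "AE \<omega> in M. (\<lambda>n. u (r n) \<omega>) \<longlonglongrightarrow> 0"
    using tendsto_L1_AE_subseq[of M u, OF int] lim by auto
  have "AE \<omega> in M. (\<lambda>n. Y (r n) \<omega>) \<longlonglongrightarrow> Z \<omega>"
    using r(2)
  proof eventually_elim
    case (elim \<omega>)
    have "\<forall>\<^sub>F n in sequentially. u (r n) \<omega> < 1"
      using order_tendstoD(2)[OF elim] by auto
    then have "\<forall>\<^sub>F n in sequentially. u (r n) \<omega> = \<bar>Y (r n) \<omega> - Z \<omega>\<bar>"
      by eventually_elim (auto simp: u_def min_def split: if_splits)
    then have "(\<lambda>n. \<bar>Y (r n) \<omega> - Z \<omega>\<bar>) \<longlonglongrightarrow> 0"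
      using elim by (simp add: tendsto_cong)
    then show ?case
      by (subst LIM_zero_iff[symmetric]) (simp add: tendsto_rabs_zero_iff)
  qed
  with r show ?thesis by blast
qed

text \<open>Along an almost surely convergent subsequence Fatou's lemma applies. Integrability of
  the limit is a conclusion, so bounds on approximations yield finite moments of \<open>X t\<close>,
  about which nothing is known in advance.\<close>

lemma converges_in_probability_Fatou:
  fixes f :: "real \<Rightarrow> real"
  assumes Y: "converges_in_probability M Y Z"
    and f: "continuous_on UNIV f" "\<And>x. 0 \<le> f x"
    and int: "\<And>n. integrable M (\<lambda>\<omega>. f (Y n \<omega>))"
    and le: "\<And>n. expectation (\<lambda>\<omega>. f (Y n \<omega>)) \<le> c n" and c: "c \<longlonglongrightarrow> C"
  shows "integrable M (\<lambda>\<omega>. f (Z \<omega>))" "expectation (\<lambda>\<omega>. f (Z \<omega>)) \<le> C"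
proof -
  note [measurable] = converges_in_probabilityD(1,2)[OF Y]
  have [measurable]: "f \<in> borel_measurable borel"
    using f(1) by (rule borel_measurable_continuous_onI)
  obtain r where r: "strict_mono r" "AE \<omega> in M. (\<lambda>n. Y (r n) \<omega>) \<longlonglongrightarrow> Z \<omega>"
    using converges_in_probability_AE_subseq[OF Y] by blast
  have "0 \<le> c n" for n
    using le[of n] Bochner_Integration.integral_nonneg[of M "\<lambda>\<omega>. f (Y n \<omega>)"] f(2) by (meson order_trans)
  then have C: "0 \<le> C" using LIMSEQ_le_const[OF c] by blast
  have "(\<integral>\<^sup>+\<omega>. ennreal (f (Z \<omega>)) \<partial>M) = (\<integral>\<^sup>+\<omega>. liminf (\<lambda>n. ennreal (f (Y (r n) \<omega>))) \<partial>M)"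
  proof (rule nn_integral_cong_AE, use r(2) in eventually_elim)
    case (elim \<omega>)
    have "(\<lambda>n. f (Y (r n) \<omega>)) \<longlonglongrightarrow> f (Z \<omega>)"
      using f(1) elim by (auto simp: continuous_on_def intro: tendsto_compose)
    then show ?case
      by (intro lim_imp_Liminf[symmetric] tendsto_ennrealI) auto
  qed
  also have "\<dots> \<le> liminf (\<lambda>n. \<integral>\<^sup>+\<omega>. ennreal (f (Y (r n) \<omega>)) \<partial>M)"
    by (rule nn_integral_liminf) simp
  also have "\<dots> \<le> liminf (\<lambda>n. ennreal (c (r n)))"
    using le int f(2) by (intro Liminf_mono always_eventually allI) (simp add: nn_integral_eq_integral ennreal_leI)
  also have "\<dots> = ennreal C"
    using LIMSEQ_subseq_LIMSEQ[OF c r(1)] by (intro lim_imp_Liminf tendsto_ennrealI) (auto simp: comp_def)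
  finally have le': "(\<integral>\<^sup>+\<omega>. ennreal (f (Z \<omega>)) \<partial>M) \<le> ennreal C" .
  show int: "integrable M (\<lambda>\<omega>. f (Z \<omega>))"
    by (rule integrableI_nonneg) (use le' f(2) in \<open>auto intro: le_less_trans\<close>)
  show "expectation (\<lambda>\<omega>. f (Z \<omega>)) \<le> C"
    using le' C f(2) by (simp add: nn_integral_eq_integral[OF int])
qed

lemma converges_in_probability_square_le:
  assumes Y: "converges_in_probability M Y Z"
    and int: "\<And>n. square_integrable M (Y n)"
    and le: "\<And>n. expectation (\<lambda>\<omega>. (Y n \<omega>)\<^sup>2) \<le> c n" and c: "c \<longlonglongrightarrow> C"
  shows "square_integrable M Z" "expectation (\<lambda>\<omega>. (Z \<omega>)\<^sup>2) \<le> C"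
  using converges_in_probability_Fatou[OF Y continuous_on_power[OF continuous_on_id], of 2 c C]
    int le c converges_in_probabilityD(2)[OF Y]
  by (auto simp: square_integrable_def)

end

section \<open>Step processes and the Ito integral\<close>

text \<open>Passing to a grid that contains all knots, capped at t, allows simple processes with
  different knots to be subtracted cell by cell. The integrator is arbitrary, so that the identity
  serves for B and for time.\<close>

lemma simple_ito_integral_partition:
  assumes v: "strict_mono_on {..m} v" "v m = t"
    and knot: "\<And>i. i < pieces h \<Longrightarrow> knot h i \<le> knot h (Suc i)"
    and D: "\<And>i. i \<le> pieces h \<Longrightarrow> min t (knot h i) \<in> v ` {..m}"
  shows "simple_ito_integral W h t \<omega> = (\<Sum>j<m. simple_value h (v j) \<omega> * (W (v (Suc j)) \<omega> - W (v j) \<omega>))"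
proof -
  have lt: "v j < t" if "j < m" for j
    using strict_mono_onD[OF v(1), of j m] that v(2) by auto
  have lt_eq: "min t x \<le> v j \<longleftrightarrow> x \<le> v j" "v j < min t x \<longleftrightarrow> v j < x" if "j < m" for j x
    using lt[OF that] by (auto simp: min_def)
  have cell: "W (min t (knot h (Suc i))) \<omega> - W (min t (knot h i)) \<omega>
    = (\<Sum>j<m. indicator {knot h i..<knot h (Suc i)} (v j) * (W (v (Suc j)) \<omega> - W (v j) \<omega>))"
    if "i < pieces h" for i
  proof -
    have "W (min t (knot h (Suc i))) \<omega> - W (min t (knot h i)) \<omega> =
      (\<Sum>j | j < m \<and> min t (knot h i) \<le> v j \<and> v j < min t (knot h (Suc i)). W (v (Suc j)) \<omega> - W (v j) \<omega>)"
      using D[of i] D[of "Suc i"] that knot[OF that]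
      by (intro sum_increments_between[OF v(1), symmetric]) auto
    also have "{j. j < m \<and> min t (knot h i) \<le> v j \<and> v j < min t (knot h (Suc i))}
       = {j \<in> {..<m}. v j \<in> {knot h i..<knot h (Suc i)}}"
    proof (rule Collect_cong)
      show "(j < m \<and> min t (knot h i) \<le> v j \<and> v j < min t (knot h (Suc i)))
        = (j \<in> {..<m} \<and> v j \<in> {knot h i..<knot h (Suc i)})" for j
        using lt_eq[of j "knot h i"] lt_eq[of j "knot h (Suc i)"] by auto
    qed
    also have "(\<Sum>j\<in>{j \<in> {..<m}. v j \<in> {knot h i..<knot h (Suc i)}}. W (v (Suc j)) \<omega> - W (v j) \<omega>)
      = (\<Sum>j<m. indicator {knot h i..<knot h (Suc i)} (v j) * (W (v (Suc j)) \<omega> - W (v j) \<omega>))"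
      by (subst sum.inter_filter, simp, rule sum.cong) simp_all
    finally show ?thesis .
  qed
  have "simple_ito_integral W h t \<omega> = (\<Sum>i<pieces h. \<Sum>j<m. coeff h i \<omega> *
      (indicator {knot h i..<knot h (Suc i)} (v j) * (W (v (Suc j)) \<omega> - W (v j) \<omega>)))"
    unfolding simple_ito_integral_def
    by (intro sum.cong refl) (simp only: cell lessThan_iff sum_distrib_left)
  also have "\<dots> = (\<Sum>j<m. simple_value h (v j) \<omega> * (W (v (Suc j)) \<omega> - W (v j) \<omega>))"
    by (subst sum.swap) (simp only: simple_value_def sum_distrib_right mult.assoc)
  finally show ?thesis .
qed

lemma simple_value_constant_on_cell:
  assumes v: "strict_mono_on {..m} v" "v m = t"
    and D: "\<And>i. i \<le> pieces h \<Longrightarrow> min t (knot h i) \<in> v ` {..m}"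
    and j: "j < m" "v j \<le> s" "s < v (Suc j)"
  shows "simple_value h s \<omega> = simple_value h (v j) \<omega>"
proof -
  have "knot h i \<le> s \<longleftrightarrow> knot h i \<le> v j" if i: "i \<le> pieces h" for i
  proof
    assume le: "knot h i \<le> s"
    have "v (Suc j) \<le> t"
      using strict_mono_on_leD[OF v(1), of "Suc j" m] j v(2) by auto
    then have "min t (knot h i) = knot h i" using le j by auto
    then obtain l where l: "l \<le> m" "knot h i = v l" using D[OF i] by auto
    then have "v l < v (Suc j)" using le j by simp
    then have "l < Suc j"
      using strict_mono_on_less[OF v(1), of l "Suc j"] l j by simp
    then show "knot h i \<le> v j"
      using strict_mono_on_leD[OF v(1), of l j] l j by simp
  qed (use j in simp)
  from this[of "Suc _"] this[of "_ :: nat"] have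
    "indicator {knot h i..<knot h (Suc i)} s = (indicator {knot h i..<knot h (Suc i)} (v j) :: real)"
    if "i < pieces h" for i
    using that by (auto simp: indicator_def not_less[symmetric])
  then show ?thesis
    unfolding simple_value_def by (intro sum.cong) auto
qed

lemma partition_cell_exists:
  fixes v :: "nat \<Rightarrow> real"
  assumes "v 0 \<le> s" "s < v m"
  shows "\<exists>j<m. v j \<le> s \<and> s < v (Suc j)"
  using assms(2)
proof (induction m)
  case (Suc m)
  then show ?case by (cases "s < v m") (auto simp: not_less intro: less_SucI)
qed (use assms in auto)

lemma lborel_integral_step:
  fixes f :: "real \<Rightarrow> real"
  assumes v: "strict_mono_on {..m} v" "v 0 = 0" "v m = t"
    and f: "\<And>j s. j < m \<Longrightarrow> v j \<le> s \<Longrightarrow> s < v (Suc j) \<Longrightarrow> f s = f (v j)"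
  shows "set_integrable lborel {0..t} f" and "(LINT s:{0..t}|lborel. f s) = (\<Sum>j<m. f (v j) * (v (Suc j) - v j))"
proof -
  define g where "g s = (\<Sum>j<m. indicator {v j..<v (Suc j)} s * f (v j))" for s
  have le: "v i \<le> v j" if "i \<le> j" "j \<le> m" for i j
    using strict_mono_on_leD[OF v(1)] that by auto
  have g: "g s = indicator {0..<t} s * f s" for s
  proof (cases "0 \<le> s \<and> s < t")
    case True
    then obtain j where j: "j < m" "v j \<le> s" "s < v (Suc j)"
      using partition_cell_exists[of v s m] v by auto
    have "indicator {v i..<v (Suc i)} s = (if i = j then 1 else 0 :: real)" if "i < m" for i
      using le[of "Suc i" j] le[of "Suc j" i] that j
      by (cases i j rule: linorder_cases) (auto simp: indicator_def)
    then have "g s = (\<Sum>i<m. (if i = j then 1 else 0) * f (v i))"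
      unfolding g_def by (intro sum.cong) auto
    also have "\<dots> = f (v j)"
      using j by (simp add: if_distrib[of "\<lambda>x. x * _"] sum.delta cong: if_cong)
    finally show ?thesis
      using f[OF j] True by simp
  next
    case False
    have "indicator {v j..<v (Suc j)} s = (0 :: real)" if "j < m" for j
      using le[of 0 j] le[of "Suc j" m] that False v by (auto simp: indicator_def)
    then have "g s = 0" unfolding g_def by (intro sum.neutral) simp
    then show ?thesis using False by auto
  qed
  have int: "has_bochner_integral lborel g (\<Sum>j<m. (v (Suc j) - v j) * f (v j))"
    unfolding g_def
  proof (intro has_bochner_integral_sum has_bochner_integral_mult_left)
    fix j assume "j \<in> {..<m}"
    then have "v j \<le> v (Suc j)" using le by auto
    then show "has_bochner_integral lborel (indicator {v j..<v (Suc j)}) (v (Suc j) - v j)"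
      using has_bochner_integral_real_indicator[of "{v j..<v (Suc j)}" lborel] by simp
  qed
  \<comment> \<open>Half-open cells leave out the right end t, a single point.\<close>
  have ae: "AE s in lborel. g s = indicator {0..t} s *\<^sub>R f s"
    using AE_lborel_singleton[of t] by eventually_elim (auto simp: g indicator_def)
  have meas: "(\<lambda>s. indicator {0..t} s *\<^sub>R f s) \<in> borel_measurable lborel"
  proof -
    \<comment> \<open>Measurability does not pass through an almost everywhere identity for
      \<open>lborel\<close>, so the value at t is put back explicitly.\<close>
    have "(\<lambda>s. g s + indicator {t} s * (if 0 \<le> t then f t else 0)) \<in> borel_measurable lborel"
      using integrable.intros[OF int] by auto
    also have "(\<lambda>s. g s + indicator {t} s * (if 0 \<le> t then f t else 0)) = (\<lambda>s. indicator {0..t} s *\<^sub>R f s)"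
    proof
      fix s show "g s + indicator {t} s * (if 0 \<le> t then f t else 0) = indicator {0..t} s *\<^sub>R f s"
        by (cases "s = t") (auto simp: g indicator_def)
    qed
    finally show ?thesis .
  qed
  have "has_bochner_integral lborel (\<lambda>s. indicator {0..t} s *\<^sub>R f s) (\<Sum>j<m. (v (Suc j) - v j) * f (v j))"
    using int ae meas has_bochner_integral_cong_AE[of g lborel] integrable.intros[OF int]
    by (metis borel_measurable_integrable)
  then show "set_integrable lborel {0..t} f" "(LINT s:{0..t}|lborel. f s) = (\<Sum>j<m. f (v j) * (v (Suc j) - v j))"
    unfolding set_integrable_def set_lebesgue_integral_def
    by (auto simp: has_bochner_integral_iff mult.commute)
qed

text \<open>Wider than \<open>adapted_simple\<close>: samples of the solution are unbounded, and
  grids have repeated knots when s = 0 or s = t, so Euler sums call for unbounded coefficients and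
  weakly increasing knots.\<close>

definition adapted_step :: "(real \<Rightarrow> 'a measure) \<Rightarrow> 'a simple_process \<Rightarrow> bool" where
  "adapted_step F h \<longleftrightarrow> 0 \<le> knot h 0 \<and> (\<forall>i < pieces h. knot h i \<le> knot h (Suc i)) \<and>
     (\<forall>i < pieces h. coeff h i \<in> borel_measurable (F (knot h i)))"

lemma adapted_simple_imp_step: "adapted_simple M F h \<Longrightarrow> adapted_step F h"
  unfolding adapted_simple_def adapted_step_def by (auto intro: less_imp_le)

lemma adapted_step_knot_nonneg:
  assumes "adapted_step F h" "i \<le> pieces h"
  shows "0 \<le> knot h i"
  using assms(2)
proof (induction i)
  case (Suc i)
  then show ?case using assms(1) by (auto simp: adapted_step_def Suc_le_eq intro: order_trans)
qed (use assms(1) in \<open>auto simp: adapted_step_def\<close>)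

lemma common_partition:
  assumes h: "adapted_step F h" and r: "adapted_step F r" and "0 \<le> t"
  obtains v :: "nat \<Rightarrow> real" and m where "strict_mono_on {..m} v" "v 0 = 0" "v m = t"
    "\<And>i. i \<le> pieces h \<Longrightarrow> min t (knot h i) \<in> v ` {..m}"
    "\<And>i. i \<le> pieces r \<Longrightarrow> min t (knot r i) \<in> v ` {..m}"
proof -
  define D where "D = {0, t} \<union> (\<lambda>i. min t (knot h i)) ` {..pieces h} \<union> (\<lambda>i. min t (knot r i)) ` {..pieces r}"
  have D: "finite D" "0 \<in> D" "t \<in> D" "D \<subseteq> {0..t}"
    using adapted_step_knot_nonneg[OF h] adapted_step_knot_nonneg[OF r] \<open>0 \<le> t\<close> by (auto simp: D_def)
  obtain v and m :: nat where v: "strict_mono_on {..m} v" "v ` {..m} = D" "v 0 = 0" "v m = t"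
    by (rule finite_set_enumeration_interval[OF D]) blast
  show thesis
    by (rule that[OF v(1,3,4)]; unfold v(2); auto simp: D_def)
qed

section \<open>Distance between stochastic integrals of step processes\<close>

context wiener_with_initial
begin

lemma simple_value_measurable_filtration:
  assumes "adapted_step \<F> h"
  shows "simple_value h s \<in> borel_measurable (\<F> s)"
proof -
  have "(\<lambda>\<omega>. coeff h i \<omega> * indicator {knot h i..<knot h (Suc i)} s) \<in> borel_measurable (\<F> s)"
    if "i < pieces h" for i
  proof (cases "knot h i \<le> s")
    case True
    then have "coeff h i \<in> borel_measurable (\<F> s)"
      using assms that by (auto simp: adapted_step_def intro: measurable_filtration_mono)
    then show ?thesis by simp
  qed simp
  then show ?thesis
    unfolding simple_value_def[abs_def] by (intro borel_measurable_sum) auto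
qed

lemma simple_ito_integral_measurable:
  assumes h: "adapted_step \<F> h" and "0 \<le> t"
  shows "simple_ito_integral B h t \<in> borel_measurable M"
proof -
  have "(\<lambda>\<omega>. coeff h i \<omega> * (B (min t (knot h (Suc i))) \<omega> - B (min t (knot h i)) \<omega>)) \<in> borel_measurable M"
    if "i < pieces h" for i
  proof -
    have "coeff h i \<in> borel_measurable M"
      using h that measurable_filtration_M by (auto simp: adapted_step_def)
    moreover have "B (min t (knot h (Suc i))) \<in> borel_measurable M" "B (min t (knot h i)) \<in> borel_measurable M"
      using adapted_step_knot_nonneg[OF h, of i] adapted_step_knot_nonneg[OF h, of "Suc i"] that \<open>0 \<le> t\<close>
      by (auto intro!: B_measurable)
    ultimately show ?thesis by measurable
  qed
  then show ?thesis
    unfolding simple_ito_integral_def[abs_def] by (intro borel_measurable_sum) auto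
qed

text \<open>On a common refinement the difference of the integrals is a single discrete stochastic
  integral, whose quadratic variation is exactly the squared L2 distance of the integrands on
  [0, t]. \<open>martingale_transform_prob_bound\<close> then turns closeness of integrands into
  closeness of integrals without any moments.\<close>

lemma simple_ito_integral_diff_prob_bound:
  assumes h: "adapted_step \<F> h" and r: "adapted_step \<F> r" and "0 \<le> t" "0 < \<epsilon>" "0 < \<delta>"
  shows "prob {\<omega> \<in> space M. \<bar>simple_ito_integral B h t \<omega> - simple_ito_integral B r t \<omega>\<bar> > \<epsilon>}
    \<le> prob {\<omega> \<in> space M. (LINT s:{0..t}|lborel. (simple_value h s \<omega> - simple_value r s \<omega>)\<^sup>2) > \<delta>} + \<delta> / \<epsilon>\<^sup>2"
    and "set_integrable lborel {0..t} (\<lambda>s. (simple_value h s \<omega> - simple_value r s \<omega>)\<^sup>2)"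
proof -
  obtain v and m :: nat where v: "strict_mono_on {..m} v" "v 0 = 0" "v m = t"
    and hD: "\<And>i. i \<le> pieces h \<Longrightarrow> min t (knot h i) \<in> v ` {..m}"
    and rD: "\<And>i. i \<le> pieces r \<Longrightarrow> min t (knot r i) \<in> v ` {..m}"
    by (rule common_partition[OF h r \<open>0 \<le> t\<close>]) blast
  define c where "c j \<omega> = simple_value h (v j) \<omega> - simple_value r (v j) \<omega>" for j \<omega>
  have I: "simple_ito_integral B h t \<omega> - simple_ito_integral B r t \<omega>
      = (\<Sum>j<m. c j \<omega> * (B (v (Suc j)) \<omega> - B (v j) \<omega>))" for \<omega>
    using simple_ito_integral_partition[OF v(1,3) _ hD, of B \<omega>] simple_ito_integral_partition[OF v(1,3) _ rD, of B \<omega>] h r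
    by (simp add: adapted_step_def c_def sum_subtractf left_diff_distrib)
  have const: "(simple_value h s \<omega> - simple_value r s \<omega>)\<^sup>2 = (simple_value h (v j) \<omega> - simple_value r (v j) \<omega>)\<^sup>2"
    if "j < m" "v j \<le> s" "s < v (Suc j)" for j s \<omega>
    using simple_value_constant_on_cell[OF v(1,3) hD that] simple_value_constant_on_cell[OF v(1,3) rD that] by simp
  have Q: "(LINT s:{0..t}|lborel. (simple_value h s \<omega> - simple_value r s \<omega>)\<^sup>2) = (\<Sum>j<m. (c j \<omega>)\<^sup>2 * (v (Suc j) - v j))" for \<omega>
    using lborel_integral_step(2)[OF v, of "\<lambda>s. (simple_value h s \<omega> - simple_value r s \<omega>)\<^sup>2", OF const]
    by (simp add: c_def)
  show "set_integrable lborel {0..t} (\<lambda>s. (simple_value h s \<omega> - simple_value r s \<omega>)\<^sup>2)"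
    by (rule lborel_integral_step(1)[OF v]) (rule const)
  show "prob {\<omega> \<in> space M. \<bar>simple_ito_integral B h t \<omega> - simple_ito_integral B r t \<omega>\<bar> > \<epsilon>}
    \<le> prob {\<omega> \<in> space M. (LINT s:{0..t}|lborel. (simple_value h s \<omega> - simple_value r s \<omega>)\<^sup>2) > \<delta>} + \<delta> / \<epsilon>\<^sup>2"
    unfolding I Q
  proof (rule martingale_transform_prob_bound[OF _ _ _ \<open>0 < \<epsilon>\<close> \<open>0 < \<delta>\<close>])
    show "v i < v (Suc i)" if "i < m" for i
      using strict_mono_onD[OF v(1), of i "Suc i"] that by simp
    show "c i \<in> borel_measurable (\<F> (v i))" for i
      using simple_value_measurable_filtration[OF h] simple_value_measurable_filtration[OF r]
      unfolding c_def[abs_def] by (intro borel_measurable_diff) auto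
  qed (use v in simp)
qed

end

lemma step_value_measurable [measurable]: "(\<lambda>s. simple_value h s \<omega>) \<in> borel_measurable borel"
  unfolding simple_value_def by measurable

text \<open>Joint measurability is given for times in [0, \<infinity>). Constant continuation to
  negative times makes it a statement about the product with \<open>lborel\<close>, as integration
  over time with a parameter demands.\<close>

lemma measurable_process_extend:
  assumes "measurable_process M G"
  shows "(\<lambda>(\<omega>, s). G (max 0 s) \<omega>) \<in> borel_measurable (M \<Otimes>\<^sub>M lborel)"
proof -
  have "(\<lambda>(\<omega>, s). (max 0 s, \<omega>)) \<in> M \<Otimes>\<^sub>M lborel \<rightarrow>\<^sub>M restrict_space borel {0 :: real..} \<Otimes>\<^sub>M M"
    by (auto intro!: measurable_Pair measurable_restrict_space2 simp: split_beta')
  from measurable_compose[OF this assms[unfolded measurable_process_def]]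
  show ?thesis by (simp add: split_beta')
qed

lemma measurable_process_path:
  assumes "measurable_process M G" "\<omega> \<in> space M"
  shows "(\<lambda>s. G (max 0 s) \<omega>) \<in> borel_measurable borel"
  using measurable_compose[OF measurable_Pair1'[OF assms(2), of lborel] measurable_process_extend[OF assms(1)]]
  by simp

lemma indicator_mult_power2: "(indicator A x * y)\<^sup>2 = (indicator A x * y\<^sup>2 :: real)"
  by (simp add: indicator_def)

lemma zero_step: "adapted_step F \<lparr>pieces = 0, knot = \<lambda>_. 0, coeff = \<lambda>_ _. 0\<rparr>"
  "simple_value \<lparr>pieces = 0, knot = \<lambda>_. 0, coeff = \<lambda>_ _. 0\<rparr> s \<omega> = 0"
  by (auto simp: adapted_step_def simple_value_def)

context wiener_with_initial
begin

text \<open>A special case of the statement on differences: the second process is taken to be the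
  zero process.\<close>

lemma step_square_integrable:
  assumes "adapted_step \<F> h" "0 \<le> t"
  shows "square_integrable lborel (\<lambda>s. indicator {0..t} s * simple_value h s \<omega>)"
  using simple_ito_integral_diff_prob_bound(2)[OF assms(1) zero_step(1) assms(2) zero_less_one zero_less_one, where \<omega> = \<omega>]
  by (simp add: square_integrable_def set_integrable_def zero_step indicator_mult_power2)

lemma step_L2_distance_measurable:
  assumes h: "adapted_step \<F> h" and G: "measurable_process M G"
  shows "(\<lambda>\<omega>. LINT s:{0..t}|lborel. (simple_value h s \<omega> - G s \<omega>)\<^sup>2) \<in> borel_measurable M"
proof -
  have [measurable]: "coeff h i \<in> borel_measurable M" if "i < pieces h" for i
    using h that measurable_filtration_M by (auto simp: adapted_step_def)
  have [measurable]: "(\<lambda>(\<omega>, s). simple_value h s \<omega>) \<in> borel_measurable (M \<Otimes>\<^sub>M lborel)"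
    unfolding simple_value_def split_beta' by (intro borel_measurable_sum) (auto intro!: borel_measurable_times)
  note [measurable] = measurable_process_extend[OF G]
  have "(\<lambda>(\<omega>, s). indicator {0..t} s * (simple_value h s \<omega> - G (max 0 s) \<omega>)\<^sup>2) \<in> borel_measurable (M \<Otimes>\<^sub>M lborel)"
    by measurable
  from lborel.borel_measurable_lebesgue_integral[OF this]
  have "(\<lambda>\<omega>. \<integral>s. indicator {0..t} s * (simple_value h s \<omega> - G (max 0 s) \<omega>)\<^sup>2 \<partial>lborel) \<in> borel_measurable M"
    by simp
  also have "(\<lambda>\<omega>. \<integral>s. indicator {0..t} s * (simple_value h s \<omega> - G (max 0 s) \<omega>)\<^sup>2 \<partial>lborel)
    = (\<lambda>\<omega>. LINT s:{0..t}|lborel. (simple_value h s \<omega> - G s \<omega>)\<^sup>2)"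
    unfolding set_lebesgue_integral_def
    by (intro ext Bochner_Integration.integral_cong) (auto simp: indicator_def)
  finally show ?thesis .
qed

text \<open>The constant 2 comes from (x + y)^2 \<le> 2 x^2 + 2 y^2; squared distances are the
  quantities that \<open>has_ito_integral\<close> controls.\<close>

lemma step_L2_triangle:
  assumes h: "adapted_step \<F> h" and r: "adapted_step \<F> r" and G: "measurable_process M G"
    and \<omega>: "\<omega> \<in> space M" and int: "set_integrable lborel {0..t} (\<lambda>s. (G s \<omega>)\<^sup>2)" and "0 \<le> t"
  shows "(LINT s:{0..t}|lborel. (simple_value h s \<omega> - simple_value r s \<omega>)\<^sup>2)
    \<le> 2 * (LINT s:{0..t}|lborel. (simple_value h s \<omega> - G s \<omega>)\<^sup>2)
      + 2 * (LINT s:{0..t}|lborel. (simple_value r s \<omega> - G s \<omega>)\<^sup>2)"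
proof -
  have eq: "(LINT s:{0..t}|lborel. (f s)\<^sup>2) = (\<integral>s. (indicator {0..t} s * f s)\<^sup>2 \<partial>lborel)" for f :: "real \<Rightarrow> real"
    unfolding set_lebesgue_integral_def
    by (intro Bochner_Integration.integral_cong) (auto simp: indicator_def)
  have "(\<lambda>s. indicator {0..t} s * G (max 0 s) \<omega>) \<in> borel_measurable lborel"
    using measurable_process_path[OF G \<omega>] by measurable
  also have "(\<lambda>s. indicator {0..t} s * G (max 0 s) \<omega>) = (\<lambda>s. indicator {0..t} s * G s \<omega>)"
    by (auto simp: indicator_def)
  finally have sqG: "square_integrable lborel (\<lambda>s. indicator {0..t} s * G s \<omega>)"
    using int by (simp add: square_integrable_def set_integrable_def indicator_mult_power2)
  note sq1 = square_integrable_diff[OF step_square_integrable[OF h \<open>0 \<le> t\<close>, where \<omega> = \<omega>] sqG]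
  note sq2 = square_integrable_diff[OF sqG step_square_integrable[OF r \<open>0 \<le> t\<close>, where \<omega> = \<omega>]]
  have "(\<integral>s. (indicator {0..t} s * (simple_value h s \<omega> - simple_value r s \<omega>))\<^sup>2 \<partial>lborel)
    \<le> 2 * (\<integral>s. (indicator {0..t} s * (simple_value h s \<omega> - G s \<omega>))\<^sup>2 \<partial>lborel)
      + 2 * (\<integral>s. (indicator {0..t} s * (G s \<omega> - simple_value r s \<omega>))\<^sup>2 \<partial>lborel)"
    using expectation_square_add_le[OF sq1 sq2] by (simp add: algebra_simps)
  also have "(\<lambda>s. (indicator {0..t} s * (G s \<omega> - simple_value r s \<omega>))\<^sup>2)
    = (\<lambda>s. (indicator {0..t} s * (simple_value r s \<omega> - G s \<omega>))\<^sup>2)"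
    by (simp add: power_mult_distrib power2_commute)
  finally show ?thesis unfolding eq .
qed

text \<open>The definition offers one unknown sequence \<open>h n\<close>, while the sums of
  interest belong to \<open>r k\<close>. Both approximate G, so their integrals are close in
  probability. With k and \<delta> fixed, n tends to infinity and eliminates \<open>h n\<close>;
  only afterwards k grows, and the leftover \<open>4 * \<delta> / \<epsilon>\<^sup>2\<close> is as
  small as desired.\<close>

theorem ito_integral_limit:
  assumes ito: "has_ito_integral M \<F> B G t J" and "0 \<le> t" and r: "\<And>k. adapted_step \<F> (r k)"
    and lim: "AE \<omega> in M. (\<lambda>k. LINT s:{0..t}|lborel. (simple_value (r k) s \<omega> - G s \<omega>)\<^sup>2) \<longlonglongrightarrow> 0"
  shows "converges_in_probability M (\<lambda>k. simple_ito_integral B (r k) t) J"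
proof -
  obtain h :: "nat \<Rightarrow> 'a simple_process" where h0: "\<And>n. adapted_simple M \<F> (h n)"
    and hG: "converges_in_probability M
          (\<lambda>n \<omega>. LINT s:{0..t}|lborel. (simple_value (h n) s \<omega> - G s \<omega>)\<^sup>2) (\<lambda>_. 0)"
    and hJ: "converges_in_probability M (\<lambda>n. simple_ito_integral B (h n) t) J"
    using ito unfolding has_ito_integral_def by blast
  have G: "measurable_process M G" and int: "AE \<omega> in M. set_integrable lborel {0..t} (\<lambda>s. (G s \<omega>)\<^sup>2)"
    using ito unfolding has_ito_integral_def by blast+
  have h: "adapted_step \<F> (h n)" for n by (rule adapted_simple_imp_step[OF h0])
  define d where "d n \<omega> = (LINT s:{0..t}|lborel. (simple_value (h n) s \<omega> - G s \<omega>)\<^sup>2)" for n \<omega>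
  define e where "e k \<omega> = (LINT s:{0..t}|lborel. (simple_value (r k) s \<omega> - G s \<omega>)\<^sup>2)" for k \<omega>
  have [measurable]: "d n \<in> borel_measurable M" "e k \<in> borel_measurable M" for n k
    unfolding d_def[abs_def] e_def[abs_def] by (intro step_L2_distance_measurable h r G)+
  have [measurable]: "simple_ito_integral B (h n) t \<in> borel_measurable M"
    "simple_ito_integral B (r k) t \<in> borel_measurable M" for n k
    by (intro simple_ito_integral_measurable h r \<open>0 \<le> t\<close>)+
  have [measurable]: "J \<in> borel_measurable M" by (rule converges_in_probabilityD(2)[OF hJ])
  have eP: "converges_in_probability M e (\<lambda>_. 0)"
    by (rule AE_imp_converges_in_probability) (use lim in \<open>auto simp: e_def\<close>)
  have dP: "converges_in_probability M d (\<lambda>_. 0)"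
    using hG by (simp add: d_def[abs_def])
  have bound: "prob {\<omega> \<in> space M. \<bar>simple_ito_integral B (r k) t \<omega> - J \<omega>\<bar> > \<epsilon>}
    \<le> prob {\<omega> \<in> space M. \<bar>e k \<omega> - 0\<bar> > \<delta> / 4} + 4 * \<delta> / \<epsilon>\<^sup>2" if "0 < \<epsilon>" "0 < \<delta>" for k \<epsilon> \<delta>
  proof (rule LIMSEQ_le_const)
    let ?a = "\<lambda>n. prob {\<omega> \<in> space M. \<bar>simple_ito_integral B (h n) t \<omega> - J \<omega>\<bar> > \<epsilon> / 2}"
    let ?b = "\<lambda>n. prob {\<omega> \<in> space M. \<bar>d n \<omega> - 0\<bar> > \<delta> / 4}"
    let ?c = "prob {\<omega> \<in> space M. \<bar>e k \<omega> - 0\<bar> > \<delta> / 4}"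
    have "(\<lambda>n. ?a n + (?b n + (?c + 4 * \<delta> / \<epsilon>\<^sup>2))) \<longlonglongrightarrow> 0 + (0 + (?c + 4 * \<delta> / \<epsilon>\<^sup>2))"
      by (intro tendsto_add tendsto_const converges_in_probabilityD(3)[OF hJ] converges_in_probabilityD(3)[OF dP])
        (use that in auto)
    then show "(\<lambda>n. ?a n + (?b n + (?c + 4 * \<delta> / \<epsilon>\<^sup>2))) \<longlonglongrightarrow> ?c + 4 * \<delta> / \<epsilon>\<^sup>2" by simp
    show "\<exists>N. \<forall>n\<ge>N. prob {\<omega> \<in> space M. \<bar>simple_ito_integral B (r k) t \<omega> - J \<omega>\<bar> > \<epsilon>}
       \<le> ?a n + (?b n + (?c + 4 * \<delta> / \<epsilon>\<^sup>2))"
    proof (intro exI allI impI)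
      fix n
      let ?S1 = "{\<omega> \<in> space M. \<bar>simple_ito_integral B (h n) t \<omega> - J \<omega>\<bar> > \<epsilon> / 2}"
      let ?S2 = "{\<omega> \<in> space M. \<bar>simple_ito_integral B (h n) t \<omega> - simple_ito_integral B (r k) t \<omega>\<bar> > \<epsilon> / 2}"
      let ?Q = "\<lambda>\<omega>. LINT s:{0..t}|lborel. (simple_value (h n) s \<omega> - simple_value (r k) s \<omega>)\<^sup>2"
      have "prob {\<omega> \<in> space M. \<bar>simple_ito_integral B (r k) t \<omega> - J \<omega>\<bar> > \<epsilon>} \<le> prob (?S1 \<union> ?S2)"
      proof (rule finite_measure_mono)
        show "{\<omega> \<in> space M. \<bar>simple_ito_integral B (r k) t \<omega> - J \<omega>\<bar> > \<epsilon>} \<subseteq> ?S1 \<union> ?S2"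
        proof
          fix \<omega> assume "\<omega> \<in> {\<omega> \<in> space M. \<bar>simple_ito_integral B (r k) t \<omega> - J \<omega>\<bar> > \<epsilon>}"
          then have "\<omega> \<in> space M" "\<epsilon> < \<bar>(simple_ito_integral B (h n) t \<omega> - J \<omega>) - (simple_ito_integral B (h n) t \<omega> - simple_ito_integral B (r k) t \<omega>)\<bar>"
            by auto
          then show "\<omega> \<in> ?S1 \<union> ?S2"
            using abs_triangle_ineq4[of "simple_ito_integral B (h n) t \<omega> - J \<omega>" "simple_ito_integral B (h n) t \<omega> - simple_ito_integral B (r k) t \<omega>"]
            by auto
        qed
      qed measurable
      also have "\<dots> \<le> prob ?S1 + prob ?S2" by (rule measure_Un_le) measurable
      also have "prob ?S2 \<le> prob {\<omega> \<in> space M. ?Q \<omega> > \<delta>} + \<delta> / (\<epsilon> / 2)\<^sup>2"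
        by (rule simple_ito_integral_diff_prob_bound(1)[OF h r \<open>0 \<le> t\<close>]) (use that in auto)
      \<comment> \<open>Almost everywhere \<open>?Q\<close> is at most 2 d + 2 e, so a value above
        \<delta> forces d or e above \<delta> / 4.\<close>
      also have "prob {\<omega> \<in> space M. ?Q \<omega> > \<delta>} \<le> prob ({\<omega> \<in> space M. \<bar>d n \<omega> - 0\<bar> > \<delta> / 4} \<union> {\<omega> \<in> space M. \<bar>e k \<omega> - 0\<bar> > \<delta> / 4})"
      proof (rule finite_measure_mono_AE)
        show "AE \<omega> in M. \<omega> \<in> {\<omega> \<in> space M. ?Q \<omega> > \<delta>} \<longrightarrow>
          \<omega> \<in> {\<omega> \<in> space M. \<bar>d n \<omega> - 0\<bar> > \<delta> / 4} \<union> {\<omega> \<in> space M. \<bar>e k \<omega> - 0\<bar> > \<delta> / 4}"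
          using int
        proof eventually_elim
          case (elim \<omega>)
          show ?case
          proof
            assume \<omega>: "\<omega> \<in> {\<omega> \<in> space M. ?Q \<omega> > \<delta>}"
            then have "?Q \<omega> \<le> 2 * d n \<omega> + 2 * e k \<omega>"
              unfolding d_def e_def by (intro step_L2_triangle h r G elim \<open>0 \<le> t\<close>) auto
            then show "\<omega> \<in> {\<omega> \<in> space M. \<bar>d n \<omega> - 0\<bar> > \<delta> / 4} \<union> {\<omega> \<in> space M. \<bar>e k \<omega> - 0\<bar> > \<delta> / 4}"
              using \<omega> by auto
          qed
        qed
      qed measurable
      also have "\<dots> \<le> ?b n + ?c" by (rule measure_Un_le) measurable
      finally show "prob {\<omega> \<in> space M. \<bar>simple_ito_integral B (r k) t \<omega> - J \<omega>\<bar> > \<epsilon>}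
         \<le> ?a n + (?b n + (?c + 4 * \<delta> / \<epsilon>\<^sup>2))"
        by (simp add: power_divide algebra_simps)
    qed
  qed
  show ?thesis
    unfolding converges_in_probability_def
  proof (intro conjI allI impI)
    fix \<epsilon> :: real assume \<epsilon>: "\<epsilon> > 0"
    show "(\<lambda>k. prob {\<omega> \<in> space M. \<bar>simple_ito_integral B (r k) t \<omega> - J \<omega>\<bar> > \<epsilon>}) \<longlonglongrightarrow> 0"
    proof (rule LIMSEQ_I)
      fix \<eta> :: real assume \<eta>: "0 < \<eta>"
      define \<delta> where "\<delta> = \<eta> * \<epsilon>\<^sup>2 / 8"
      have \<delta>: "0 < \<delta>" "4 * \<delta> / \<epsilon>\<^sup>2 = \<eta> / 2" using \<epsilon> \<eta> by (auto simp: \<delta>_def)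
      obtain K where K: "\<And>k. k \<ge> K \<Longrightarrow> prob {\<omega> \<in> space M. \<bar>e k \<omega> - 0\<bar> > \<delta> / 4} < \<eta> / 2"
        using LIMSEQ_D[OF converges_in_probabilityD(3)[OF eP, of "\<delta> / 4"], of "\<eta> / 2"] \<delta> \<eta> by auto
      have "prob {\<omega> \<in> space M. \<bar>simple_ito_integral B (r k) t \<omega> - J \<omega>\<bar> > \<epsilon>} < \<eta>" if "k \<ge> K" for k
        using bound[OF \<epsilon> \<delta>(1), of k] K[OF that] \<delta>(2) by simp
      then show "\<exists>K. \<forall>k\<ge>K. norm (prob {\<omega> \<in> space M. \<bar>simple_ito_integral B (r k) t \<omega> - J \<omega>\<bar> > \<epsilon>} - 0) < \<eta>"
        by auto
    qed
  qed auto
qed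

end

section \<open>Euler sums\<close>

text \<open>The right end is exempt from the bound because a step function on half-open cells of
  [0, t] is 0 at t.\<close>

lemma set_integral_abs_le:
  fixes f :: "real \<Rightarrow> real"
  assumes "\<And>x. 0 \<le> x \<Longrightarrow> x < t \<Longrightarrow> \<bar>f x\<bar> \<le> e" "0 \<le> t" "0 \<le> e"
  shows "\<bar>LINT x:{0..t}|lborel. f x\<bar> \<le> e * t"
proof -
  have "\<bar>LINT x:{0..t}|lborel. f x\<bar> \<le> (\<integral>x. \<bar>indicator {0..t} x *\<^sub>R f x\<bar> \<partial>lborel)"
    unfolding set_lebesgue_integral_def by (rule integral_abs_bound)
  also have "\<dots> \<le> (\<integral>x. e * indicator {0..t} x \<partial>lborel)"
  proof (rule integral_mono_AE')
    show "AE x in lborel. \<bar>indicator {0..t} x *\<^sub>R f x\<bar> \<le> e * indicator {0..t} x"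
      using AE_lborel_singleton[of t] by eventually_elim (use assms in \<open>auto simp: indicator_def\<close>)
    show "integrable lborel (\<lambda>x. e * indicator {0..t} x)"
      by (intro integrable_mult_right integrable_real_indicator) (auto simp: emeasure_lborel_Icc_eq)
  qed (use assms in auto)
  also have "\<dots> = e * t" using assms by simp
  finally show ?thesis .
qed

lemma step_value_cell:
  fixes u :: "nat \<Rightarrow> real"
  assumes u: "\<And>i. i < m \<Longrightarrow> u i \<le> u (Suc i)" "u 0 \<le> x" "x < u m"
  shows "\<exists>j<m. u j \<le> x \<and> x < u (Suc j) \<and> (\<Sum>i<m. c i * indicator {u i..<u (Suc i)} x) = (c j :: real)"
proof -
  obtain j where j: "j < m" "u j \<le> x" "x < u (Suc j)"
    using partition_cell_exists[OF u(2,3)] by blast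
  have le: "u i \<le> u k" if "i \<le> k" "k \<le> m" for i k
    using that
  proof (induction k rule: dec_induct)
    case (step n)
    then show ?case using u(1)[of n] by auto
  qed simp
  have "indicator {u i..<u (Suc i)} x = (if i = j then 1 else 0 :: real)" if "i < m" for i
    using le[of "Suc i" j] le[of "Suc j" i] that j
    by (cases i j rule: linorder_cases) (auto simp: indicator_def)
  then have "(\<Sum>i<m. c i * indicator {u i..<u (Suc i)} x) = (\<Sum>i<m. c i * (if i = j then 1 else 0))"
    by (intro sum.cong) auto
  also have "\<dots> = c j"
    using j by (simp add: if_distrib sum.delta cong: if_cong)
  finally show ?thesis using j by blast
qed

text \<open>Uniform continuity on [0, t] makes step function and path uniformly close once the mesh
  is small. The upper limit t' is separate from the end t of the grid, since one and the same grid
  is integrated up to s and up to t.\<close>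

lemma step_approximation:
  fixes u :: "nat \<Rightarrow> nat \<Rightarrow> real" and y :: "real \<Rightarrow> real"
  assumes y: "continuous_on {0..t} y" and t': "0 \<le> t'" "t' \<le> t"
    and u: "\<And>n i. i < m n \<Longrightarrow> u n i \<le> u n (Suc i)" "\<And>n. u n 0 = 0" "\<And>n. u n (m n) = t"
    and mesh: "\<And>n i. i < m n \<Longrightarrow> u n (Suc i) - u n i \<le> d n" "d \<longlonglongrightarrow> 0"
  defines "S \<equiv> \<lambda>n x. \<Sum>i<m n. y (u n i) * indicator {u n i..<u n (Suc i)} x"
  shows "(\<lambda>n. LINT x:{0..t'}|lborel. (S n x - y x)\<^sup>2) \<longlonglongrightarrow> 0"
    and "(\<lambda>n. LINT x:{0..t'}|lborel. S n x) \<longlonglongrightarrow> (LINT x:{0..t'}|lborel. y x)"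
proof -
  have unif: "uniformly_continuous_on {0..t} y"
    by (rule compact_uniformly_continuous[OF y]) simp
  have close: "\<forall>\<^sub>F n in sequentially. \<forall>x. 0 \<le> x \<and> x < t \<longrightarrow> \<bar>S n x - y x\<bar> \<le> e" if "0 < e" for e
  proof -
    obtain \<delta> where \<delta>: "0 < \<delta>" "\<And>x x'. x \<in> {0..t} \<Longrightarrow> x' \<in> {0..t} \<Longrightarrow> dist x' x < \<delta> \<Longrightarrow> dist (y x') (y x) < e"
      using unif \<open>0 < e\<close> unfolding uniformly_continuous_on_def by metis
    have "\<forall>\<^sub>F n in sequentially. d n < \<delta>"
      using order_tendstoD(2)[OF mesh(2) \<open>0 < \<delta>\<close>] .
    then show ?thesis
    proof eventually_elim
      case (elim n)
      show ?case
      proof (intro allI impI)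
        fix x assume x: "0 \<le> x \<and> x < t"
        obtain j where j: "j < m n" "u n j \<le> x" "x < u n (Suc j)" "S n x = y (u n j)"
          using step_value_cell[of "m n" "u n" x "\<lambda>i. y (u n i)"] u x unfolding S_def by auto
        \<comment> \<open>Monotonicity is available up to index \<open>m n\<close> only, hence the
          capped index.\<close>
        have "u n 0 \<le> u n j"
          using lift_Suc_mono_le[of "\<lambda>i. u n (min i (m n))" 0 j] u(1)[of _ n] j
          by (auto simp: min_def Suc_le_eq)
        then have "dist (y (u n j)) (y x) < e"
          using j x mesh(1)[OF j(1)] elim u(2)[of n] by (intro \<delta>(2)) (auto simp: dist_real_def)
        then show "\<bar>S n x - y x\<bar> \<le> e" using j by (simp add: dist_real_def)
      qed
    qed
  qed
  show "(\<lambda>n. LINT x:{0..t'}|lborel. (S n x - y x)\<^sup>2) \<longlonglongrightarrow> 0"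
  proof (rule LIMSEQ_I)
    fix \<eta> :: real assume "0 < \<eta>"
    \<comment> \<open>The cap 1 ensures e^2 \<le> e for the squared error, and \<open>t' + 1\<close>
      avoids division by 0.\<close>
    define e where "e = min 1 (\<eta> / (t' + 1))"
    have e: "0 < e" "e \<le> 1" using \<open>0 < \<eta>\<close> t' by (auto simp: e_def)
    have "e * t' < e * (t' + 1)" using e by simp
    also have "\<dots> \<le> \<eta> / (t' + 1) * (t' + 1)" using t' by (intro mult_right_mono) (auto simp: e_def)
    also have "\<dots> = \<eta>" using t' by simp
    finally have et: "e * t' < \<eta>" .
    have "\<forall>\<^sub>F n in sequentially. norm ((LINT x:{0..t'}|lborel. (S n x - y x)\<^sup>2) - 0) < \<eta>"
      using close[OF e(1)]
    proof eventually_elim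
      case (elim n)
      have "\<bar>(S n x - y x)\<^sup>2\<bar> \<le> e" if "0 \<le> x" "x < t'" for x
      proof -
        have "\<bar>S n x - y x\<bar> \<le> e" using elim that t' by auto
        then have "\<bar>S n x - y x\<bar> * \<bar>S n x - y x\<bar> \<le> e * 1" using e by (intro mult_mono) auto
        then show ?thesis by (simp add: power2_eq_square)
      qed
      then have "\<bar>LINT x:{0..t'}|lborel. (S n x - y x)\<^sup>2\<bar> \<le> e * t'"
        using e t' by (intro set_integral_abs_le) auto
      then show ?case using et by simp
    qed
    then show "\<exists>N. \<forall>n\<ge>N. norm ((LINT x:{0..t'}|lborel. (S n x - y x)\<^sup>2) - 0) < \<eta>"
      by (simp add: eventually_sequentially)
  qed
  show "(\<lambda>n. LINT x:{0..t'}|lborel. S n x) \<longlonglongrightarrow> (LINT x:{0..t'}|lborel. y x)"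
  proof (rule LIMSEQ_I)
    fix \<eta> :: real assume "0 < \<eta>"
    define e where "e = \<eta> / (t' + 1)"
    have e: "0 < e" using \<open>0 < \<eta>\<close> t' by (auto simp: e_def)
    have "e * t' < e * (t' + 1)" using e by simp
    also have "\<dots> = \<eta>" using t' by (simp add: e_def)
    finally have et: "e * t' < \<eta>" .
    have y_int: "set_integrable lborel {0..t'} y"
      by (rule borel_integrable_atLeastAtMost', rule continuous_on_subset[OF y]) (use t' in auto)
    have S_int: "set_integrable lborel {0..t'} (S n)" for n
      unfolding S_def set_integrable_def sum_distrib_left scaleR_sum_right
    proof (intro Bochner_Integration.integrable_sum)
      fix i
      have "integrable lborel (\<lambda>x. y (u n i) * indicator ({0..t'} \<inter> {u n i..<u n (Suc i)}) x)"
        by (intro integrable_mult_right integrable_real_indicator emeasure_bounded_finite bounded_Int) auto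
      then show "integrable lborel (\<lambda>x. indicat_real {0..t'} x *\<^sub>R (y (u n i) * indicat_real {u n i..<u n (Suc i)} x))"
        by (simp add: indicator_inter_arith mult_ac)
    qed
    have "\<forall>\<^sub>F n in sequentially. norm ((LINT x:{0..t'}|lborel. S n x) - (LINT x:{0..t'}|lborel. y x)) < \<eta>"
      using close[OF e(1)]
    proof eventually_elim
      case (elim n)
      have "\<bar>LINT x:{0..t'}|lborel. S n x - y x\<bar> \<le> e * t'"
        using e t' elim by (intro set_integral_abs_le) auto
      then show ?case using et set_integral_diff(2)[OF S_int y_int] by simp
    qed
    then show "\<exists>N. \<forall>n\<ge>N. norm ((LINT x:{0..t'}|lborel. S n x) - (LINT x:{0..t'}|lborel. y x)) < \<eta>"
      by (simp add: eventually_sequentially)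
  qed
qed

text \<open>With time as integrator the discrete integral is a Riemann sum. Drift and noise can thus
  be sampled on one grid and split at s by one lemma.\<close>

lemma simple_time_integral:
  assumes "adapted_step F h" "0 \<le> t"
  shows "simple_ito_integral (\<lambda>x _. x) h t \<omega> = (LINT x:{0..t}|lborel. simple_value h x \<omega>)"
proof -
  obtain v and m :: nat where v: "strict_mono_on {..m} v" "v 0 = 0" "v m = t"
    and D: "\<And>i. i \<le> pieces h \<Longrightarrow> min t (knot h i) \<in> v ` {..m}"
    by (rule common_partition[OF assms(1,1,2)]) blast
  have "(LINT x:{0..t}|lborel. simple_value h x \<omega>) = (\<Sum>j<m. simple_value h (v j) \<omega> * (v (Suc j) - v j))"
    by (rule lborel_integral_step(2)[OF v]) (rule simple_value_constant_on_cell[OF v(1,3) D])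
  moreover have "simple_ito_integral (\<lambda>x _. x) h t \<omega> = (\<Sum>j<m. simple_value h (v j) \<omega> * (v (Suc j) - v j))"
    by (rule simple_ito_integral_partition[OF v(1,3) _ D]) (use assms(1) in \<open>auto simp: adapted_step_def\<close>)
  ultimately show ?thesis by simp
qed

section \<open>Grids and sums over subintervals\<close>

definition sampled_process :: "nat \<Rightarrow> (nat \<Rightarrow> real) \<Rightarrow> (real \<Rightarrow> 'a \<Rightarrow> real) \<Rightarrow> 'a simple_process" where
  "sampled_process m u Y = \<lparr>pieces = m, knot = u, coeff = \<lambda>i. Y (u i)\<rparr>"

definition uniform_grid :: "real \<Rightarrow> real \<Rightarrow> nat \<Rightarrow> nat \<Rightarrow> real" where
  "uniform_grid s t n j = s + (t - s) * real j / real (Suc n)"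

lemma uniform_grid_bounds [simp]:
  assumes "s \<le> t"
  shows "uniform_grid s t n 0 = s" "uniform_grid s t n (Suc n) = t"
    and "uniform_grid s t n j \<le> uniform_grid s t n (Suc j)"
    and "s \<le> uniform_grid s t n j" "j \<le> Suc n \<Longrightarrow> uniform_grid s t n j \<le> t"
proof -
  show "j \<le> Suc n \<Longrightarrow> uniform_grid s t n j \<le> t"
    using mult_left_mono[of "real j" "real (Suc n)" "t - s"] assms
    by (simp add: uniform_grid_def field_simps)
  show "uniform_grid s t n j \<le> uniform_grid s t n (Suc j)"
    unfolding uniform_grid_def using assms by (intro add_left_mono divide_right_mono mult_left_mono) auto
  show "uniform_grid s t n (Suc n) = t"
    by (simp add: uniform_grid_def del: of_nat_Suc)
qed (use assms in \<open>simp_all add: uniform_grid_def del: of_nat_Suc\<close>)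

lemma uniform_grid_step:
  "uniform_grid s t n (Suc j) - uniform_grid s t n j = (t - s) / real (Suc n)"
proof -
  have "uniform_grid s t n (Suc j) - uniform_grid s t n j = (t - s) * (real (Suc j) - real j) / real (Suc n)"
    by (simp add: uniform_grid_def diff_divide_distrib right_diff_distrib del: of_nat_Suc)
  then show ?thesis by simp
qed

text \<open>The Ito integral is only given over intervals starting at 0, so Euler sums on \<open>[s, t]\<close> are
  differences of sums over grids of \<open>[0, t]\<close> that contain \<open>s\<close>.\<close>

definition split_grid :: "real \<Rightarrow> real \<Rightarrow> nat \<Rightarrow> nat \<Rightarrow> real" where
  "split_grid s t n j = (if j \<le> Suc n then uniform_grid 0 s n j else uniform_grid s t n (j - Suc n))"

lemma split_grid_bounds:
  assumes "0 \<le> s" "s \<le> t"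
  shows "split_grid s t n 0 = 0" "split_grid s t n (2 * Suc n) = t"
    and "split_grid s t n j \<le> split_grid s t n (Suc j)"
    and "split_grid s t n (Suc j) - split_grid s t n j \<le> t / real (Suc n)"
    and "split_grid s t n (Suc n + i) = uniform_grid s t n i"
    and "j \<le> Suc n \<Longrightarrow> split_grid s t n j \<le> s"
proof -
  have eq: "split_grid s t n (Suc n + i) = uniform_grid s t n i" for i
    using assms by (cases i) (auto simp: split_grid_def)
  then show "split_grid s t n (Suc n + i) = uniform_grid s t n i" .
  show "split_grid s t n 0 = 0" using assms by (simp add: split_grid_def)
  show "split_grid s t n (2 * Suc n) = t"
    using eq[of "Suc n"] assms by (simp only: mult_2 uniform_grid_bounds)
  show "j \<le> Suc n \<Longrightarrow> split_grid s t n j \<le> s"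
    using assms by (simp add: split_grid_def)
  have "split_grid s t n (Suc j) - split_grid s t n j = (if j < Suc n then s else t - s) / real (Suc n)"
  proof (cases "j < Suc n")
    case True
    then show ?thesis using uniform_grid_step[of 0 s n j] by (simp add: split_grid_def)
  next
    case False
    then obtain i where "j = Suc n + i" using le_Suc_ex[of "Suc n" j] by auto
    then show ?thesis using eq[of i] eq[of "Suc i"] uniform_grid_step[of s t n i] by simp
  qed
  moreover have "0 \<le> (if j < Suc n then s else t - s) / real (Suc n)"
    using assms by simp
  moreover have "(if j < Suc n then s else t - s) / real (Suc n) \<le> t / real (Suc n)"
    using assms by (intro divide_right_mono) auto
  ultimately show "split_grid s t n j \<le> split_grid s t n (Suc j)"
    "split_grid s t n (Suc j) - split_grid s t n j \<le> t / real (Suc n)"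
    by linarith+
qed

text \<open>In the integral up to s the cells after s are capped to length 0, and cells before s
  contribute equally to both integrals; the difference keeps exactly the cells of [s, t].\<close>

lemma simple_ito_integral_split_grid:
  fixes Y W :: "real \<Rightarrow> 'a \<Rightarrow> real"
  assumes "0 \<le> s" "s \<le> t"
  defines "h \<equiv> \<lambda>n. sampled_process (2 * Suc n) (split_grid s t n) Y" and "w \<equiv> uniform_grid s t"
  shows "simple_ito_integral W (h n) t \<omega> - simple_ito_integral W (h n) s \<omega>
    = (\<Sum>j<Suc n. Y (w n j) \<omega> * (W (w n (Suc j)) \<omega> - W (w n j) \<omega>))"
proof -
  note g = split_grid_bounds[OF assms(1,2)]
  have split: "(\<Sum>j<N + k. f j) = (\<Sum>j<N. f j) + (\<Sum>j<k. f (N + j))" for N k :: nat and f :: "nat \<Rightarrow> real"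
    by (induction k) (simp_all add: add.assoc)
  let ?u = "split_grid s t n"
  define f where "f j = Y (?u j) \<omega> * (W (min t (?u (Suc j))) \<omega> - W (min t (?u j)) \<omega>)
    - Y (?u j) \<omega> * (W (min s (?u (Suc j))) \<omega> - W (min s (?u j)) \<omega>)" for j
  have "simple_ito_integral W (h n) t \<omega> - simple_ito_integral W (h n) s \<omega> = (\<Sum>j<Suc n + Suc n. f j)"
    by (simp add: h_def simple_ito_integral_def sampled_process_def f_def sum_subtractf mult_2)
  also have "\<dots> = (\<Sum>j<Suc n. f j) + (\<Sum>j<Suc n. f (Suc n + j))"
    by (rule split)
  also have "(\<Sum>j<Suc n. f j) = 0"
  proof (rule sum.neutral, safe)
    fix j assume "j < Suc n"
    then have "?u j \<le> s" "?u (Suc j) \<le> s" using g(6)[of j n] g(6)[of "Suc j" n] by auto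
    then show "f j = 0" using assms by (simp add: f_def min_def)
  qed
  also have "(\<Sum>j<Suc n. f (Suc n + j)) = (\<Sum>j<Suc n. Y (w n j) \<omega> * (W (w n (Suc j)) \<omega> - W (w n j) \<omega>))"
  proof (rule sum.cong[OF refl])
    fix j assume "j \<in> {..<Suc n}"
    then have j: "j \<le> Suc n" "Suc j \<le> Suc n" by auto
    have u: "?u (Suc n + j) = w n j" "?u (Suc (Suc n + j)) = w n (Suc j)"
      using g(5)[of n j] g(5)[of n "Suc j"] by (simp_all add: w_def)
    have b: "min t (w n j) = w n j" "min t (w n (Suc j)) = w n (Suc j)" "min s (w n j) = s" "min s (w n (Suc j)) = s"
      using uniform_grid_bounds[OF assms(2)] j by (auto simp: w_def min_absorb1 min_absorb2)
    show "f (Suc n + j) = Y (w n j) \<omega> * (W (w n (Suc j)) \<omega> - W (w n j) \<omega>)"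
      unfolding f_def u b by simp
  qed
  finally show ?thesis by simp
qed

section \<open>The solution as a limit of Euler sums\<close>

locale pantograph = wiener_with_initial M B X0
  for M :: "'a measure" and B and X0 +
  fixes a b \<sigma> \<rho> q :: real and X :: "real \<Rightarrow> 'a \<Rightarrow> real"
  assumes q: "0 < q" "q < 1"
    and X0_square: "integrable M (\<lambda>\<omega>. (X0 \<omega>)\<^sup>2)"
    and solution: "pantograph_solution M B X0 a b \<sigma> \<rho> q X"
begin

definition drift :: "real \<Rightarrow> 'a \<Rightarrow> real" where
  "drift s \<omega> = a * X s \<omega> + b * X (q * s) \<omega>"

definition diffusion :: "real \<Rightarrow> 'a \<Rightarrow> real" where
  "diffusion s \<omega> = \<sigma> * X s \<omega> + \<rho> * X (q * s) \<omega>"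

lemma X_filtration: "0 \<le> t \<Longrightarrow> X t \<in> borel_measurable (\<F> t)"
  using solution by (auto simp: pantograph_solution_def adapted_process_def)

lemma X_measurable [measurable]: "0 \<le> t \<Longrightarrow> X t \<in> borel_measurable M"
  using X_filtration measurable_filtration_M by blast

lemma X_continuous: "AE \<omega> in M. continuous_on {0..} (\<lambda>t. X t \<omega>)"
  using solution by (auto simp: pantograph_solution_def)

lemma X_0: "AE \<omega> in M. X 0 \<omega> = X0 \<omega>"
  using solution by (auto simp: pantograph_solution_def)

lemma q_mult: "0 \<le> s \<Longrightarrow> 0 \<le> q * s" "0 \<le> s \<Longrightarrow> q * s \<le> s"
  using q by (auto simp: mult_left_le_one_le)

text \<open>As q < 1, the delayed value belongs to the past; this is what makes both coefficients
  adapted.\<close>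

lemma X_q_filtration: "0 \<le> t \<Longrightarrow> X (q * t) \<in> borel_measurable (\<F> t)"
  using measurable_filtration_mono[OF X_filtration] q_mult by blast

lemma drift_filtration: "0 \<le> t \<Longrightarrow> drift t \<in> borel_measurable (\<F> t)"
  unfolding drift_def[abs_def] using X_filtration X_q_filtration by (intro borel_measurable_add borel_measurable_times) auto

lemma diffusion_filtration: "0 \<le> t \<Longrightarrow> diffusion t \<in> borel_measurable (\<F> t)"
  unfolding diffusion_def[abs_def] using X_filtration X_q_filtration by (intro borel_measurable_add borel_measurable_times) auto

lemma linear_combination_continuous:
  assumes "continuous_on {0..} (\<lambda>t. X t \<omega>)"
  shows "continuous_on {0..} (\<lambda>s. c * X s \<omega> + d * X (q * s) \<omega>)"
proof -
  have "continuous_on {0..} (\<lambda>s. X (q * s) \<omega>)"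
    by (rule continuous_on_compose2[OF assms]) (use q_mult in \<open>auto intro!: continuous_intros\<close>)
  then show ?thesis using assms by (intro continuous_intros)
qed

lemma sampled_process_adapted:
  assumes "0 \<le> s" "s \<le> t" and Y: "\<And>x. 0 \<le> x \<Longrightarrow> Y x \<in> borel_measurable (\<F> x)"
  shows "adapted_step \<F> (sampled_process (2 * Suc n) (split_grid s t n) Y)"
proof -
  note g = split_grid_bounds[OF assms(1,2), of n]
  have "0 \<le> split_grid s t n i" for i
    using lift_Suc_mono_le[of "split_grid s t n" 0 i, OF g(3)] g(1) by simp
  then show ?thesis
    using g Y by (auto simp: adapted_step_def sampled_process_def)
qed

lemma simple_time_integral_measurable:
  assumes "adapted_step \<F> h"
  shows "simple_ito_integral (\<lambda>x _. x) h t \<in> borel_measurable M"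
  unfolding simple_ito_integral_def[abs_def]
  using assms measurable_filtration_M
  by (intro borel_measurable_sum borel_measurable_times borel_measurable_const) (auto simp: adapted_step_def)

lemma sampled_process_limits:
  assumes "0 \<le> s" "s \<le> t" "0 \<le> t'" "t' \<le> t" and Y: "continuous_on {0..} (\<lambda>x. Y x \<omega>)"
  defines "h \<equiv> \<lambda>n. sampled_process (2 * Suc n) (split_grid s t n) Y"
  shows "(\<lambda>n. LINT x:{0..t'}|lborel. (simple_value (h n) x \<omega> - Y x \<omega>)\<^sup>2) \<longlonglongrightarrow> 0"
    and "(\<lambda>n. LINT x:{0..t'}|lborel. simple_value (h n) x \<omega>) \<longlonglongrightarrow> (LINT x:{0..t'}|lborel. Y x \<omega>)"
proof -
  note g = split_grid_bounds[OF assms(1,2)]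
  have Y': "continuous_on {0..t} (\<lambda>x. Y x \<omega>)"
    by (rule continuous_on_subset[OF Y]) auto
  have mesh: "(\<lambda>n. t / real (Suc n)) \<longlonglongrightarrow> 0"
    using tendsto_mult[OF tendsto_const[of t] LIMSEQ_inverse_real_of_nat] by (simp add: divide_inverse)
  note * = step_approximation[OF Y' assms(3,4), of "\<lambda>n. 2 * Suc n" "split_grid s t", OF g(3) g(1) g(2) g(4) mesh]
  show "(\<lambda>n. LINT x:{0..t'}|lborel. (simple_value (h n) x \<omega> - Y x \<omega>)\<^sup>2) \<longlonglongrightarrow> 0"
    "(\<lambda>n. LINT x:{0..t'}|lborel. simple_value (h n) x \<omega>) \<longlonglongrightarrow> (LINT x:{0..t'}|lborel. Y x \<omega>)"
    using * by (simp_all add: h_def simple_value_def sampled_process_def)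
qed

text \<open>Starting at an arbitrary s from the value \<open>X s\<close> is what permits a local
  expansion in time. Drift sums converge almost surely because paths are continuous, noise sums in
  probability by \<open>ito_integral_limit\<close>.\<close>

theorem Euler_limit:
  assumes st: "0 \<le> s" "s \<le> t"
  defines "w \<equiv> uniform_grid s t"
  shows "converges_in_probability M (\<lambda>n \<omega>. X s \<omega> + (\<Sum>j<Suc n. drift (w n j) \<omega> * (w n (Suc j) - w n j))
      + (\<Sum>j<Suc n. diffusion (w n j) \<omega> * (B (w n (Suc j)) \<omega> - B (w n j) \<omega>))) (X t)"
proof -
  have t: "0 \<le> t" using st by simp
  obtain J where J: "\<And>t. 0 \<le> t \<Longrightarrow> has_ito_integral M \<F> B diffusion t (J t)"
    and X: "\<And>t. 0 \<le> t \<Longrightarrow> AE \<omega> in M. X t \<omega> = X0 \<omega> + (LINT s:{0..t}|lborel. drift s \<omega>) + J t \<omega>"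
    using solution unfolding pantograph_solution_def drift_def diffusion_def[abs_def] by blast
  define hD where "hD n = sampled_process (2 * Suc n) (split_grid s t n) drift" for n
  define hG where "hG n = sampled_process (2 * Suc n) (split_grid s t n) diffusion" for n
  have hD: "adapted_step \<F> (hD n)" and hG: "adapted_step \<F> (hG n)" for n
    unfolding hD_def hG_def using sampled_process_adapted[OF st] drift_filtration diffusion_filtration by auto
  have G: "converges_in_probability M (\<lambda>n. simple_ito_integral B (hG n) t') (J t')" if "0 \<le> t'" "t' \<le> t" for t'
  proof (rule ito_integral_limit[OF J[OF that(1)] that(1) hG])
    show "AE \<omega> in M. (\<lambda>k. LINT s:{0..t'}|lborel. (simple_value (hG k) s \<omega> - diffusion s \<omega>)\<^sup>2) \<longlonglongrightarrow> 0"
      using X_continuous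
    proof eventually_elim
      case (elim \<omega>)
      then show ?case
        unfolding hG_def using sampled_process_limits(1)[OF st that, of diffusion \<omega>] linear_combination_continuous
        by (simp add: diffusion_def)
    qed
  qed
  have D_lim: "AE \<omega> in M. (\<lambda>n. simple_ito_integral (\<lambda>x _. x) (hD n) t' \<omega>) \<longlonglongrightarrow> (LINT x:{0..t'}|lborel. drift x \<omega>)"
    if "0 \<le> t'" "t' \<le> t" for t'
    using X_continuous
  proof eventually_elim
    case (elim \<omega>)
    have "continuous_on {0..} (\<lambda>x. drift x \<omega>)"
      unfolding drift_def by (rule linear_combination_continuous[OF elim])
    then show ?case
      unfolding simple_time_integral[OF hD that(1)] unfolding hD_def
      by (rule sampled_process_limits(2)[OF st that])
  qed
  have [measurable]: "simple_ito_integral (\<lambda>x _. x) (hD n) t' \<in> borel_measurable M" for n t'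
    by (rule simple_time_integral_measurable[OF hD])
  have [measurable]: "simple_ito_integral B (hG n) t \<in> borel_measurable M" "simple_ito_integral B (hG n) s \<in> borel_measurable M" for n
    by (rule simple_ito_integral_measurable[OF hG], fact)+
  have J_meas [measurable]: "J t \<in> borel_measurable M" "J s \<in> borel_measurable M"
    using converges_in_probabilityD(2)[OF G[of t]] converges_in_probabilityD(2)[OF G[of s]] st by auto
  have [measurable]: "X t \<in> borel_measurable M" "X s \<in> borel_measurable M" using st by auto
  \<comment> \<open>Almost surely the drift integral over [s, t]. Defined as what the noise leaves
    of the increment, it is measurable at once, and the limits add up to \<open>X t\<close> at every
    point.\<close>
  define Z where "Z \<omega> = X t \<omega> - X s \<omega> - (J t \<omega> - J s \<omega>)" for \<omega>
  have [measurable]: "Z \<in> borel_measurable M" unfolding Z_def[abs_def] by measurable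
  have D: "converges_in_probability M
     (\<lambda>n \<omega>. simple_ito_integral (\<lambda>x _. x) (hD n) t \<omega> - simple_ito_integral (\<lambda>x _. x) (hD n) s \<omega>) Z"
  proof (rule AE_imp_converges_in_probability)
    show "AE \<omega> in M. (\<lambda>n. simple_ito_integral (\<lambda>x _. x) (hD n) t \<omega> - simple_ito_integral (\<lambda>x _. x) (hD n) s \<omega>) \<longlonglongrightarrow> Z \<omega>"
      using D_lim[OF t order_refl] D_lim[OF st] X[OF t] X[OF st(1)]
    proof eventually_elim
      case (elim \<omega>)
      have "Z \<omega> = (LINT x:{0..t}|lborel. drift x \<omega>) - (LINT x:{0..s}|lborel. drift x \<omega>)"
        using elim(3,4) by (simp add: Z_def)
      then show ?case using tendsto_diff[OF elim(1,2)] by simp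
    qed
  qed measurable
  have "converges_in_probability M (\<lambda>n \<omega>. X s \<omega> +
      (simple_ito_integral (\<lambda>x _. x) (hD n) t \<omega> - simple_ito_integral (\<lambda>x _. x) (hD n) s \<omega>) +
      (simple_ito_integral B (hG n) t \<omega> - simple_ito_integral B (hG n) s \<omega>)) (\<lambda>\<omega>. X s \<omega> + Z \<omega> + (J t \<omega> - J s \<omega>))"
    by (intro converges_in_probability_add converges_in_probability_diff D G t st order_refl converges_in_probability_const)
      measurable
  then show ?thesis
    unfolding Z_def hD_def hG_def simple_ito_integral_split_grid[OF st] w_def by simp
qed

end

section \<open>Second moments of the solution\<close>

lemma square_sum3_le: "(x + y + z)\<^sup>2 \<le> 3 * x\<^sup>2 + 3 * y\<^sup>2 + 3 * (z :: real)\<^sup>2"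
proof -
  have "0 \<le> (x - y)\<^sup>2 + (y - z)\<^sup>2 + (x - z)\<^sup>2" by simp
  then show ?thesis by (simp add: power2_eq_square algebra_simps)
qed

lemma square_integrable_bounded_mult:
  assumes "square_integrable M Y" "A \<in> borel_measurable M" "\<And>\<omega>. \<bar>A \<omega>\<bar> \<le> 1"
  shows "square_integrable M (\<lambda>\<omega>. A \<omega> * Y \<omega>)"
    and "(\<integral>\<omega>. (A \<omega> * Y \<omega>)\<^sup>2 \<partial>M) \<le> (\<integral>\<omega>. (Y \<omega>)\<^sup>2 \<partial>M)"
proof -
  have le: "(A \<omega> * Y \<omega>)\<^sup>2 \<le> (Y \<omega>)\<^sup>2" for \<omega>
    using mult_right_mono[of "(A \<omega>)\<^sup>2" 1 "(Y \<omega>)\<^sup>2"] power_mono[OF assms(3)[of \<omega>], of 2]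
    by (simp add: power_mult_distrib)
  have "integrable M (\<lambda>\<omega>. (A \<omega> * Y \<omega>)\<^sup>2)"
    by (rule Bochner_Integration.integrable_bound[OF square_integrableD(2)[OF assms(1)]])
      (use le square_integrableD(1)[OF assms(1)] assms(2) in auto)
  then show "square_integrable M (\<lambda>\<omega>. A \<omega> * Y \<omega>)"
    using square_integrableD(1)[OF assms(1)] assms(2) by (auto simp: square_integrable_def)
  show "(\<integral>\<omega>. (A \<omega> * Y \<omega>)\<^sup>2 \<partial>M) \<le> (\<integral>\<omega>. (Y \<omega>)\<^sup>2 \<partial>M)"
    by (rule integral_mono) (use \<open>integrable M _\<close> le square_integrableD(2)[OF assms(1)] in auto)
qed

text \<open>Cauchy-Schwarz for a sum of m terms. With \<open>\<delta>\<close> = t / m the prefactor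
  is t \<delta>, so the bound is t times a Riemann sum.\<close>

lemma expectation_square_scaled_sum_le:
  assumes "\<And>j. j < m \<Longrightarrow> square_integrable M (d j)"
  shows "(\<integral>\<omega>. (\<Sum>j<m. d j \<omega> * \<delta>)\<^sup>2 \<partial>M) \<le> real m * \<delta>\<^sup>2 * (\<Sum>j<m. \<integral>\<omega>. (d j \<omega>)\<^sup>2 \<partial>M)"
proof -
  have sq: "square_integrable M (\<lambda>\<omega>. \<Sum>j<m. d j \<omega> * \<delta>)"
    using assms square_integrable_cmult[of M _ \<delta>] by (intro square_integrable_sum) (auto simp: mult.commute)
  have le: "(\<Sum>j<m. d j \<omega> * \<delta>)\<^sup>2 \<le> real m * \<delta>\<^sup>2 * (\<Sum>j<m. (d j \<omega>)\<^sup>2)" for \<omega>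
    using sum_squared_le_sum_of_squares[of "\<lambda>j. d j \<omega> * \<delta>" "{..<m}"]
    by (simp add: power_mult_distrib sum_distrib_left mult_ac)
  have "(\<integral>\<omega>. (\<Sum>j<m. d j \<omega> * \<delta>)\<^sup>2 \<partial>M) \<le> (\<integral>\<omega>. real m * \<delta>\<^sup>2 * (\<Sum>j<m. (d j \<omega>)\<^sup>2) \<partial>M)"
    by (rule integral_mono) (use sq assms le in \<open>auto simp: square_integrable_def\<close>)
  also have "\<dots> = real m * \<delta>\<^sup>2 * (\<Sum>j<m. \<integral>\<omega>. (d j \<omega>)\<^sup>2 \<partial>M)"
    using assms by (simp add: square_integrable_def)
  finally show ?thesis .
qed

text \<open>By 1 + z \<le> exp z each term is at most an increment of exp (\<kappa> u) / \<kappa>,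
  and these telescope. The factor 1 / \<kappa> is the source of the contraction in the moment
  estimate.\<close>

lemma exp_riemann_sum_le:
  fixes \<kappa> :: real
  assumes "0 < \<kappa>"
  shows "(\<Sum>j<m. exp (\<kappa> * u j) * (u (Suc j) - u j)) \<le> exp (\<kappa> * u m) / \<kappa>"
proof -
  have "exp (\<kappa> * u j) * (u (Suc j) - u j) \<le> exp (\<kappa> * u (Suc j)) / \<kappa> - exp (\<kappa> * u j) / \<kappa>" for j
  proof -
    have "exp (\<kappa> * u j) * (1 + \<kappa> * (u (Suc j) - u j)) \<le> exp (\<kappa> * u j) * exp (\<kappa> * (u (Suc j) - u j))"
      by (intro mult_left_mono exp_ge_add_one_self) simp
    also have "\<dots> = exp (\<kappa> * u (Suc j))"
      by (simp add: exp_add[symmetric] algebra_simps)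
    finally show ?thesis using assms by (simp add: field_simps)
  qed
  then have "(\<Sum>j<m. exp (\<kappa> * u j) * (u (Suc j) - u j)) \<le> (\<Sum>j<m. exp (\<kappa> * u (Suc j)) / \<kappa> - exp (\<kappa> * u j) / \<kappa>)"
    by (intro sum_mono)
  also have "\<dots> = exp (\<kappa> * u m) / \<kappa> - exp (\<kappa> * u 0) / \<kappa>"
    by (rule sum_lessThan_telescope)
  also have "\<dots> \<le> exp (\<kappa> * u m) / \<kappa>" using assms by simp
  finally show ?thesis .
qed

lemma bounded_on_rationals_imp_bounded:
  fixes f :: "real \<Rightarrow> real"
  assumes f: "continuous_on {0..1} f" and le: "\<forall>r \<in> \<rat> \<inter> {0..1}. \<bar>f r\<bar> \<le> N" and x: "0 \<le> x" "x \<le> 1"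
  shows "\<bar>f x\<bar> \<le> N"
proof -
  have dense: "closure (\<rat> \<inter> {0..1}) = {0..1 :: real}"
  proof
    show "closure (\<rat> \<inter> {0..1}) \<subseteq> {0..1 :: real}"
      by (rule closure_minimal) auto
    show "{0..1 :: real} \<subseteq> closure (\<rat> \<inter> {0..1})"
    proof
      fix x :: real assume x: "x \<in> {0..1}"
      show "x \<in> closure (\<rat> \<inter> {0..1})"
      \<comment> \<open>Rationals slightly above x remain in [0, 1] only for x < 1; the point 1 is
        itself rational.\<close>
      proof (cases "x = 1")
        case True
        then show ?thesis by (intro subsetD[OF closure_subset]) auto
      next
        case False
        show ?thesis
          unfolding closure_approachable
        proof (intro allI impI)
          fix e :: real assume "0 < e"
          then obtain r where "r \<in> \<rat>" "x < r" "r < min 1 (x + e)"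
            using Rats_dense_in_real[of x "min 1 (x + e)"] x False by auto
          then show "\<exists>y\<in>\<rat> \<inter> {0..1}. dist y x < e"
            using x by (intro bexI[of _ r]) (auto simp: dist_real_def)
        qed
      qed
    qed
  qed
  show ?thesis
  proof (rule continuous_le_on_closure[of "\<rat> \<inter> {0..1}" "\<lambda>x. \<bar>f x\<bar>"])
    show "continuous_on (closure (\<rat> \<inter> {0..1})) (\<lambda>x. \<bar>f x\<bar>)"
      unfolding dense using f by (intro continuous_intros)
    show "x \<in> closure (\<rat> \<inter> {0..1})" unfolding dense using x by simp
  qed (use le in auto)
qed

section \<open>Finiteness of the second moment by cut-off\<close>

context pantograph
begin

lemma X0_second_moment: "square_integrable M (X 0)" "expectation (\<lambda>\<omega>. (X 0 \<omega>)\<^sup>2) = expectation (\<lambda>\<omega>. (X0 \<omega>)\<^sup>2)"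
proof -
  have "AE \<omega> in M. (X0 \<omega>)\<^sup>2 = (X 0 \<omega>)\<^sup>2"
    using X_0 by eventually_elim simp
  then have "integrable M (\<lambda>\<omega>. (X 0 \<omega>)\<^sup>2) \<longleftrightarrow> integrable M (\<lambda>\<omega>. (X0 \<omega>)\<^sup>2)"
    "expectation (\<lambda>\<omega>. (X 0 \<omega>)\<^sup>2) = expectation (\<lambda>\<omega>. (X0 \<omega>)\<^sup>2)"
    by (intro integrable_cong_AE[symmetric] integral_cong_AE[symmetric]; simp)+
  then show "square_integrable M (X 0)" "expectation (\<lambda>\<omega>. (X 0 \<omega>)\<^sup>2) = expectation (\<lambda>\<omega>. (X0 \<omega>)\<^sup>2)"
    using X0_square by (auto simp: square_integrable_def)
qed

text \<open>On almost every path, the indicator of \<open>\<bar>X\<bar> \<le> N\<close> on \<open>[0, t]\<close>; rational sampling makes it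
  adapted. It replaces a localizing stopping time.\<close>

definition stay :: "real \<Rightarrow> real \<Rightarrow> 'a \<Rightarrow> real" where
  "stay N t \<omega> = (if \<forall>r \<in> \<rat> \<inter> {0..1}. \<bar>X (t * r) \<omega>\<bar> \<le> N then 1 else 0)"

lemma stay_bounds: "\<bar>stay N t \<omega>\<bar> \<le> 1" "0 \<le> stay N t \<omega>"
  by (auto simp: stay_def)

lemma stay_filtration:
  assumes "0 \<le> t"
  shows "stay N t \<in> borel_measurable (\<F> t)"
proof -
  have C: "countable (\<rat> \<inter> {0..1 :: real})" by (rule countable_subset[OF _ countable_rat]) auto
  have [measurable]: "X (t * r) \<in> borel_measurable (\<F> t)" if "r \<in> \<rat> \<inter> {0..1}" for r
    using that assms mult_left_mono[of r 1 t] by (intro measurable_filtration_mono[OF X_filtration]) auto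
  have [measurable]: "Measurable.pred (\<F> t) (\<lambda>\<omega>. \<forall>r \<in> \<rat> \<inter> {0..1}. \<bar>X (t * r) \<omega>\<bar> \<le> N)"
    unfolding pred_def by (rule sets.sets_Collect_countable_All'[OF _ C]) measurable
  then show ?thesis
    unfolding stay_def[abs_def] by measurable
qed

lemma stay_measurable [measurable]: "0 \<le> t \<Longrightarrow> stay N t \<in> borel_measurable M"
  using stay_filtration measurable_filtration_M by blast

lemma stay_X_le: "0 \<le> N \<Longrightarrow> \<bar>stay N t \<omega> * X t \<omega>\<bar> \<le> N"
  by (auto simp: stay_def dest: bspec[of _ _ 1])

text \<open>A continuous path bounded at the rational fractions of t is bounded on all of [0, t].
  Staying until t therefore means staying at every earlier time, which allows the cut-off to be
  inserted into each coefficient of an Euler sum.\<close>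

lemma stay_mono:
  assumes "continuous_on {0..} (\<lambda>t. X t \<omega>)" "0 \<le> s" "s \<le> t" "stay N t \<omega> \<noteq> 0"
  shows "stay N s \<omega> = 1"
proof -
  have c: "continuous_on {0..1} (\<lambda>r. X (t * r) \<omega>)"
    by (rule continuous_on_compose2[OF assms(1)]) (use assms in \<open>auto intro!: continuous_intros\<close>)
  have b: "\<forall>r \<in> \<rat> \<inter> {0..1}. \<bar>X (t * r) \<omega>\<bar> \<le> N"
    using assms(4) by (auto simp: stay_def split: if_splits)
  have X: "\<bar>X x \<omega>\<bar> \<le> N" if "0 \<le> x" "x \<le> t" for x
  proof (cases "t = 0")
    case True
    then show ?thesis using that b by (auto dest: bspec[of _ _ 1])
  next
    case False
    then show ?thesis
      using bounded_on_rationals_imp_bounded[OF c b, of "x / t"] that assms by (simp add: field_simps)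
  qed
  have "s * r \<le> t" if "0 \<le> r" "r \<le> 1" for r
    using mult_left_mono[OF that(2) assms(2)] assms(3) by simp
  then show ?thesis
    unfolding stay_def using X assms(2) by auto
qed

lemma stay_eventually:
  assumes "continuous_on {0..} (\<lambda>t. X t \<omega>)" "0 \<le> t"
  shows "\<forall>\<^sub>F n in sequentially. stay (real n) t \<omega> = 1"
proof -
  have "compact ((\<lambda>x. X x \<omega>) ` {0..t})"
    by (intro compact_continuous_image continuous_on_subset[OF assms(1)]) auto
  then have "bounded ((\<lambda>x. X x \<omega>) ` {0..t})" by (rule compact_imp_bounded)
  then obtain K where "\<forall>y \<in> (\<lambda>x. X x \<omega>) ` {0..t}. norm y \<le> K" unfolding bounded_iff by blast
  then have K: "\<bar>X x \<omega>\<bar> \<le> K" if "0 \<le> x" "x \<le> t" for x using that by auto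
  have le: "t * r \<le> t" if "0 \<le> r" "r \<le> 1" for r
    using mult_left_mono[OF that(2) assms(2)] by simp
  obtain n0 :: nat where n0: "K \<le> real n0" using real_arch_simple by blast
  show ?thesis
    unfolding eventually_sequentially
  proof (intro exI allI impI)
    fix n assume "n0 \<le> n"
    then have "K \<le> real n" using n0 by linarith
    then show "stay (real n) t \<omega> = 1"
      using order_trans[OF K[OF _ le]] assms(2) by (auto simp: stay_def)
  qed
qed

lemma stay_X_square_integrable: "0 \<le> N \<Longrightarrow> 0 \<le> t \<Longrightarrow> square_integrable M (\<lambda>\<omega>. stay N t \<omega> * X t \<omega>)"
  unfolding square_integrable_def
  using stay_X_le[of N t] power_mono[OF stay_X_le[of N t], where n = 2]
  by (auto intro!: integrable_const_bound[of _ "N\<^sup>2"])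

text \<open>The delayed value is cut off too: as q s \<le> s, the factor \<open>stay N s\<close>
  absorbs \<open>stay N (q * s)\<close> up to a null set. The weight exp (\<kappa> s) increases with
  s, so the bound at q s is no worse than the one at s.\<close>

lemma stay_linear_combination:
  assumes "0 \<le> N" "0 \<le> s" "s \<le> T" "0 \<le> F" "0 \<le> \<kappa>"
    and F: "\<And>s. 0 \<le> s \<Longrightarrow> s \<le> T \<Longrightarrow> expectation (\<lambda>\<omega>. (stay N s \<omega> * X s \<omega>)\<^sup>2) \<le> F * exp (\<kappa> * s)"
  shows "square_integrable M (\<lambda>\<omega>. stay N s \<omega> * (c * X s \<omega> + d * X (q * s) \<omega>))"
    and "expectation (\<lambda>\<omega>. (stay N s \<omega> * (c * X s \<omega> + d * X (q * s) \<omega>))\<^sup>2) \<le> 2 * (c\<^sup>2 + d\<^sup>2) * (F * exp (\<kappa> * s))"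
proof -
  note qs = q_mult[OF assms(2)]
  have [measurable]: "X s \<in> borel_measurable M" "X (q * s) \<in> borel_measurable M"
    "stay N s \<in> borel_measurable M" "stay N (q * s) \<in> borel_measurable M"
    using qs assms by auto
  note sq1 = stay_X_square_integrable[OF \<open>0 \<le> N\<close> \<open>0 \<le> s\<close>]
  note sq2 = stay_X_square_integrable[OF \<open>0 \<le> N\<close> qs(1)]
  have "AE \<omega> in M. stay N s \<omega> * X (q * s) \<omega> = stay N s \<omega> * (stay N (q * s) \<omega> * X (q * s) \<omega>)"
    using X_continuous by eventually_elim (use stay_mono qs in fastforce)
  moreover note sq2' = square_integrable_bounded_mult[OF sq2 stay_measurable[OF \<open>0 \<le> s\<close>, of N] stay_bounds(1)]
  ultimately have sq3: "square_integrable M (\<lambda>\<omega>. stay N s \<omega> * X (q * s) \<omega>)"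
    and E3: "expectation (\<lambda>\<omega>. (stay N s \<omega> * X (q * s) \<omega>)\<^sup>2)
      = expectation (\<lambda>\<omega>. (stay N s \<omega> * (stay N (q * s) \<omega> * X (q * s) \<omega>))\<^sup>2)"
  proof -
    assume ae: "AE \<omega> in M. stay N s \<omega> * X (q * s) \<omega> = stay N s \<omega> * (stay N (q * s) \<omega> * X (q * s) \<omega>)"
    have ae2: "AE \<omega> in M. (stay N s \<omega> * X (q * s) \<omega>)\<^sup>2 = (stay N s \<omega> * (stay N (q * s) \<omega> * X (q * s) \<omega>))\<^sup>2"
      using ae by eventually_elim (simp only:)
    show "expectation (\<lambda>\<omega>. (stay N s \<omega> * X (q * s) \<omega>)\<^sup>2)
      = expectation (\<lambda>\<omega>. (stay N s \<omega> * (stay N (q * s) \<omega> * X (q * s) \<omega>))\<^sup>2)"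
      by (rule integral_cong_AE[OF _ _ ae2]) measurable
    have "integrable M (\<lambda>\<omega>. (stay N s \<omega> * X (q * s) \<omega>)\<^sup>2)
      = integrable M (\<lambda>\<omega>. (stay N s \<omega> * (stay N (q * s) \<omega> * X (q * s) \<omega>))\<^sup>2)"
      by (rule integrable_cong_AE[OF _ _ ae2]) measurable
    then show "square_integrable M (\<lambda>\<omega>. stay N s \<omega> * X (q * s) \<omega>)"
      using sq2'(1) by (auto simp: square_integrable_def)
  qed
  have "expectation (\<lambda>\<omega>. (stay N s \<omega> * X (q * s) \<omega>)\<^sup>2) \<le> F * exp (\<kappa> * (q * s))"
    unfolding E3 using sq2'(2) F[of "q * s"] qs assms by linarith
  also have "\<dots> \<le> F * exp (\<kappa> * s)"
    using qs assms by (intro mult_left_mono) (auto intro: mult_left_mono)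
  finally have le3: "expectation (\<lambda>\<omega>. (stay N s \<omega> * X (q * s) \<omega>)\<^sup>2) \<le> F * exp (\<kappa> * s)" .
  have eq: "stay N s \<omega> * (c * X s \<omega> + d * X (q * s) \<omega>) = c * (stay N s \<omega> * X s \<omega>) + d * (stay N s \<omega> * X (q * s) \<omega>)" for \<omega>
    by (simp add: algebra_simps)
  note sq4 = square_integrable_cmult[OF sq1, of c] and sq5 = square_integrable_cmult[OF sq3, of d]
  show "square_integrable M (\<lambda>\<omega>. stay N s \<omega> * (c * X s \<omega> + d * X (q * s) \<omega>))"
    unfolding eq by (rule square_integrable_add[OF sq4 sq5])
  have "expectation (\<lambda>\<omega>. (c * (stay N s \<omega> * X s \<omega>) + d * (stay N s \<omega> * X (q * s) \<omega>))\<^sup>2)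
    \<le> 2 * (c\<^sup>2 * expectation (\<lambda>\<omega>. (stay N s \<omega> * X s \<omega>)\<^sup>2)) + 2 * (d\<^sup>2 * expectation (\<lambda>\<omega>. (stay N s \<omega> * X (q * s) \<omega>)\<^sup>2))"
    using expectation_square_add_le[OF sq4 sq5] by (simp add: power_mult_distrib)
  also have "\<dots> \<le> 2 * (c\<^sup>2 * (F * exp (\<kappa> * s))) + 2 * (d\<^sup>2 * (F * exp (\<kappa> * s)))"
    using le3 F[of s] assms by (intro add_mono mult_left_mono) auto
  finally show "expectation (\<lambda>\<omega>. (stay N s \<omega> * (c * X s \<omega> + d * X (q * s) \<omega>))\<^sup>2) \<le> 2 * (c\<^sup>2 + d\<^sup>2) * (F * exp (\<kappa> * s))"
    unfolding eq by (simp add: algebra_simps)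
qed

text \<open>One Picard step in the norm with weight exp (- \<kappa> t). The bound F on the truncated
  moment enters the drift sum through Cauchy-Schwarz and the noise sum through the isometry; the
  weight turns integration in time into division by \<kappa>, and \<kappa> is so large that F
  returns with factor 1/2.\<close>

lemma stay_moment_step:
  assumes "0 \<le> N" "0 \<le> t" "t \<le> T" "0 \<le> F"
  defines "\<kappa> \<equiv> 6 * (2 * T * (a\<^sup>2 + b\<^sup>2) + 2 * (\<sigma>\<^sup>2 + \<rho>\<^sup>2)) + 1"
  assumes F: "\<And>s. 0 \<le> s \<Longrightarrow> s \<le> T \<Longrightarrow> expectation (\<lambda>\<omega>. (stay N s \<omega> * X s \<omega>)\<^sup>2) \<le> F * exp (\<kappa> * s)"
  shows "expectation (\<lambda>\<omega>. (stay N t \<omega> * X t \<omega>)\<^sup>2) \<le> (3 * expectation (\<lambda>\<omega>. (X0 \<omega>)\<^sup>2) + F / 2) * exp (\<kappa> * t)"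
proof -
  define w where "w = uniform_grid 0 t"
  have T: "0 \<le> T" using assms by simp
  have \<kappa>: "0 < \<kappa>" "1 \<le> \<kappa>" using T by (auto simp: \<kappa>_def add_nonneg_pos)
  note stay_meas [measurable] = stay_measurable[OF \<open>0 \<le> t\<close>, of N]
  \<comment> \<open>Cut off at their own time, the coefficients are square integrable and still
    adapted; a cut-off at the final time t would look ahead.\<close>
  define D where "D n j \<omega> = stay N (w n j) \<omega> * drift (w n j) \<omega>" for n j \<omega>
  define G where "G n j \<omega> = stay N (w n j) \<omega> * diffusion (w n j) \<omega>" for n j \<omega>
  have w0: "0 \<le> w n j" for n j using uniform_grid_bounds(4)[OF \<open>0 \<le> t\<close>] by (simp add: w_def)
  have wt: "w n j \<le> t" if "j \<le> Suc n" for n j using uniform_grid_bounds(5)[OF \<open>0 \<le> t\<close> that] by (simp add: w_def)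
  have wmono: "w n j \<le> w n (Suc j)" for n j using uniform_grid_bounds(3)[OF \<open>0 \<le> t\<close>] by (simp add: w_def)
  have step: "w n (Suc j) - w n j = t / real (Suc n)" for n j
    using uniform_grid_step[of 0 t n j] by (simp add: w_def)
  have DG: "square_integrable M (D n j)" "square_integrable M (G n j)"
    "expectation (\<lambda>\<omega>. (D n j \<omega>)\<^sup>2) \<le> 2 * (a\<^sup>2 + b\<^sup>2) * (F * exp (\<kappa> * w n j))"
    "expectation (\<lambda>\<omega>. (G n j \<omega>)\<^sup>2) \<le> 2 * (\<sigma>\<^sup>2 + \<rho>\<^sup>2) * (F * exp (\<kappa> * w n j))"
    if "j < Suc n" for n j
    unfolding D_def G_def drift_def diffusion_def
    using stay_linear_combination[OF \<open>0 \<le> N\<close> w0 _ \<open>0 \<le> F\<close> _ F, of n j] \<kappa> wt[of j n] that assms(3) by auto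
  define I1 where "I1 n \<omega> = (\<Sum>j<Suc n. D n j \<omega> * (w n (Suc j) - w n j))" for n \<omega>
  define I2 where "I2 n \<omega> = (\<Sum>j<Suc n. G n j \<omega> * (B (w n (Suc j)) \<omega> - B (w n j) \<omega>))" for n \<omega>
  define Y where "Y n \<omega> = stay N t \<omega> * (X 0 \<omega> + I1 n \<omega> + I2 n \<omega>)" for n \<omega>
  have I1: "square_integrable M (I1 n)" for n
    unfolding I1_def[abs_def]
  proof (rule square_integrable_sum)
    fix j assume "j \<in> {..<Suc n}"
    then have "square_integrable M (\<lambda>\<omega>. (w n (Suc j) - w n j) * D n j \<omega>)"
      by (intro square_integrable_cmult DG(1)) simp
    then show "square_integrable M (\<lambda>\<omega>. D n j \<omega> * (w n (Suc j) - w n j))"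
      by (simp only: mult.commute)
  qed
  have G_filtration: "G n j \<in> borel_measurable (\<F> (w n j))" for n j
    unfolding G_def[abs_def] by (intro borel_measurable_times stay_filtration diffusion_filtration w0)
  have I2: "square_integrable M (I2 n)"
    "expectation (\<lambda>\<omega>. (I2 n \<omega>)\<^sup>2) = (\<Sum>i<Suc n. expectation (\<lambda>\<omega>. (G n i \<omega>)\<^sup>2) * (w n (Suc i) - w n i))" for n
    using martingale_transform_isometry[of "w n" "Suc n" "G n" "\<lambda>_. 0", OF w0 wmono G_filtration DG(2)]
    by (auto simp: I2_def[abs_def] square_integrable_zero)
  have Y_sq: "square_integrable M (Y n)" for n
    unfolding Y_def[abs_def]
    by (intro square_integrable_bounded_mult(1) square_integrable_add X0_second_moment I1 I2 stay_meas stay_bounds)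
  define S where "S n = (\<Sum>j<Suc n. exp (\<kappa> * w n j) * (w n (Suc j) - w n j))" for n
  have S: "S n \<le> exp (\<kappa> * t) / \<kappa>" for n
    using exp_riemann_sum_le[OF \<kappa>(1), of "w n" "Suc n"] \<open>0 \<le> t\<close> by (simp add: S_def w_def del: sum.lessThan_Suc)
  have E1: "expectation (\<lambda>\<omega>. (I1 n \<omega>)\<^sup>2) \<le> t * (2 * (a\<^sup>2 + b\<^sup>2) * F * S n)" for n
  proof -
    have "expectation (\<lambda>\<omega>. (I1 n \<omega>)\<^sup>2) \<le> real (Suc n) * (t / real (Suc n))\<^sup>2 * (\<Sum>j<Suc n. expectation (\<lambda>\<omega>. (D n j \<omega>)\<^sup>2))"
      unfolding I1_def step by (rule expectation_square_scaled_sum_le) (rule DG(1))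
    also have "\<dots> = t * (\<Sum>j<Suc n. expectation (\<lambda>\<omega>. (D n j \<omega>)\<^sup>2) * (w n (Suc j) - w n j))"
      unfolding step sum_distrib_right[symmetric] by (simp add: power2_eq_square del: of_nat_Suc sum.lessThan_Suc)
    also have "\<dots> \<le> t * (\<Sum>j<Suc n. 2 * (a\<^sup>2 + b\<^sup>2) * (F * exp (\<kappa> * w n j)) * (w n (Suc j) - w n j))"
      using DG(3) wmono \<open>0 \<le> t\<close> by (intro mult_left_mono sum_mono mult_right_mono) auto
    also have "\<dots> = t * (2 * (a\<^sup>2 + b\<^sup>2) * F * S n)"
      by (simp add: S_def sum_distrib_left mult_ac del: sum.lessThan_Suc)
    finally show ?thesis .
  qed
  have E2: "expectation (\<lambda>\<omega>. (I2 n \<omega>)\<^sup>2) \<le> 2 * (\<sigma>\<^sup>2 + \<rho>\<^sup>2) * F * S n" for n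
  proof -
    have "expectation (\<lambda>\<omega>. (I2 n \<omega>)\<^sup>2) \<le> (\<Sum>j<Suc n. 2 * (\<sigma>\<^sup>2 + \<rho>\<^sup>2) * (F * exp (\<kappa> * w n j)) * (w n (Suc j) - w n j))"
      unfolding I2(2) using DG(4) wmono by (intro sum_mono mult_right_mono) auto
    also have "\<dots> = 2 * (\<sigma>\<^sup>2 + \<rho>\<^sup>2) * F * S n"
      by (simp add: S_def sum_distrib_left mult_ac del: sum.lessThan_Suc)
    finally show ?thesis .
  qed
  have Y_le: "expectation (\<lambda>\<omega>. (Y n \<omega>)\<^sup>2) \<le> (3 * expectation (\<lambda>\<omega>. (X0 \<omega>)\<^sup>2) + F / 2) * exp (\<kappa> * t)" for n
  proof -
    note sq = X0_second_moment(1) I1[of n] I2(1)[of n]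
    have "expectation (\<lambda>\<omega>. (Y n \<omega>)\<^sup>2) \<le> expectation (\<lambda>\<omega>. (X 0 \<omega> + I1 n \<omega> + I2 n \<omega>)\<^sup>2)"
      unfolding Y_def by (intro square_integrable_bounded_mult(2) square_integrable_add sq stay_meas stay_bounds)
    also have "\<dots> \<le> expectation (\<lambda>\<omega>. 3 * (X 0 \<omega>)\<^sup>2 + 3 * (I1 n \<omega>)\<^sup>2 + 3 * (I2 n \<omega>)\<^sup>2)"
      using sq square_integrable_add[OF square_integrable_add[OF sq(1,2)] sq(3)]
      by (intro integral_mono square_sum3_le) (auto simp: square_integrable_def)
    also have "\<dots> = 3 * expectation (\<lambda>\<omega>. (X0 \<omega>)\<^sup>2) + 3 * expectation (\<lambda>\<omega>. (I1 n \<omega>)\<^sup>2) + 3 * expectation (\<lambda>\<omega>. (I2 n \<omega>)\<^sup>2)"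
      using sq X0_second_moment(2) by (auto simp: square_integrable_def)
    also have "\<dots> \<le> 3 * expectation (\<lambda>\<omega>. (X0 \<omega>)\<^sup>2) + 3 * (t * (2 * (a\<^sup>2 + b\<^sup>2) * F * S n)) + 3 * (2 * (\<sigma>\<^sup>2 + \<rho>\<^sup>2) * F * S n)"
      using E1[of n] E2[of n] by linarith
    also have "\<dots> = 3 * expectation (\<lambda>\<omega>. (X0 \<omega>)\<^sup>2) + 3 * (2 * t * (a\<^sup>2 + b\<^sup>2) + 2 * (\<sigma>\<^sup>2 + \<rho>\<^sup>2)) * (F * S n)"
      by (simp add: algebra_simps)
    \<comment> \<open>\<open>\<kappa>\<close> is 6 times the bracket with T in place of t, plus 1:
      half of it dominates the prefactor, and the 1 keeps it positive.\<close>
    also have "3 * (2 * t * (a\<^sup>2 + b\<^sup>2) + 2 * (\<sigma>\<^sup>2 + \<rho>\<^sup>2)) * (F * S n) \<le> \<kappa> / 2 * (F * (exp (\<kappa> * t) / \<kappa>))"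
    proof (rule mult_mono)
      have "t * (a\<^sup>2 + b\<^sup>2) \<le> T * (a\<^sup>2 + b\<^sup>2)" using assms by (intro mult_right_mono) auto
      then show "3 * (2 * t * (a\<^sup>2 + b\<^sup>2) + 2 * (\<sigma>\<^sup>2 + \<rho>\<^sup>2)) \<le> \<kappa> / 2" by (simp add: \<kappa>_def)
      show "F * S n \<le> F * (exp (\<kappa> * t) / \<kappa>)" by (intro mult_left_mono S \<open>0 \<le> F\<close>)
      have "0 \<le> S n" unfolding S_def using wmono by (intro sum_nonneg mult_nonneg_nonneg) auto
      then show "0 \<le> F * S n" using \<open>0 \<le> F\<close> by simp
    qed (use \<kappa> in simp)
    also have "\<dots> = F / 2 * exp (\<kappa> * t)" using \<kappa> by simp
    also have "3 * expectation (\<lambda>\<omega>. (X0 \<omega>)\<^sup>2) \<le> 3 * expectation (\<lambda>\<omega>. (X0 \<omega>)\<^sup>2) * exp (\<kappa> * t)"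
      using mult_left_mono[of 1 "exp (\<kappa> * t)" "3 * expectation (\<lambda>\<omega>. (X0 \<omega>)\<^sup>2)"] \<kappa> \<open>0 \<le> t\<close> by simp
    finally show ?thesis by (simp add: algebra_simps)
  qed
  \<comment> \<open>Where \<open>stay N t\<close> is nonzero, all earlier cut-offs are 1, so
    \<open>Y n\<close> is almost everywhere \<open>stay N t\<close> times the original Euler
    sum.\<close>
  have "converges_in_probability M Y (\<lambda>\<omega>. stay N t \<omega> * X t \<omega>)"
  proof (rule converges_in_probability_cong_AE)
    show "converges_in_probability M (\<lambda>n \<omega>. stay N t \<omega> * (X 0 \<omega> + (\<Sum>j<Suc n. drift (w n j) \<omega> * (w n (Suc j) - w n j))
      + (\<Sum>j<Suc n. diffusion (w n j) \<omega> * (B (w n (Suc j)) \<omega> - B (w n j) \<omega>)))) (\<lambda>\<omega>. stay N t \<omega> * X t \<omega>)"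
      unfolding w_def
      by (rule converges_in_probability_mult_bounded[OF Euler_limit[OF order_refl \<open>0 \<le> t\<close>] stay_meas zero_less_one]) (rule stay_bounds)
    show "Y n \<in> borel_measurable M" for n using Y_sq by (simp add: square_integrable_def)
    show "AE \<omega> in M. stay N t \<omega> * (X 0 \<omega> + (\<Sum>j<Suc n. drift (w n j) \<omega> * (w n (Suc j) - w n j))
      + (\<Sum>j<Suc n. diffusion (w n j) \<omega> * (B (w n (Suc j)) \<omega> - B (w n j) \<omega>))) = Y n \<omega>" for n
      using X_continuous
    proof eventually_elim
      case (elim \<omega>)
      show ?case
      proof (cases "stay N t \<omega> = 0")
        case False
        have "stay N (w n j) \<omega> = 1" if "j < Suc n" for j
          using stay_mono[OF elim w0 wt False] that by simp
        then show ?thesis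
          unfolding Y_def I1_def I2_def D_def G_def by simp
      qed (simp add: Y_def)
    qed
  qed (use assms(2) in auto)
  from converges_in_probability_square_le(2)[OF this Y_sq Y_le tendsto_const]
  show ?thesis .
qed

text \<open>The map F -> 3 E0 + F / 2 has the fixed point 6 E0. Starting from the crude bound 6 E0 +
  N^2, the part that depends on N is halved in each round and disappears in the limit. The iteration
  takes the place of Gronwall's inequality.\<close>

lemma stay_moment_bound:
  assumes "0 \<le> N" "0 \<le> t" "t \<le> T"
  shows "expectation (\<lambda>\<omega>. (stay N t \<omega> * X t \<omega>)\<^sup>2)
    \<le> 6 * expectation (\<lambda>\<omega>. (X0 \<omega>)\<^sup>2) * exp ((6 * (2 * T * (a\<^sup>2 + b\<^sup>2) + 2 * (\<sigma>\<^sup>2 + \<rho>\<^sup>2)) + 1) * t)"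
proof -
  define \<kappa> where "\<kappa> = 6 * (2 * T * (a\<^sup>2 + b\<^sup>2) + 2 * (\<sigma>\<^sup>2 + \<rho>\<^sup>2)) + 1"
  define E0 where "E0 = expectation (\<lambda>\<omega>. (X0 \<omega>)\<^sup>2)"
  have "0 \<le> E0" by (simp add: E0_def)
  have "0 \<le> \<kappa>" using assms by (auto simp: \<kappa>_def)
  have iter: "\<forall>s. 0 \<le> s \<and> s \<le> T \<longrightarrow> expectation (\<lambda>\<omega>. (stay N s \<omega> * X s \<omega>)\<^sup>2) \<le> (6 * E0 + N\<^sup>2 / 2 ^ k) * exp (\<kappa> * s)" for k
  proof (induction k)
    case 0
    show ?case
    proof safe
      fix s assume s: "0 \<le> s" "s \<le> T"
      have "expectation (\<lambda>\<omega>. (stay N s \<omega> * X s \<omega>)\<^sup>2) \<le> expectation (\<lambda>_. N\<^sup>2)"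
        using square_integrableD(2)[OF stay_X_square_integrable[OF \<open>0 \<le> N\<close> s(1)]]
          power_mono[OF stay_X_le[OF \<open>0 \<le> N\<close>], where n = 2] by (intro integral_mono) auto
      also have "\<dots> = N\<^sup>2" by (simp add: prob_space)
      also have "\<dots> \<le> (6 * E0 + N\<^sup>2) * 1" using \<open>0 \<le> E0\<close> by simp
      also have "\<dots> \<le> (6 * E0 + N\<^sup>2) * exp (\<kappa> * s)"
        using \<open>0 \<le> E0\<close> \<open>0 \<le> \<kappa>\<close> s by (intro mult_left_mono) auto
      finally show "expectation (\<lambda>\<omega>. (stay N s \<omega> * X s \<omega>)\<^sup>2) \<le> (6 * E0 + N\<^sup>2 / 2 ^ 0) * exp (\<kappa> * s)" by simp
    qed
  next
    case (Suc k)
    show ?case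
    proof safe
      fix s assume s: "0 \<le> s" "s \<le> T"
      have "expectation (\<lambda>\<omega>. (stay N s \<omega> * X s \<omega>)\<^sup>2) \<le> (3 * E0 + (6 * E0 + N\<^sup>2 / 2 ^ k) / 2) * exp (\<kappa> * s)"
        unfolding E0_def \<kappa>_def
        by (rule stay_moment_step[OF \<open>0 \<le> N\<close> s]) (use Suc \<open>0 \<le> E0\<close> in \<open>auto simp: E0_def \<kappa>_def\<close>)
      then show "expectation (\<lambda>\<omega>. (stay N s \<omega> * X s \<omega>)\<^sup>2) \<le> (6 * E0 + N\<^sup>2 / 2 ^ Suc k) * exp (\<kappa> * s)"
        by (simp add: field_simps)
    qed
  qed
  have "(\<lambda>k. (1 / 2) ^ k) \<longlonglongrightarrow> (0 :: real)"
    by (rule LIMSEQ_power_zero) simp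
  then have lim: "(\<lambda>k. (6 * E0 + N\<^sup>2 * (1 / 2) ^ k) * exp (\<kappa> * t)) \<longlonglongrightarrow> (6 * E0 + N\<^sup>2 * 0) * exp (\<kappa> * t)"
    by (rule tendsto_mult[OF tendsto_add[OF tendsto_const tendsto_mult[OF tendsto_const]] tendsto_const])
  have le: "expectation (\<lambda>\<omega>. (stay N t \<omega> * X t \<omega>)\<^sup>2) \<le> (6 * E0 + N\<^sup>2 * (1 / 2) ^ k) * exp (\<kappa> * t)" for k
    using iter[of k, rule_format, of t] assms(2,3) by (simp add: power_one_over)
  have "expectation (\<lambda>\<omega>. (stay N t \<omega> * X t \<omega>)\<^sup>2) \<le> (6 * E0 + N\<^sup>2 * 0) * exp (\<kappa> * t)"
    by (rule LIMSEQ_le_const[OF lim]) (use le in blast)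
  then show ?thesis by (simp add: E0_def \<kappa>_def)
qed

text \<open>The bound on truncated moments is uniform in N, and on each continuous path the cut-off
  is eventually 1, so Fatou's lemma removes it.\<close>

theorem second_moment_bound:
  shows "\<exists>C\<ge>0. \<forall>t. 0 \<le> t \<and> t \<le> T \<longrightarrow> square_integrable M (X t) \<and> expectation (\<lambda>\<omega>. (X t \<omega>)\<^sup>2) \<le> C"
proof -
  define \<kappa> where "\<kappa> = 6 * (2 * T * (a\<^sup>2 + b\<^sup>2) + 2 * (\<sigma>\<^sup>2 + \<rho>\<^sup>2)) + 1"
  define C where "C = 6 * expectation (\<lambda>\<omega>. (X0 \<omega>)\<^sup>2) * exp (\<kappa> * T)"
  show ?thesis
  proof (intro exI conjI allI impI)
    show "0 \<le> C" by (simp add: C_def)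
    fix t assume "0 \<le> t \<and> t \<le> T"
    then have t: "0 \<le> t" "t \<le> T" by auto
    then have "0 \<le> \<kappa>" by (auto simp: \<kappa>_def)
    have [measurable]: "X t \<in> borel_measurable M" "\<And>N. stay N t \<in> borel_measurable M" using t by auto
    have conv: "converges_in_probability M (\<lambda>n \<omega>. stay (real n) t \<omega> * X t \<omega>) (X t)"
    proof (rule AE_imp_converges_in_probability)
      show "AE \<omega> in M. (\<lambda>n. stay (real n) t \<omega> * X t \<omega>) \<longlonglongrightarrow> X t \<omega>"
        using X_continuous
      proof eventually_elim
        case (elim \<omega>)
        from stay_eventually[OF elim t(1)] show ?case
          by (intro tendsto_eventually) (auto elim: eventually_mono)
      qed
    qed measurable
    have "expectation (\<lambda>\<omega>. (stay (real n) t \<omega> * X t \<omega>)\<^sup>2) \<le> C" for n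
    proof -
      have "expectation (\<lambda>\<omega>. (stay (real n) t \<omega> * X t \<omega>)\<^sup>2) \<le> 6 * expectation (\<lambda>\<omega>. (X0 \<omega>)\<^sup>2) * exp (\<kappa> * t)"
        unfolding \<kappa>_def by (rule stay_moment_bound[OF _ t]) simp
      also have "\<dots> \<le> C"
        unfolding C_def using t \<open>0 \<le> \<kappa>\<close> by (intro mult_left_mono) (auto intro: mult_left_mono)
      finally show ?thesis .
    qed
    from converges_in_probability_square_le[OF conv stay_X_square_integrable this tendsto_const] t
    show "square_integrable M (X t)" "expectation (\<lambda>\<omega>. (X t \<omega>)\<^sup>2) \<le> C" by auto
  qed
qed

lemma X_square_integrable: "0 \<le> t \<Longrightarrow> square_integrable M (X t)"
  using second_moment_bound[of t] by blast

end

section \<open>Local expansion of the moments\<close>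

context wiener_with_initial
begin

text \<open>With h = t - s, a drift sum has order h in L2 and a noise sum order sqrt h. The
  coefficients are abstract because the estimate is also applied to differences from values frozen
  at s.\<close>

lemma Euler_sum_square_le:
  fixes n :: nat
  assumes st: "0 \<le> s" "s \<le> t"
  defines "w \<equiv> uniform_grid s t n"
  assumes d: "\<And>j. j < Suc n \<Longrightarrow> square_integrable M (d j)" "\<And>j. j < Suc n \<Longrightarrow> expectation (\<lambda>\<omega>. (d j \<omega>)\<^sup>2) \<le> KD"
    and g: "\<And>j. j < Suc n \<Longrightarrow> g j \<in> borel_measurable (\<F> (w j))"
      "\<And>j. j < Suc n \<Longrightarrow> square_integrable M (g j)" "\<And>j. j < Suc n \<Longrightarrow> expectation (\<lambda>\<omega>. (g j \<omega>)\<^sup>2) \<le> KG"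
  shows "square_integrable M (\<lambda>\<omega>. \<Sum>j<Suc n. d j \<omega> * (w (Suc j) - w j))"
    and "expectation (\<lambda>\<omega>. (\<Sum>j<Suc n. d j \<omega> * (w (Suc j) - w j))\<^sup>2) \<le> (t - s)\<^sup>2 * KD"
    and "square_integrable M (\<lambda>\<omega>. (\<Sum>j<Suc n. d j \<omega> * (w (Suc j) - w j)) + (\<Sum>j<Suc n. g j \<omega> * (B (w (Suc j)) \<omega> - B (w j) \<omega>)))"
    and "expectation (\<lambda>\<omega>. ((\<Sum>j<Suc n. d j \<omega> * (w (Suc j) - w j)) + (\<Sum>j<Suc n. g j \<omega> * (B (w (Suc j)) \<omega> - B (w j) \<omega>)))\<^sup>2)
       \<le> 2 * ((t - s)\<^sup>2 * KD) + 2 * ((t - s) * KG)"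
proof -
  have step: "w (Suc j) - w j = (t - s) / real (Suc n)" for j
    unfolding w_def by (rule uniform_grid_step)
  have w: "0 \<le> w 0" "\<And>j. w j \<le> w (Suc j)"
    using uniform_grid_bounds[OF st(2)] st by (auto simp: w_def)
  show sq1: "square_integrable M (\<lambda>\<omega>. \<Sum>j<Suc n. d j \<omega> * (w (Suc j) - w j))"
  proof (rule square_integrable_sum)
    fix j assume "j \<in> {..<Suc n}"
    then have "square_integrable M (\<lambda>\<omega>. (w (Suc j) - w j) * d j \<omega>)"
      by (intro square_integrable_cmult d(1)) simp
    then show "square_integrable M (\<lambda>\<omega>. d j \<omega> * (w (Suc j) - w j))"
      by (simp only: mult.commute)
  qed
  have "expectation (\<lambda>\<omega>. (\<Sum>j<Suc n. d j \<omega> * (w (Suc j) - w j))\<^sup>2)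
    \<le> real (Suc n) * ((t - s) / real (Suc n))\<^sup>2 * (\<Sum>j<Suc n. expectation (\<lambda>\<omega>. (d j \<omega>)\<^sup>2))"
    unfolding step by (rule expectation_square_scaled_sum_le) (rule d(1))
  also have "\<dots> \<le> real (Suc n) * ((t - s) / real (Suc n))\<^sup>2 * (\<Sum>j<Suc n. KD)"
    using d(2) by (intro mult_left_mono sum_mono) auto
  also have "\<dots> = (t - s)\<^sup>2 * KD"
    by (simp add: power2_eq_square del: of_nat_Suc sum.lessThan_Suc)
  finally show E1: "expectation (\<lambda>\<omega>. (\<Sum>j<Suc n. d j \<omega> * (w (Suc j) - w j))\<^sup>2) \<le> (t - s)\<^sup>2 * KD" .
  have iso: "square_integrable M (\<lambda>\<omega>. \<Sum>j<Suc n. g j \<omega> * (B (w (Suc j)) \<omega> - B (w j) \<omega>))"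
    "expectation (\<lambda>\<omega>. (\<Sum>j<Suc n. g j \<omega> * (B (w (Suc j)) \<omega> - B (w j) \<omega>))\<^sup>2)
      = (\<Sum>j<Suc n. expectation (\<lambda>\<omega>. (g j \<omega>)\<^sup>2) * (w (Suc j) - w j))"
    using martingale_transform_isometry[of w "Suc n" g "\<lambda>_. 0", OF w(1) w(2) g(1,2)] square_integrable_zero by auto
  note iso(2)
  also have "(\<Sum>j<Suc n. expectation (\<lambda>\<omega>. (g j \<omega>)\<^sup>2) * (w (Suc j) - w j)) \<le> (\<Sum>j<Suc n. KG * (w (Suc j) - w j))"
    using g(3) w(2) by (intro sum_mono mult_right_mono) auto
  also have "\<dots> = (t - s) * KG"
    unfolding step by (simp del: of_nat_Suc sum.lessThan_Suc)
  finally have E2: "expectation (\<lambda>\<omega>. (\<Sum>j<Suc n. g j \<omega> * (B (w (Suc j)) \<omega> - B (w j) \<omega>))\<^sup>2) \<le> (t - s) * KG" .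
  show "square_integrable M (\<lambda>\<omega>. (\<Sum>j<Suc n. d j \<omega> * (w (Suc j) - w j)) + (\<Sum>j<Suc n. g j \<omega> * (B (w (Suc j)) \<omega> - B (w j) \<omega>)))"
    by (rule square_integrable_add[OF sq1 iso(1)])
  show "expectation (\<lambda>\<omega>. ((\<Sum>j<Suc n. d j \<omega> * (w (Suc j) - w j)) + (\<Sum>j<Suc n. g j \<omega> * (B (w (Suc j)) \<omega> - B (w j) \<omega>)))\<^sup>2)
       \<le> 2 * ((t - s)\<^sup>2 * KD) + 2 * ((t - s) * KG)"
    using expectation_square_add_le[OF sq1 iso(1)] E1 E2 by linarith
qed

end

context pantograph
begin

lemma X_q_square_integrable: "0 \<le> t \<Longrightarrow> square_integrable M (X (q * t))"
  using X_square_integrable q_mult by blast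

lemma drift_square_integrable: "0 \<le> t \<Longrightarrow> square_integrable M (drift t)"
  unfolding drift_def[abs_def]
  by (intro square_integrable_add square_integrable_cmult X_square_integrable X_q_square_integrable)

lemma diffusion_square_integrable: "0 \<le> t \<Longrightarrow> square_integrable M (diffusion t)"
  unfolding diffusion_def[abs_def]
  by (intro square_integrable_add square_integrable_cmult X_square_integrable X_q_square_integrable)

lemma linear_combination_square_le:
  assumes "square_integrable M U" "square_integrable M V"
    and "expectation (\<lambda>\<omega>. (U \<omega>)\<^sup>2) \<le> K" "expectation (\<lambda>\<omega>. (V \<omega>)\<^sup>2) \<le> K"
  shows "expectation (\<lambda>\<omega>. (c * U \<omega> + d * V \<omega>)\<^sup>2) \<le> 2 * (c\<^sup>2 + d\<^sup>2) * K"
proof -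
  have "expectation (\<lambda>\<omega>. (c * U \<omega> + d * V \<omega>)\<^sup>2)
    \<le> 2 * (c\<^sup>2 * expectation (\<lambda>\<omega>. (U \<omega>)\<^sup>2)) + 2 * (d\<^sup>2 * expectation (\<lambda>\<omega>. (V \<omega>)\<^sup>2))"
    using expectation_square_add_le[OF square_integrable_cmult[OF assms(1), of c] square_integrable_cmult[OF assms(2), of d]]
    by (simp add: power_mult_distrib)
  also have "\<dots> \<le> 2 * (c\<^sup>2 * K) + 2 * (d\<^sup>2 * K)"
    using assms(3,4) by (intro add_mono mult_left_mono) auto
  finally show ?thesis by (simp add: algebra_simps)
qed

lemma coefficient_moment_bound:
  "\<exists>K\<ge>0. \<forall>t. 0 \<le> t \<and> t \<le> T \<longrightarrow> expectation (\<lambda>\<omega>. (X t \<omega>)\<^sup>2) \<le> K \<and>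
     expectation (\<lambda>\<omega>. (drift t \<omega>)\<^sup>2) \<le> K \<and> expectation (\<lambda>\<omega>. (diffusion t \<omega>)\<^sup>2) \<le> K"
proof -
  obtain C where C: "0 \<le> C" "\<And>t. 0 \<le> t \<Longrightarrow> t \<le> T \<Longrightarrow> expectation (\<lambda>\<omega>. (X t \<omega>)\<^sup>2) \<le> C"
    using second_moment_bound[of T] by blast
  define K where "K = (1 + 2 * (a\<^sup>2 + b\<^sup>2) + 2 * (\<sigma>\<^sup>2 + \<rho>\<^sup>2)) * C"
  have K: "C \<le> K" "2 * (a\<^sup>2 + b\<^sup>2) * C \<le> K" "2 * (\<sigma>\<^sup>2 + \<rho>\<^sup>2) * C \<le> K"
    using C(1) by (auto simp: K_def algebra_simps)
  show ?thesis
  proof (intro exI conjI allI impI)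
    show "0 \<le> K" using C K by linarith
    fix t assume "0 \<le> t \<and> t \<le> T"
    then have t: "0 \<le> t" "t \<le> T" by auto
    have Xq: "expectation (\<lambda>\<omega>. (X (q * t) \<omega>)\<^sup>2) \<le> C" using C(2)[of "q * t"] q_mult[OF t(1)] t by simp
    note le = linear_combination_square_le[OF X_square_integrable[OF t(1)] X_q_square_integrable[OF t(1)] C(2)[OF t] Xq]
    show "expectation (\<lambda>\<omega>. (X t \<omega>)\<^sup>2) \<le> K" using C(2)[OF t] K by linarith
    show "expectation (\<lambda>\<omega>. (drift t \<omega>)\<^sup>2) \<le> K" unfolding drift_def using le[of a b] K by linarith
    show "expectation (\<lambda>\<omega>. (diffusion t \<omega>)\<^sup>2) \<le> K" unfolding diffusion_def using le[of \<sigma> \<rho>] K by linarith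
  qed
qed

text \<open>The common frame of the local expansions: a proposed expansion \<open>Z\<close> is
  subtracted from the Euler sums, and the remainder \<open>R n\<close> is estimated on the grid.
  Convergence then reduces to an algebraic identity.\<close>

lemma Euler_limit_centered:
  assumes st: "0 \<le> s" "s \<le> t" and Z: "Z \<in> borel_measurable M"
  defines "w \<equiv> uniform_grid s t"
  assumes R: "\<And>n \<omega>. R n \<omega> = X s \<omega> + (\<Sum>j<Suc n. drift (w n j) \<omega> * (w n (Suc j) - w n j))
      + (\<Sum>j<Suc n. diffusion (w n j) \<omega> * (B (w n (Suc j)) \<omega> - B (w n j) \<omega>)) - Z \<omega>"
  shows "converges_in_probability M R (\<lambda>\<omega>. X t \<omega> - Z \<omega>)"
proof -
  have "R = (\<lambda>n \<omega>. X s \<omega> + (\<Sum>j<Suc n. drift (w n j) \<omega> * (w n (Suc j) - w n j))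
      + (\<Sum>j<Suc n. diffusion (w n j) \<omega> * (B (w n (Suc j)) \<omega> - B (w n j) \<omega>)) - Z \<omega>)"
    by (intro ext) (rule R)
  then show ?thesis
    unfolding w_def
    using converges_in_probability_diff[OF Euler_limit[OF st] converges_in_probability_const[OF Z]] by (simp only:)
qed

text \<open>The noise decides the order: its second moment is of order t - s, that of the drift of
  order (t - s)^2.\<close>

lemma X_increment_bound:
  "\<exists>K\<ge>0. \<forall>s t. 0 \<le> s \<and> s \<le> t \<and> t \<le> T \<longrightarrow> expectation (\<lambda>\<omega>. (X t \<omega> - X s \<omega>)\<^sup>2) \<le> K * (t - s)"
proof -
  obtain K where K: "0 \<le> K" "\<And>t. 0 \<le> t \<Longrightarrow> t \<le> T \<Longrightarrow> expectation (\<lambda>\<omega>. (drift t \<omega>)\<^sup>2) \<le> K"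
    "\<And>t. 0 \<le> t \<Longrightarrow> t \<le> T \<Longrightarrow> expectation (\<lambda>\<omega>. (diffusion t \<omega>)\<^sup>2) \<le> K"
    using coefficient_moment_bound[of T] by blast
  define K' where "K' = 2 * \<bar>T\<bar> * K + 2 * K"
  have "expectation (\<lambda>\<omega>. (X t \<omega> - X s \<omega>)\<^sup>2) \<le> K' * (t - s)" if "0 \<le> s" "s \<le> t" "t \<le> T" for s t
  proof -
    define w where "w = uniform_grid s t"
    have w: "0 \<le> w n j" "j \<le> Suc n \<Longrightarrow> w n j \<le> T" for n j
      unfolding w_def
      using order_trans[OF that(1) uniform_grid_bounds(4)[OF that(2)]] order_trans[OF uniform_grid_bounds(5)[OF that(2)] that(3)]
      by blast+
    define R where "R n \<omega> = (\<Sum>j<Suc n. drift (w n j) \<omega> * (w n (Suc j) - w n j))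
      + (\<Sum>j<Suc n. diffusion (w n j) \<omega> * (B (w n (Suc j)) \<omega> - B (w n j) \<omega>))" for n \<omega>
    have conv: "converges_in_probability M R (\<lambda>\<omega>. X t \<omega> - X s \<omega>)"
      by (rule Euler_limit_centered[OF that(1,2) X_measurable[OF that(1)]]) (simp add: R_def w_def)
    have E: "square_integrable M (R n)" "expectation (\<lambda>\<omega>. (R n \<omega>)\<^sup>2) \<le> 2 * ((t - s)\<^sup>2 * K) + 2 * ((t - s) * K)" for n
      unfolding R_def w_def
      by (rule Euler_sum_square_le(3,4)[OF that(1,2), where KD = K and KG = K]; fold w_def;
          intro drift_square_integrable diffusion_square_integrable diffusion_filtration K w; simp)+
    have "expectation (\<lambda>\<omega>. (X t \<omega> - X s \<omega>)\<^sup>2) \<le> 2 * ((t - s)\<^sup>2 * K) + 2 * ((t - s) * K)"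
      by (rule converges_in_probability_square_le(2)[OF conv E tendsto_const])
    also have "(t - s)\<^sup>2 * K \<le> (\<bar>T\<bar> * (t - s)) * K"
      using that K(1) by (intro mult_right_mono) (auto simp: power2_eq_square intro: mult_right_mono)
    finally show ?thesis by (simp add: K'_def algebra_simps)
  qed
  moreover have "0 \<le> K'" using K(1) by (simp add: K'_def)
  ultimately show ?thesis by blast
qed

text \<open>The delay preserves the modulus, since q t - q s \<le> t - s.\<close>

lemma coefficient_increment_bound:
  "\<exists>K\<ge>0. \<forall>s t. 0 \<le> s \<and> s \<le> t \<and> t \<le> T \<longrightarrow> expectation (\<lambda>\<omega>. (X t \<omega> - X s \<omega>)\<^sup>2) \<le> K * (t - s) \<and>
     expectation (\<lambda>\<omega>. (drift t \<omega> - drift s \<omega>)\<^sup>2) \<le> K * (t - s) \<and>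
     expectation (\<lambda>\<omega>. (diffusion t \<omega> - diffusion s \<omega>)\<^sup>2) \<le> K * (t - s)"
proof -
  obtain C where C: "0 \<le> C" "\<And>s t. 0 \<le> s \<Longrightarrow> s \<le> t \<Longrightarrow> t \<le> T \<Longrightarrow> expectation (\<lambda>\<omega>. (X t \<omega> - X s \<omega>)\<^sup>2) \<le> C * (t - s)"
    using X_increment_bound[of T] by blast
  define K where "K = (1 + 2 * (a\<^sup>2 + b\<^sup>2) + 2 * (\<sigma>\<^sup>2 + \<rho>\<^sup>2)) * C"
  have K: "C \<le> K" "2 * (a\<^sup>2 + b\<^sup>2) * C \<le> K" "2 * (\<sigma>\<^sup>2 + \<rho>\<^sup>2) * C \<le> K"
    using C(1) by (auto simp: K_def algebra_simps)
  show ?thesis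
  proof (rule exI[of _ K], rule conjI, goal_cases)
    case 1 show ?case using C K by linarith
  next
    case 2
    show ?case
    proof (intro allI impI)
      fix s t assume "0 \<le> s \<and> s \<le> t \<and> t \<le> T"
      then have st: "0 \<le> s" "s \<le> t" "t \<le> T" and t: "0 \<le> t" by auto
      have qst: "q * s \<le> q * t" "q * t - q * s \<le> t - s"
        using q st mult_right_mono[of q 1 "t - s"] by (auto simp: algebra_simps)
      have "expectation (\<lambda>\<omega>. (X (q * t) \<omega> - X (q * s) \<omega>)\<^sup>2) \<le> C * (q * t - q * s)"
        using q_mult[OF t] q_mult[OF st(1)] st qst by (intro C(2)) auto
      also have "\<dots> \<le> C * (t - s)" using qst C(1) by (intro mult_left_mono)
      finally have Xq: "expectation (\<lambda>\<omega>. (X (q * t) \<omega> - X (q * s) \<omega>)\<^sup>2) \<le> C * (t - s)" .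
      note sq = square_integrable_diff[OF X_square_integrable[OF t] X_square_integrable[OF st(1)]]
        square_integrable_diff[OF X_q_square_integrable[OF t] X_q_square_integrable[OF st(1)]]
      note le = linear_combination_square_le[OF sq C(2)[OF st] Xq]
      have eq: "drift t \<omega> - drift s \<omega> = a * (X t \<omega> - X s \<omega>) + b * (X (q * t) \<omega> - X (q * s) \<omega>)"
        "diffusion t \<omega> - diffusion s \<omega> = \<sigma> * (X t \<omega> - X s \<omega>) + \<rho> * (X (q * t) \<omega> - X (q * s) \<omega>)" for \<omega>
        by (simp_all add: drift_def diffusion_def algebra_simps)
      have K': "C * (t - s) \<le> K * (t - s)" "2 * (a\<^sup>2 + b\<^sup>2) * (C * (t - s)) \<le> K * (t - s)"
        "2 * (\<sigma>\<^sup>2 + \<rho>\<^sup>2) * (C * (t - s)) \<le> K * (t - s)"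
        using K st mult_right_mono[of _ K "t - s"] by (auto simp: mult.assoc[symmetric])
      show "expectation (\<lambda>\<omega>. (X t \<omega> - X s \<omega>)\<^sup>2) \<le> K * (t - s) \<and>
         expectation (\<lambda>\<omega>. (drift t \<omega> - drift s \<omega>)\<^sup>2) \<le> K * (t - s) \<and>
         expectation (\<lambda>\<omega>. (diffusion t \<omega> - diffusion s \<omega>)\<^sup>2) \<le> K * (t - s)"
        unfolding eq using le[of a b] le[of \<sigma> \<rho>] K' C(2)[OF st] by linarith
    qed
  qed
qed

lemma uniform_grid_mem: "s \<le> t \<Longrightarrow> 0 \<le> s \<Longrightarrow> 0 \<le> uniform_grid s t n j"
  "s \<le> t \<Longrightarrow> t \<le> T \<Longrightarrow> j \<le> Suc n \<Longrightarrow> uniform_grid s t n j \<le> T"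
  by (erule order_trans[rotated, OF uniform_grid_bounds(4)], assumption)
     (rule order_trans[OF uniform_grid_bounds(5)])

text \<open>A substitute for Ito's formula applied to x^2. The state together with its drift frozen
  at s is known at s, hence orthogonal to the noise sum. The rest of the drift has order h^(3/2) in
  L2, and the second moment of the diffusion coefficient grows by at most order sqrt h during the
  step, so every error has order h^(3/2).\<close>

lemma second_moment_step:
  "\<exists>K\<ge>0. \<forall>s t. 0 \<le> s \<and> s \<le> t \<and> t \<le> T \<and> t - s \<le> 1 \<longrightarrow>
     expectation (\<lambda>\<omega>. (X t \<omega>)\<^sup>2) \<le> expectation (\<lambda>\<omega>. (X s \<omega>)\<^sup>2)
       + (t - s) * (2 * expectation (\<lambda>\<omega>. X s \<omega> * drift s \<omega>) + expectation (\<lambda>\<omega>. (diffusion s \<omega>)\<^sup>2))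
       + K * ((t - s) * sqrt (t - s))"
proof -
  obtain K1 where K1: "0 \<le> K1" "\<And>t. 0 \<le> t \<Longrightarrow> t \<le> T \<Longrightarrow> expectation (\<lambda>\<omega>. (X t \<omega>)\<^sup>2) \<le> K1"
    "\<And>t. 0 \<le> t \<Longrightarrow> t \<le> T \<Longrightarrow> expectation (\<lambda>\<omega>. (drift t \<omega>)\<^sup>2) \<le> K1"
    "\<And>t. 0 \<le> t \<Longrightarrow> t \<le> T \<Longrightarrow> expectation (\<lambda>\<omega>. (diffusion t \<omega>)\<^sup>2) \<le> K1"
    using coefficient_moment_bound[of T] by blast
  obtain K2 where K2: "0 \<le> K2"
    "\<And>s t. 0 \<le> s \<Longrightarrow> s \<le> t \<Longrightarrow> t \<le> T \<Longrightarrow> expectation (\<lambda>\<omega>. (drift t \<omega> - drift s \<omega>)\<^sup>2) \<le> K2 * (t - s)"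
    "\<And>s t. 0 \<le> s \<Longrightarrow> s \<le> t \<Longrightarrow> t \<le> T \<Longrightarrow> expectation (\<lambda>\<omega>. (diffusion t \<omega> - diffusion s \<omega>)\<^sup>2) \<le> K2 * (t - s)"
    using coefficient_increment_bound[of T] by blast
  \<comment> \<open>The three groups account for the squared frozen drift, the change of the
    diffusion coefficient, and the rest of the drift with its cross term.\<close>
  define K where "K = K1 + (2 * (sqrt K1 * sqrt K2) + K2) + (2 * (sqrt (5 * K1) * sqrt K2) + K2)"
  have "expectation (\<lambda>\<omega>. (X t \<omega>)\<^sup>2) \<le> expectation (\<lambda>\<omega>. (X s \<omega>)\<^sup>2)
       + (t - s) * (2 * expectation (\<lambda>\<omega>. X s \<omega> * drift s \<omega>) + expectation (\<lambda>\<omega>. (diffusion s \<omega>)\<^sup>2))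
       + K * ((t - s) * sqrt (t - s))" if st: "0 \<le> s" "s \<le> t" "t \<le> T" "t - s \<le> 1" for s t
  proof -
    define h where "h = t - s"
    have h: "0 \<le> h" "h \<le> 1" using st by (auto simp: h_def)
    have sT: "s \<le> T" using st by simp
    define w where "w = uniform_grid s t"
    have w: "0 \<le> w n j" "j \<le> Suc n \<Longrightarrow> w n j \<le> T" "s \<le> w n j" "w n j \<le> w n (Suc j)" "j \<le> Suc n \<Longrightarrow> w n j - s \<le> h" for n j
      using uniform_grid_mem[OF st(2)] st uniform_grid_bounds(3,4,5)[OF st(2)] unfolding w_def h_def by (blast, blast, blast, blast, fastforce)
    have step: "w n (Suc j) - w n j = h / real (Suc n)" for n j
      unfolding w_def h_def by (rule uniform_grid_step)
    \<comment> \<open>For h \<le> 1 all higher powers are absorbed into h sqrt h.\<close>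
    have h2: "h\<^sup>2 \<le> h * sqrt h" "h * h \<le> h * sqrt h" "h\<^sup>2 * (K2 * h) \<le> K2 * (h * sqrt h)"
    proof -
      have "h \<le> sqrt h" using h by (metis real_sqrt_le_iff real_sqrt_abs abs_of_nonneg power2_eq_square mult_left_le)
      then show 1: "h * h \<le> h * sqrt h" using h by (intro mult_left_mono)
      then show 2: "h\<^sup>2 \<le> h * sqrt h" by (simp add: power2_eq_square)
      have "h\<^sup>2 * (K2 * h) \<le> h\<^sup>2 * (K2 * 1)" using h K2(1) by (intro mult_left_mono) auto
      also have "\<dots> \<le> (h * sqrt h) * (K2 * 1)" using 2 K2(1) by (intro mult_right_mono) auto
      finally show "h\<^sup>2 * (K2 * h) \<le> K2 * (h * sqrt h)" by (simp add: mult_ac)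
    qed
    define Z where "Z \<omega> = X s \<omega> + h * drift s \<omega>" for \<omega>
    define I where "I n \<omega> = (\<Sum>j<Suc n. diffusion (w n j) \<omega> * (B (w n (Suc j)) \<omega> - B (w n j) \<omega>))" for n \<omega>
    define P where "P n \<omega> = (\<Sum>j<Suc n. (drift (w n j) \<omega> - drift s \<omega>) * (w n (Suc j) - w n j))" for n \<omega>
    have sqX: "square_integrable M (X s)" and sqD: "square_integrable M (drift s)" and sqG: "square_integrable M (diffusion s)"
      using X_square_integrable drift_square_integrable diffusion_square_integrable st by auto
    have Z_sq: "square_integrable M Z"
      unfolding Z_def[abs_def] by (intro square_integrable_add square_integrable_cmult sqX sqD)
    have Z_F: "Z \<in> borel_measurable (\<F> s)"
      unfolding Z_def[abs_def] using X_filtration[OF st(1)] drift_filtration[OF st(1)] by measurable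
    have EZ: "expectation (\<lambda>\<omega>. (Z \<omega>)\<^sup>2) = expectation (\<lambda>\<omega>. (X s \<omega>)\<^sup>2) + 2 * h * expectation (\<lambda>\<omega>. X s \<omega> * drift s \<omega>)
        + h\<^sup>2 * expectation (\<lambda>\<omega>. (drift s \<omega>)\<^sup>2)"
    proof -
      have "expectation (\<lambda>\<omega>. (Z \<omega>)\<^sup>2) = expectation (\<lambda>\<omega>. (X s \<omega>)\<^sup>2 + 2 * h * (X s \<omega> * drift s \<omega>) + h\<^sup>2 * (drift s \<omega>)\<^sup>2)"
        by (intro Bochner_Integration.integral_cong) (auto simp: Z_def power2_eq_square algebra_simps)
      then show ?thesis
        using square_integrableD(2)[OF sqX] square_integrableD(2)[OF sqD] square_integrable_mult_integrable[OF sqX sqD] by simp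
    qed
    have w0: "w n 0 = s" "w n (Suc n) = t" for n using st by (auto simp: w_def)
    have iso: "square_integrable M (\<lambda>\<omega>. Z \<omega> + I n \<omega>)"
      "expectation (\<lambda>\<omega>. (Z \<omega> + I n \<omega>)\<^sup>2) = expectation (\<lambda>\<omega>. (Z \<omega>)\<^sup>2)
         + (\<Sum>j<Suc n. expectation (\<lambda>\<omega>. (diffusion (w n j) \<omega>)\<^sup>2) * (w n (Suc j) - w n j))" for n
      using martingale_transform_isometry[of "w n" "Suc n" "\<lambda>j. diffusion (w n j)" Z, OF w(1,4) diffusion_filtration[OF w(1)]
        diffusion_square_integrable[OF w(1)]] Z_sq Z_F w0 by (auto simp: I_def)
    have Pb: "square_integrable M (P n)" "expectation (\<lambda>\<omega>. (P n \<omega>)\<^sup>2) \<le> h\<^sup>2 * (K2 * h)" for n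
    proof -
      have d: "square_integrable M (\<lambda>\<omega>. drift (w n j) \<omega> - drift s \<omega>)" for j
        by (intro square_integrable_diff drift_square_integrable w sqD)
      have Ed: "expectation (\<lambda>\<omega>. (drift (w n j) \<omega> - drift s \<omega>)\<^sup>2) \<le> K2 * h" if "j < Suc n" for j
      proof -
        have "expectation (\<lambda>\<omega>. (drift (w n j) \<omega> - drift s \<omega>)\<^sup>2) \<le> K2 * (w n j - s)"
          by (rule K2(2)[OF st(1) w(3) w(2)]) (use that in simp)
        also have "\<dots> \<le> K2 * h" using w(5)[of j n] that K2(1) by (intro mult_left_mono) auto
        finally show ?thesis .
      qed
      note E = Euler_sum_square_le(1,2)[OF st(1,2), of n "\<lambda>j \<omega>. drift (w n j) \<omega> - drift s \<omega>" "K2 * h" "\<lambda>_ _. 0" 0, OF d Ed,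
          folded w_def h_def]
      show "square_integrable M (P n)" unfolding P_def[abs_def] by (rule E(1)) (auto simp: square_integrable_zero)
      show "expectation (\<lambda>\<omega>. (P n \<omega>)\<^sup>2) \<le> h\<^sup>2 * (K2 * h)" unfolding P_def by (rule E(2)) (auto simp: square_integrable_zero)
    qed
    have EG: "expectation (\<lambda>\<omega>. (diffusion (w n j) \<omega>)\<^sup>2) \<le> expectation (\<lambda>\<omega>. (diffusion s \<omega>)\<^sup>2) + (2 * (sqrt K1 * sqrt K2) + K2) * sqrt h"
      if "j < Suc n" for n j
    proof -
      let ?U = "\<lambda>\<omega>. diffusion (w n j) \<omega> - diffusion s \<omega>"
      have sqU: "square_integrable M ?U" by (intro square_integrable_diff diffusion_square_integrable w sqG)
      have "expectation (\<lambda>\<omega>. (?U \<omega>)\<^sup>2) \<le> K2 * (w n j - s)"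
        by (rule K2(3)[OF st(1) w(3) w(2)]) (use that in simp)
      also have "\<dots> \<le> K2 * h" using w(5)[of j n] that K2(1) by (intro mult_left_mono) auto
      finally have EU: "expectation (\<lambda>\<omega>. (?U \<omega>)\<^sup>2) \<le> K2 * h" .
      have "expectation (\<lambda>\<omega>. diffusion s \<omega> * ?U \<omega>) \<le> sqrt (expectation (\<lambda>\<omega>. (diffusion s \<omega>)\<^sup>2)) * sqrt (expectation (\<lambda>\<omega>. (?U \<omega>)\<^sup>2))"
        using Cauchy_Schwarz_expectation[OF sqG sqU] by linarith
      also have "\<dots> \<le> sqrt K1 * sqrt (K2 * h)"
        using K1(4)[OF st(1) sT] EU K1(1) by (intro mult_mono real_sqrt_le_mono) auto
      finally have C: "expectation (\<lambda>\<omega>. diffusion s \<omega> * ?U \<omega>) \<le> sqrt K1 * sqrt K2 * sqrt h"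
        by (simp add: real_sqrt_mult)
      have "expectation (\<lambda>\<omega>. (diffusion (w n j) \<omega>)\<^sup>2) = expectation (\<lambda>\<omega>. (diffusion s \<omega>)\<^sup>2 + 2 * (diffusion s \<omega> * ?U \<omega>) + (?U \<omega>)\<^sup>2)"
        by (intro Bochner_Integration.integral_cong) (auto simp: power2_eq_square algebra_simps)
      also have "\<dots> = expectation (\<lambda>\<omega>. (diffusion s \<omega>)\<^sup>2) + 2 * expectation (\<lambda>\<omega>. diffusion s \<omega> * ?U \<omega>) + expectation (\<lambda>\<omega>. (?U \<omega>)\<^sup>2)"
        using square_integrableD(2)[OF sqG] square_integrable_mult_integrable[OF sqG sqU] square_integrableD(2)[OF sqU] by simp
      also have "\<dots> \<le> expectation (\<lambda>\<omega>. (diffusion s \<omega>)\<^sup>2) + 2 * (sqrt K1 * sqrt K2 * sqrt h) + K2 * sqrt h"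
      proof -
        have "h \<le> sqrt h" using h by (metis real_sqrt_le_iff real_sqrt_abs abs_of_nonneg power2_eq_square mult_left_le)
        then have "K2 * h \<le> K2 * sqrt h" using K2(1) by (intro mult_left_mono)
        then show ?thesis using C EU by linarith
      qed
      finally show ?thesis by (simp add: algebra_simps)
    qed
    have EA: "expectation (\<lambda>\<omega>. (Z \<omega> + I n \<omega>)\<^sup>2) \<le> expectation (\<lambda>\<omega>. (X s \<omega>)\<^sup>2)
       + h * (2 * expectation (\<lambda>\<omega>. X s \<omega> * drift s \<omega>) + expectation (\<lambda>\<omega>. (diffusion s \<omega>)\<^sup>2))
       + (K1 + (2 * (sqrt K1 * sqrt K2) + K2)) * (h * sqrt h)" for n
    proof -
      have "(\<Sum>j<Suc n. expectation (\<lambda>\<omega>. (diffusion (w n j) \<omega>)\<^sup>2) * (w n (Suc j) - w n j))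
        \<le> (\<Sum>j<Suc n. (expectation (\<lambda>\<omega>. (diffusion s \<omega>)\<^sup>2) + (2 * (sqrt K1 * sqrt K2) + K2) * sqrt h) * (w n (Suc j) - w n j))"
        using EG[of _ n] w(4)[of n] by (intro sum_mono mult_right_mono) auto
      also have "\<dots> = (expectation (\<lambda>\<omega>. (diffusion s \<omega>)\<^sup>2) + (2 * (sqrt K1 * sqrt K2) + K2) * sqrt h) * h"
        unfolding step by (simp del: of_nat_Suc sum.lessThan_Suc)
      finally have 1: "(\<Sum>j<Suc n. expectation (\<lambda>\<omega>. (diffusion (w n j) \<omega>)\<^sup>2) * (w n (Suc j) - w n j))
        \<le> (expectation (\<lambda>\<omega>. (diffusion s \<omega>)\<^sup>2) + (2 * (sqrt K1 * sqrt K2) + K2) * sqrt h) * h" .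
      have "h\<^sup>2 * expectation (\<lambda>\<omega>. (drift s \<omega>)\<^sup>2) \<le> (h * sqrt h) * K1"
        using h2(1) K1(3)[OF st(1) sT] h by (intro mult_mono) auto
      then show ?thesis
        unfolding iso(2) EZ using 1 by (simp add: algebra_simps)
    qed
    \<comment> \<open>A crude bound for the Cauchy-Schwarz factor: \<open>4 * K1\<close> from
      \<open>Z\<close> and \<open>K1\<close> from the noise sum.\<close>
    have EA': "expectation (\<lambda>\<omega>. (Z \<omega> + I n \<omega>)\<^sup>2) \<le> 5 * K1" for n
    proof -
      have "expectation (\<lambda>\<omega>. (Z \<omega>)\<^sup>2) \<le> 2 * expectation (\<lambda>\<omega>. (X s \<omega>)\<^sup>2) + 2 * (h\<^sup>2 * expectation (\<lambda>\<omega>. (drift s \<omega>)\<^sup>2))"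
        using expectation_square_add_le[OF sqX square_integrable_cmult[OF sqD, of h]] by (simp add: Z_def power_mult_distrib)
      moreover have "h\<^sup>2 * expectation (\<lambda>\<omega>. (drift s \<omega>)\<^sup>2) \<le> 1 * K1"
        using K1(3)[OF st(1) sT] h power_le_one[OF h, of 2] by (intro mult_mono) auto
      moreover have "(\<Sum>j<Suc n. expectation (\<lambda>\<omega>. (diffusion (w n j) \<omega>)\<^sup>2) * (w n (Suc j) - w n j)) \<le> (\<Sum>j<Suc n. K1 * (w n (Suc j) - w n j))"
        using K1(4)[OF w(1) w(2)] w(4)[of n] by (intro sum_mono mult_right_mono) auto
      moreover have "(\<Sum>j<Suc n. K1 * (w n (Suc j) - w n j)) = K1 * h"
        unfolding step by (simp del: of_nat_Suc sum.lessThan_Suc)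
      moreover have "K1 * h \<le> K1 * 1" using h K1(1) by (intro mult_left_mono)
      ultimately show ?thesis unfolding iso(2) using K1(2)[OF st(1) sT] by linarith
    qed
    define Y where "Y n \<omega> = (Z \<omega> + I n \<omega>) + P n \<omega>" for n \<omega>
    have Y_sq: "square_integrable M (Y n)" for n
      unfolding Y_def[abs_def] by (rule square_integrable_add[OF iso(1) Pb(1)])
    have EY: "expectation (\<lambda>\<omega>. (Y n \<omega>)\<^sup>2) \<le> expectation (\<lambda>\<omega>. (X s \<omega>)\<^sup>2)
       + h * (2 * expectation (\<lambda>\<omega>. X s \<omega> * drift s \<omega>) + expectation (\<lambda>\<omega>. (diffusion s \<omega>)\<^sup>2))
       + K * (h * sqrt h)" for n
    proof -
      let ?A = "\<lambda>\<omega>. Z \<omega> + I n \<omega>"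
      have "expectation (\<lambda>\<omega>. ?A \<omega> * P n \<omega>) \<le> sqrt (expectation (\<lambda>\<omega>. (?A \<omega>)\<^sup>2)) * sqrt (expectation (\<lambda>\<omega>. (P n \<omega>)\<^sup>2))"
        using Cauchy_Schwarz_expectation[OF iso(1) Pb(1)] by (rule order_trans[OF abs_ge_self])
      also have "\<dots> \<le> sqrt (5 * K1) * sqrt (h\<^sup>2 * (K2 * h))"
        using EA'[of n] Pb(2)[of n] K1(1) by (intro mult_mono real_sqrt_le_mono) auto
      also have "\<dots> = sqrt (5 * K1) * sqrt K2 * (h * sqrt h)"
        using h by (simp add: real_sqrt_mult)
      finally have C: "expectation (\<lambda>\<omega>. ?A \<omega> * P n \<omega>) \<le> sqrt (5 * K1) * sqrt K2 * (h * sqrt h)" .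
      have "expectation (\<lambda>\<omega>. (Y n \<omega>)\<^sup>2) = expectation (\<lambda>\<omega>. (?A \<omega>)\<^sup>2 + 2 * (?A \<omega> * P n \<omega>) + (P n \<omega>)\<^sup>2)"
        by (intro Bochner_Integration.integral_cong) (auto simp: Y_def power2_eq_square algebra_simps)
      also have "\<dots> = expectation (\<lambda>\<omega>. (?A \<omega>)\<^sup>2) + 2 * expectation (\<lambda>\<omega>. ?A \<omega> * P n \<omega>) + expectation (\<lambda>\<omega>. (P n \<omega>)\<^sup>2)"
        using square_integrableD(2)[OF iso(1)[of n]] square_integrable_mult_integrable[OF iso(1) Pb(1), of n n] square_integrableD(2)[OF Pb(1)[of n]]
        by simp
      finally show ?thesis
        using C EA[of n] Pb(2)[of n] h2(3) by (simp add: K_def algebra_simps)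
    qed
    have "converges_in_probability M Y (\<lambda>\<omega>. X t \<omega> - 0)"
    proof (rule Euler_limit_centered[OF st(1,2) borel_measurable_const])
      fix n \<omega>
      have "(\<Sum>j<Suc n. drift s \<omega> * (w n (Suc j) - w n j)) = drift s \<omega> * h"
        unfolding step by (simp del: of_nat_Suc sum.lessThan_Suc)
      then show "Y n \<omega> = X s \<omega> + (\<Sum>j<Suc n. drift (uniform_grid s t n j) \<omega> * (uniform_grid s t n (Suc j) - uniform_grid s t n j))
        + (\<Sum>j<Suc n. diffusion (uniform_grid s t n j) \<omega> * (B (uniform_grid s t n (Suc j)) \<omega> - B (uniform_grid s t n j) \<omega>)) - 0"
        unfolding Y_def Z_def I_def P_def w_def[symmetric] left_diff_distrib sum_subtractf
        by (simp only:) (simp add: mult.commute)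
    qed
    from converges_in_probability_square_le(2)[OF this Y_sq EY tendsto_const]
    show ?thesis by (simp add: h_def)
  qed
  moreover have "0 \<le> K" using K1(1) K2(1) by (simp add: K_def)
  ultimately show ?thesis by blast
qed

text \<open>The mixed moment of \<open>X s\<close> and \<open>X (q * s)\<close> occurs with total
  coefficient 2 (b + \<sigma> \<rho>) and unknown sign. Cauchy-Schwarz closes the inequality in the
  second moment alone and brings in the absolute value.\<close>

lemma second_moment_generator:
  assumes "0 \<le> s"
  defines "m \<equiv> \<lambda>s. expectation (\<lambda>\<omega>. (X s \<omega>)\<^sup>2)"
  shows "2 * expectation (\<lambda>\<omega>. X s \<omega> * drift s \<omega>) + expectation (\<lambda>\<omega>. (diffusion s \<omega>)\<^sup>2)
    \<le> (2 * a + \<sigma>\<^sup>2) * m s + 2 * \<bar>b + \<sigma> * \<rho>\<bar> * sqrt (m s * m (q * s)) + \<rho>\<^sup>2 * m (q * s)"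
proof -
  note sq = X_square_integrable[OF assms(1)] X_q_square_integrable[OF assms(1)]
  note int = square_integrableD(2)[OF sq(1)] square_integrableD(2)[OF sq(2)] square_integrable_mult_integrable[OF sq]
  define e where "e = expectation (\<lambda>\<omega>. X s \<omega> * X (q * s) \<omega>)"
  have "expectation (\<lambda>\<omega>. X s \<omega> * drift s \<omega>) = expectation (\<lambda>\<omega>. a * (X s \<omega>)\<^sup>2 + b * (X s \<omega> * X (q * s) \<omega>))"
    by (intro Bochner_Integration.integral_cong) (auto simp: drift_def power2_eq_square algebra_simps)
  also have "\<dots> = a * m s + b * e" using int by (simp add: m_def e_def)
  finally have 1: "expectation (\<lambda>\<omega>. X s \<omega> * drift s \<omega>) = a * m s + b * e" .
  have "expectation (\<lambda>\<omega>. (diffusion s \<omega>)\<^sup>2)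
    = expectation (\<lambda>\<omega>. \<sigma>\<^sup>2 * (X s \<omega>)\<^sup>2 + 2 * \<sigma> * \<rho> * (X s \<omega> * X (q * s) \<omega>) + \<rho>\<^sup>2 * (X (q * s) \<omega>)\<^sup>2)"
    by (intro Bochner_Integration.integral_cong) (auto simp: diffusion_def power2_eq_square algebra_simps)
  also have "\<dots> = \<sigma>\<^sup>2 * m s + 2 * \<sigma> * \<rho> * e + \<rho>\<^sup>2 * m (q * s)" using int by (simp add: m_def e_def)
  finally have 2: "expectation (\<lambda>\<omega>. (diffusion s \<omega>)\<^sup>2) = \<sigma>\<^sup>2 * m s + 2 * \<sigma> * \<rho> * e + \<rho>\<^sup>2 * m (q * s)" .
  have "\<bar>e\<bar> \<le> sqrt (m s * m (q * s))"
    using Cauchy_Schwarz_expectation[OF sq] by (simp add: e_def m_def real_sqrt_mult)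
  then have "\<bar>b + \<sigma> * \<rho>\<bar> * \<bar>e\<bar> \<le> \<bar>b + \<sigma> * \<rho>\<bar> * sqrt (m s * m (q * s))"
    by (intro mult_left_mono) auto
  moreover have "(b + \<sigma> * \<rho>) * e \<le> \<bar>b + \<sigma> * \<rho>\<bar> * \<bar>e\<bar>"
    by (metis abs_ge_self abs_mult)
  ultimately show ?thesis unfolding 1 2 by (simp add: algebra_simps)
qed

end

section \<open>Milstein expansion for the first moment\<close>

context wiener_with_initial
begin

text \<open>A squared increment minus its time length d is centred, has variance 2 d^2 and is
  independent of the past, so the terms are orthogonal and the total is of the order of the mesh.
  The weight \<open>Z\<close> belongs inside: it is merely square integrable, and it is independence
  that makes its product with the sum square integrable.\<close>

lemma quadratic_variation:
  assumes "0 \<le> v 0" and v: "\<And>i. i < m \<Longrightarrow> v i \<le> v (Suc i)"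
    and Z: "Z \<in> borel_measurable (\<F> (v 0))" "square_integrable M Z"
  defines "V \<equiv> \<lambda>m \<omega>. \<Sum>i<m. (B (v (Suc i)) \<omega> - B (v i) \<omega>)\<^sup>2 - (v (Suc i) - v i)"
  shows "0 \<le> v m \<and> v 0 \<le> v m \<and> (\<lambda>\<omega>. Z \<omega> * V m \<omega>) \<in> borel_measurable (\<F> (v m)) \<and>
    square_integrable M (\<lambda>\<omega>. Z \<omega> * V m \<omega>) \<and>
    expectation (\<lambda>\<omega>. (Z \<omega> * V m \<omega>)\<^sup>2) = expectation (\<lambda>\<omega>. (Z \<omega>)\<^sup>2) * (\<Sum>i<m. 2 * (v (Suc i) - v i)\<^sup>2)"
  using v
proof (induction m)
  case 0
  then show ?case using assms by (simp add: V_def square_integrable_zero)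
next
  case (Suc m)
  let ?D = "\<lambda>\<omega>. B (v (Suc m)) \<omega> - B (v m) \<omega>" and ?d = "v (Suc m) - v m"
  let ?Y = "\<lambda>\<omega>. Z \<omega> * V m \<omega>" and ?U = "\<lambda>\<omega>. Z \<omega> * ((?D \<omega>)\<^sup>2 - ?d)"
  have IH: "0 \<le> v m" "v 0 \<le> v m" "?Y \<in> borel_measurable (\<F> (v m))" "square_integrable M ?Y"
    "expectation (\<lambda>\<omega>. (?Y \<omega>)\<^sup>2) = expectation (\<lambda>\<omega>. (Z \<omega>)\<^sup>2) * (\<Sum>i<m. 2 * (v (Suc i) - v i)\<^sup>2)"
    using Suc by auto
  have m: "0 \<le> v m" "v m \<le> v (Suc m)" using IH Suc.prems by auto
  have v1: "0 \<le> v (Suc m)" using m by linarith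
  have Zm: "Z \<in> borel_measurable (\<F> (v m))" by (rule measurable_filtration_mono[OF Z(1) IH(2)])
  have Z2: "(\<lambda>\<omega>. (Z \<omega>)\<^sup>2) \<in> borel_measurable (\<F> (v m))" "integrable M (\<lambda>\<omega>. (Z \<omega>)\<^sup>2)"
    using Zm square_integrableD(2)[OF Z(2)] by auto
  have YZ: "(\<lambda>\<omega>. ?Y \<omega> * Z \<omega>) \<in> borel_measurable (\<F> (v m))" "integrable M (\<lambda>\<omega>. ?Y \<omega> * Z \<omega>)"
    using IH(3) Zm square_integrable_mult_integrable[OF IH(4) Z(2)] by auto
  note p2 = filtration_mult_increment_power[OF m Z2, of 2]
  note p4 = filtration_mult_increment_power[OF m Z2, of 4]
  note c2 = filtration_mult_increment_power[OF m YZ, of 2]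
  note mom = B_increment_moments(2,3)[OF m]
  have U2: "(?U \<omega>)\<^sup>2 = (Z \<omega>)\<^sup>2 * (?D \<omega>) ^ 4 - 2 * ?d * ((Z \<omega>)\<^sup>2 * (?D \<omega>)\<^sup>2) + ?d\<^sup>2 * (Z \<omega>)\<^sup>2" for \<omega>
    by (simp add: power2_eq_square power4_eq_xxxx algebra_simps)
  have U_int: "integrable M (\<lambda>\<omega>. (?U \<omega>)\<^sup>2)"
    unfolding U2 using p2(1) p4(1) Z2(2) by simp
  have EU: "expectation (\<lambda>\<omega>. (?U \<omega>)\<^sup>2) = expectation (\<lambda>\<omega>. (Z \<omega>)\<^sup>2) * (2 * ?d\<^sup>2)"
  proof -
    have "expectation (\<lambda>\<omega>. (?U \<omega>)\<^sup>2) = expectation (\<lambda>\<omega>. (Z \<omega>)\<^sup>2 * (?D \<omega>) ^ 4)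
        - 2 * ?d * expectation (\<lambda>\<omega>. (Z \<omega>)\<^sup>2 * (?D \<omega>)\<^sup>2) + ?d\<^sup>2 * expectation (\<lambda>\<omega>. (Z \<omega>)\<^sup>2)"
      unfolding U2 using p2(1) p4(1) Z2(2) by simp
    then show ?thesis
      unfolding p2(2) p4(2) mom by (simp add: power2_eq_square algebra_simps)
  qed
  have [measurable]: "B (v (Suc m)) \<in> borel_measurable M" "B (v m) \<in> borel_measurable M" "Z \<in> borel_measurable M"
    using m v1 Z(2) by (auto simp: square_integrable_def)
  have U_sq: "square_integrable M ?U"
    using U_int by (simp add: square_integrable_def)
  have cross_eq: "?Y \<omega> * ?U \<omega> = ?Y \<omega> * Z \<omega> * (?D \<omega>)\<^sup>2 - ?d * (?Y \<omega> * Z \<omega>)" for \<omega>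
    by (simp add: algebra_simps)
  have cross: "integrable M (\<lambda>\<omega>. ?Y \<omega> * ?U \<omega>)" "expectation (\<lambda>\<omega>. ?Y \<omega> * ?U \<omega>) = 0"
    unfolding cross_eq using c2 YZ(2) mom(1) by simp_all
  have eq: "Z \<omega> * V (Suc m) \<omega> = ?Y \<omega> + ?U \<omega>" for \<omega>
    by (simp add: V_def algebra_simps)
  have "expectation (\<lambda>\<omega>. (?Y \<omega> + ?U \<omega>)\<^sup>2) = expectation (\<lambda>\<omega>. (?Y \<omega>)\<^sup>2 + 2 * (?Y \<omega> * ?U \<omega>) + (?U \<omega>)\<^sup>2)"
    by (intro Bochner_Integration.integral_cong) (auto simp: power2_eq_square algebra_simps)
  also have "\<dots> = expectation (\<lambda>\<omega>. (?Y \<omega>)\<^sup>2) + 2 * expectation (\<lambda>\<omega>. ?Y \<omega> * ?U \<omega>) + expectation (\<lambda>\<omega>. (?U \<omega>)\<^sup>2)"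
    using square_integrableD(2)[OF IH(4)] cross(1) U_int by simp
  finally have E: "expectation (\<lambda>\<omega>. (?Y \<omega> + ?U \<omega>)\<^sup>2)
    = expectation (\<lambda>\<omega>. (Z \<omega>)\<^sup>2) * (\<Sum>i<Suc m. 2 * (v (Suc i) - v i)\<^sup>2)"
    unfolding IH(5) cross(2) EU by (simp add: algebra_simps)
  have "?Y \<in> borel_measurable (\<F> (v (Suc m)))" "Z \<in> borel_measurable (\<F> (v (Suc m)))"
    "B (v (Suc m)) \<in> borel_measurable (\<F> (v (Suc m)))" "B (v m) \<in> borel_measurable (\<F> (v (Suc m)))"
    using IH(3) Zm m v1 by (auto intro: measurable_filtration_mono[OF _ m(2)] B_measurable_filtration)
  then have "(\<lambda>\<omega>. ?Y \<omega> + ?U \<omega>) \<in> borel_measurable (\<F> (v (Suc m)))" by measurable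
  then show ?case
    unfolding eq using E square_integrable_add[OF IH(4) U_sq] v1 IH(2) m by auto
qed

end

context pantograph
begin

text \<open>The drift contributes order t - s in L2, and so does the noise integral of the change of
  \<open>diffusion\<close>, itself of order sqrt (t - s). Freezing the diffusion coefficient thus
  costs half an order less than the increment of X.\<close>

lemma linear_approximation_bound:
  "\<exists>K\<ge>0. \<forall>s t. 0 \<le> s \<and> s \<le> t \<and> t \<le> T \<longrightarrow>
     expectation (\<lambda>\<omega>. (X t \<omega> - X s \<omega> - diffusion s \<omega> * (B t \<omega> - B s \<omega>))\<^sup>2) \<le> K * (t - s)\<^sup>2"
proof -
  obtain K1 where K1: "0 \<le> K1" "\<And>t. 0 \<le> t \<Longrightarrow> t \<le> T \<Longrightarrow> expectation (\<lambda>\<omega>. (drift t \<omega>)\<^sup>2) \<le> K1"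
    using coefficient_moment_bound[of T] by blast
  obtain K2 where K2: "0 \<le> K2"
    "\<And>s t. 0 \<le> s \<Longrightarrow> s \<le> t \<Longrightarrow> t \<le> T \<Longrightarrow> expectation (\<lambda>\<omega>. (diffusion t \<omega> - diffusion s \<omega>)\<^sup>2) \<le> K2 * (t - s)"
    using coefficient_increment_bound[of T] by blast
  have "expectation (\<lambda>\<omega>. (X t \<omega> - X s \<omega> - diffusion s \<omega> * (B t \<omega> - B s \<omega>))\<^sup>2) \<le> (2 * K1 + 2 * K2) * (t - s)\<^sup>2"
    if st: "0 \<le> s" "s \<le> t" "t \<le> T" for s t
  proof -
    define w where "w = uniform_grid s t"
    have w: "0 \<le> w n j" "j \<le> Suc n \<Longrightarrow> w n j \<le> T" "s \<le> w n j" "w n j \<le> w n (Suc j)" "j \<le> Suc n \<Longrightarrow> w n j - s \<le> t - s" for n j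
      using uniform_grid_mem[OF st(2)] st uniform_grid_bounds(3,4,5)[OF st(2)] unfolding w_def by (blast, blast, blast, blast, fastforce)
    have w0: "w n 0 = s" "w n (Suc n) = t" for n using st by (auto simp: w_def)
    define R where "R n \<omega> = (\<Sum>j<Suc n. drift (w n j) \<omega> * (w n (Suc j) - w n j))
      + (\<Sum>j<Suc n. (diffusion (w n j) \<omega> - diffusion s \<omega>) * (B (w n (Suc j)) \<omega> - B (w n j) \<omega>))" for n \<omega>
    have g: "(\<lambda>\<omega>. diffusion (w n j) \<omega> - diffusion s \<omega>) \<in> borel_measurable (\<F> (w n j))" for n j
      by (intro borel_measurable_diff diffusion_filtration w measurable_filtration_mono[OF diffusion_filtration[OF st(1)]])
    have sg: "square_integrable M (\<lambda>\<omega>. diffusion (w n j) \<omega> - diffusion s \<omega>)" for n j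
      by (intro square_integrable_diff diffusion_square_integrable w st)
    have Eg: "expectation (\<lambda>\<omega>. (diffusion (w n j) \<omega> - diffusion s \<omega>)\<^sup>2) \<le> K2 * (t - s)" if "j < Suc n" for n j
    proof -
      have "expectation (\<lambda>\<omega>. (diffusion (w n j) \<omega> - diffusion s \<omega>)\<^sup>2) \<le> K2 * (w n j - s)"
        by (rule K2(2)[OF st(1) w(3) w(2)]) (use that in simp)
      also have "\<dots> \<le> K2 * (t - s)" using w(5)[of j n] that K2(1) by (intro mult_left_mono) auto
      finally show ?thesis .
    qed
    have E: "square_integrable M (R n)" "expectation (\<lambda>\<omega>. (R n \<omega>)\<^sup>2) \<le> 2 * ((t - s)\<^sup>2 * K1) + 2 * ((t - s) * (K2 * (t - s)))" for n
      unfolding R_def w_def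
      by (rule Euler_sum_square_le(3,4)[OF st(1,2), where KD = K1 and KG = "K2 * (t - s)"]; fold w_def;
          intro drift_square_integrable g sg Eg K1 w; simp)+
    have st0: "0 \<le> t" using st by simp
    have "converges_in_probability M R (\<lambda>\<omega>. X t \<omega> - (X s \<omega> + diffusion s \<omega> * (B t \<omega> - B s \<omega>)))"
    proof (rule Euler_limit_centered[OF st(1,2)])
      show "(\<lambda>\<omega>. X s \<omega> + diffusion s \<omega> * (B t \<omega> - B s \<omega>)) \<in> borel_measurable M"
        using square_integrableD(1)[OF diffusion_square_integrable[OF st(1)]] st(1) st0 by measurable
      fix n \<omega>
      have "(\<Sum>j<Suc n. diffusion s \<omega> * (B (w n (Suc j)) \<omega> - B (w n j) \<omega>)) = diffusion s \<omega> * (B (w n (Suc n)) \<omega> - B (w n 0) \<omega>)"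
        unfolding sum_distrib_left[symmetric] by (subst sum_lessThan_telescope) simp
      then show "R n \<omega> = X s \<omega> + (\<Sum>j<Suc n. drift (uniform_grid s t n j) \<omega> * (uniform_grid s t n (Suc j) - uniform_grid s t n j))
        + (\<Sum>j<Suc n. diffusion (uniform_grid s t n j) \<omega> * (B (uniform_grid s t n (Suc j)) \<omega> - B (uniform_grid s t n j) \<omega>))
        - (X s \<omega> + diffusion s \<omega> * (B t \<omega> - B s \<omega>))"
        unfolding R_def w_def[symmetric] w0
        by (simp add: left_diff_distrib sum_subtractf del: sum.lessThan_Suc)
    qed
    from converges_in_probability_square_le(2)[OF this E tendsto_const]
    have "expectation (\<lambda>\<omega>. (X t \<omega> - (X s \<omega> + diffusion s \<omega> * (B t \<omega> - B s \<omega>)))\<^sup>2)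
      \<le> 2 * ((t - s)\<^sup>2 * K1) + 2 * ((t - s) * (K2 * (t - s)))" .
    then show ?thesis by (simp add: power2_eq_square algebra_simps)
  qed
  then show ?thesis using K1(1) K2(1) by (intro exI[of _ "2 * K1 + 2 * K2"]) auto
qed

text \<open>For \<open>\<rho>\<close> = 0 the diffusion coefficient changes by \<sigma> (X u - X s),
  to leading order by \<sigma> \<open>diffusion s\<close> (B u - B s), and the noise integral of B u
  - B s has the closed form ((B t - B s)^2 - (t - s)) / 2. What is left of the coefficient has order
  h in L2, so the remainder has order h^(3/2) in L2 and hence in L1.\<close>

lemma Milstein_remainder_bound:
  assumes "\<rho> = 0"
  shows "\<exists>K\<ge>0. \<forall>s t. 0 \<le> s \<and> s \<le> t \<and> t \<le> T \<longrightarrow>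
     integrable M (\<lambda>\<omega>. X t \<omega> - (X s \<omega> + (t - s) * drift s \<omega> + diffusion s \<omega> * (B t \<omega> - B s \<omega>)
         + \<sigma> * diffusion s \<omega> * (((B t \<omega> - B s \<omega>)\<^sup>2 - (t - s)) / 2))) \<and>
     expectation (\<lambda>\<omega>. \<bar>X t \<omega> - (X s \<omega> + (t - s) * drift s \<omega> + diffusion s \<omega> * (B t \<omega> - B s \<omega>)
         + \<sigma> * diffusion s \<omega> * (((B t \<omega> - B s \<omega>)\<^sup>2 - (t - s)) / 2))\<bar>) \<le> K * ((t - s) * sqrt (t - s))"
proof -
  obtain K1 where K1: "0 \<le> K1" "\<And>t. 0 \<le> t \<Longrightarrow> t \<le> T \<Longrightarrow> expectation (\<lambda>\<omega>. (diffusion t \<omega>)\<^sup>2) \<le> K1"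
    using coefficient_moment_bound[of T] by blast
  obtain K2 where K2: "0 \<le> K2"
    "\<And>s t. 0 \<le> s \<Longrightarrow> s \<le> t \<Longrightarrow> t \<le> T \<Longrightarrow> expectation (\<lambda>\<omega>. (drift t \<omega> - drift s \<omega>)\<^sup>2) \<le> K2 * (t - s)"
    using coefficient_increment_bound[of T] by blast
  obtain K3 where K3: "0 \<le> K3"
    "\<And>s t. 0 \<le> s \<Longrightarrow> s \<le> t \<Longrightarrow> t \<le> T \<Longrightarrow>
      expectation (\<lambda>\<omega>. (X t \<omega> - X s \<omega> - diffusion s \<omega> * (B t \<omega> - B s \<omega>))\<^sup>2) \<le> K3 * (t - s)\<^sup>2"
    using linear_approximation_bound[of T] by blast
  \<comment> \<open>The square root of the coefficient of h^3 in the limit of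
    \<open>C\<close>.\<close>
  define K where "K = sqrt (4 * K2 + 4 * \<sigma>\<^sup>2 * K3)"
  have main: "integrable M R \<and> expectation (\<lambda>\<omega>. \<bar>R \<omega>\<bar>) \<le> K * ((t - s) * sqrt (t - s))"
    if st: "0 \<le> s" "s \<le> t" "t \<le> T" and
      R: "R = (\<lambda>\<omega>. X t \<omega> - (X s \<omega> + (t - s) * drift s \<omega> + diffusion s \<omega> * (B t \<omega> - B s \<omega>)
         + \<sigma> * diffusion s \<omega> * (((B t \<omega> - B s \<omega>)\<^sup>2 - (t - s)) / 2)))" for s t R
  proof -
    define h where "h = t - s"
    have h: "0 \<le> h" using st by (simp add: h_def)
    have t0: "0 \<le> t" and sT: "s \<le> T" using st by auto
    define w where "w = uniform_grid s t"
    have w: "0 \<le> w n j" "j \<le> Suc n \<Longrightarrow> w n j \<le> T" "s \<le> w n j" "w n j \<le> w n (Suc j)" "j \<le> Suc n \<Longrightarrow> w n j - s \<le> h" for n j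
      using uniform_grid_mem[OF st(2)] st uniform_grid_bounds(3,4,5)[OF st(2)] unfolding w_def h_def by (blast, blast, blast, blast, fastforce)
    have w0: "w n 0 = s" "w n (Suc n) = t" for n using st by (auto simp: w_def)
    have step: "w n (Suc j) - w n j = h / real (Suc n)" for n j
      unfolding w_def h_def by (rule uniform_grid_step)
    define d where "d n j \<omega> = drift (w n j) \<omega> - drift s \<omega>" for n j \<omega>
    \<comment> \<open>For \<open>\<rho>\<close> = 0 this is the diffusion coefficient at
      \<open>w n j\<close> minus its linear approximation from s.\<close>
    define g where "g n j \<omega> = \<sigma> * (X (w n j) \<omega> - X s \<omega> - diffusion s \<omega> * (B (w n j) \<omega> - B s \<omega>))" for n j \<omega>
    define V where "V n \<omega> = (\<Sum>j<Suc n. (B (w n (Suc j)) \<omega> - B (w n j) \<omega>)\<^sup>2 - (w n (Suc j) - w n j))" for n \<omega>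
    define U where "U n \<omega> = (\<Sum>j<Suc n. d n j \<omega> * (w n (Suc j) - w n j)) + (\<Sum>j<Suc n. g n j \<omega> * (B (w n (Suc j)) \<omega> - B (w n j) \<omega>))" for n \<omega>
    \<comment> \<open>The discrete iterated integral misses its closed form by half of
      \<open>V n\<close>, the deviation of the quadratic variation from t - s; \<open>Q n\<close>
      collects this error and tends to 0 in L2.\<close>
    define Q where "Q n \<omega> = (- \<sigma> / 2) * (diffusion s \<omega> * V n \<omega>)" for n \<omega>
    have sqG: "square_integrable M (diffusion s)" by (rule diffusion_square_integrable[OF st(1)])
    have d: "square_integrable M (d n j)" for n j
      unfolding d_def[abs_def] by (intro square_integrable_diff drift_square_integrable w st)
    have Ed: "expectation (\<lambda>\<omega>. (d n j \<omega>)\<^sup>2) \<le> K2 * h" if "j < Suc n" for n j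
    proof -
      have "expectation (\<lambda>\<omega>. (d n j \<omega>)\<^sup>2) \<le> K2 * (w n j - s)"
        unfolding d_def by (rule K2(2)[OF st(1) w(3) w(2)]) (use that in simp)
      also have "\<dots> \<le> K2 * h" using w(5)[of j n] that K2(1) by (intro mult_left_mono) auto
      finally show ?thesis .
    qed
    have g_F: "g n j \<in> borel_measurable (\<F> (w n j))" for n j
    proof -
      have [measurable]: "X (w n j) \<in> borel_measurable (\<F> (w n j))" "X s \<in> borel_measurable (\<F> (w n j))"
        "diffusion s \<in> borel_measurable (\<F> (w n j))" "B (w n j) \<in> borel_measurable (\<F> (w n j))" "B s \<in> borel_measurable (\<F> (w n j))"
        using w st(1) X_filtration B_measurable_filtration measurable_filtration_mono[OF X_filtration[OF st(1)] w(3)]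
          measurable_filtration_mono[OF diffusion_filtration[OF st(1)] w(3)] by auto
      show ?thesis unfolding g_def[abs_def] by measurable
    qed
    have g_sq: "square_integrable M (g n j)" for n j
      unfolding g_def[abs_def]
      by (intro square_integrable_cmult square_integrable_diff X_square_integrable w st
          square_integrable_mult_increment(1)[OF st(1) w(3) diffusion_filtration[OF st(1)] sqG])
    have Eg: "expectation (\<lambda>\<omega>. (g n j \<omega>)\<^sup>2) \<le> \<sigma>\<^sup>2 * K3 * h\<^sup>2" if "j < Suc n" for n j
    proof -
      have "expectation (\<lambda>\<omega>. (X (w n j) \<omega> - X s \<omega> - diffusion s \<omega> * (B (w n j) \<omega> - B s \<omega>))\<^sup>2) \<le> K3 * (w n j - s)\<^sup>2"
        by (rule K3(2)[OF st(1) w(3) w(2)]) (use that in simp)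
      also have "\<dots> \<le> K3 * h\<^sup>2"
        using w(5)[of j n] w(3)[of n j] that K3(1) by (intro mult_left_mono power_mono) auto
      finally show ?thesis
        unfolding g_def power_mult_distrib by (simp add: mult_left_mono mult.assoc)
    qed
    have U: "square_integrable M (U n)" "expectation (\<lambda>\<omega>. (U n \<omega>)\<^sup>2) \<le> 2 * (h\<^sup>2 * (K2 * h)) + 2 * (h * (\<sigma>\<^sup>2 * K3 * h\<^sup>2))" for n
    proof -
      note E = Euler_sum_square_le(3,4)[OF st(1,2), of n "d n" "K2 * h" "g n" "\<sigma>\<^sup>2 * K3 * h\<^sup>2", folded w_def h_def]
      show "square_integrable M (U n)"
        unfolding U_def[abs_def] by (rule E(1)) (blast intro: d Ed g_F g_sq Eg)+
      show "expectation (\<lambda>\<omega>. (U n \<omega>)\<^sup>2) \<le> 2 * (h\<^sup>2 * (K2 * h)) + 2 * (h * (\<sigma>\<^sup>2 * K3 * h\<^sup>2))"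
        unfolding U_def by (rule E(2)) (blast intro: d Ed g_F g_sq Eg)+
    qed
    have GV: "square_integrable M (\<lambda>\<omega>. diffusion s \<omega> * V n \<omega>)"
      "expectation (\<lambda>\<omega>. (diffusion s \<omega> * V n \<omega>)\<^sup>2) = expectation (\<lambda>\<omega>. (diffusion s \<omega>)\<^sup>2) * (\<Sum>i<Suc n. 2 * (w n (Suc i) - w n i)\<^sup>2)" for n
      using quadratic_variation[of "w n" "Suc n" "diffusion s", OF w(1) w(4)] diffusion_filtration[OF st(1)] sqG
      unfolding w0 V_def by blast+
    have Q: "square_integrable M (Q n)" for n
      unfolding Q_def[abs_def] by (intro square_integrable_cmult GV)
    have EQ: "expectation (\<lambda>\<omega>. (Q n \<omega>)\<^sup>2) \<le> (\<sigma> / 2)\<^sup>2 * (K1 * (2 * h\<^sup>2)) * inverse (real (Suc n))" for n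
    proof -
      have "(\<Sum>i<Suc n. 2 * (w n (Suc i) - w n i)\<^sup>2) = 2 * h\<^sup>2 * inverse (real (Suc n))"
        unfolding step by (simp add: power_divide power2_eq_square divide_inverse del: of_nat_Suc sum.lessThan_Suc)
      then have "expectation (\<lambda>\<omega>. (diffusion s \<omega> * V n \<omega>)\<^sup>2) \<le> K1 * (2 * h\<^sup>2 * inverse (real (Suc n)))"
        unfolding GV(2) using K1(2)[OF st(1) sT] K1(1) by (intro mult_mono) auto
      then have "(\<sigma> / 2)\<^sup>2 * expectation (\<lambda>\<omega>. (diffusion s \<omega> * V n \<omega>)\<^sup>2) \<le> (\<sigma> / 2)\<^sup>2 * (K1 * (2 * h\<^sup>2 * inverse (real (Suc n))))"
        by (intro mult_left_mono) auto
      moreover have "expectation (\<lambda>\<omega>. (Q n \<omega>)\<^sup>2) = (\<sigma> / 2)\<^sup>2 * expectation (\<lambda>\<omega>. (diffusion s \<omega> * V n \<omega>)\<^sup>2)"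
        by (simp add: Q_def power_mult_distrib power_divide)
      ultimately show ?thesis by (simp only: mult.assoc)
    qed
    define C where "C n = 2 * (2 * (h\<^sup>2 * (K2 * h)) + 2 * (h * (\<sigma>\<^sup>2 * K3 * h\<^sup>2)))
      + 2 * ((\<sigma> / 2)\<^sup>2 * (K1 * (2 * h\<^sup>2)) * inverse (real (Suc n)))" for n
    have UQ: "square_integrable M (\<lambda>\<omega>. U n \<omega> + Q n \<omega>)" "expectation (\<lambda>\<omega>. (U n \<omega> + Q n \<omega>)\<^sup>2) \<le> C n" for n
      using square_integrable_add[OF U(1) Q] expectation_square_add_le[OF U(1) Q, of n n] U(2)[of n] EQ[of n]
      unfolding C_def by (simp_all del: of_nat_Suc)
    have "C \<longlonglongrightarrow> 2 * (2 * (h\<^sup>2 * (K2 * h)) + 2 * (h * (\<sigma>\<^sup>2 * K3 * h\<^sup>2))) + 2 * ((\<sigma> / 2)\<^sup>2 * (K1 * (2 * h\<^sup>2)) * 0)"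
      unfolding C_def by (intro tendsto_add tendsto_const tendsto_mult LIMSEQ_inverse_real_of_nat)
    then have C: "C \<longlonglongrightarrow> K\<^sup>2 * h ^ 3"
      using K2(1) K3(1) by (simp add: K_def power2_eq_square power3_eq_cube algebra_simps)
    have conv: "converges_in_probability M (\<lambda>n \<omega>. U n \<omega> + Q n \<omega>) R"
      unfolding R
    proof (rule Euler_limit_centered[OF st(1,2)])
      show "(\<lambda>\<omega>. X s \<omega> + (t - s) * drift s \<omega> + diffusion s \<omega> * (B t \<omega> - B s \<omega>)
         + \<sigma> * diffusion s \<omega> * (((B t \<omega> - B s \<omega>)\<^sup>2 - (t - s)) / 2)) \<in> borel_measurable M"
        using square_integrableD(1)[OF sqG] square_integrableD(1)[OF drift_square_integrable[OF st(1)]] st(1) t0 by measurable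
      fix n \<omega>
      have 1: "(\<Sum>j<Suc n. drift s \<omega> * (w n (Suc j) - w n j)) = (t - s) * drift s \<omega>"
        unfolding step by (simp add: h_def del: of_nat_Suc sum.lessThan_Suc)
      have 2: "(\<Sum>j<Suc n. B (w n (Suc j)) \<omega> - B (w n j) \<omega>) = B t \<omega> - B s \<omega>"
        by (subst sum_lessThan_telescope) (simp add: w0)
      have 3: "(\<Sum>j<Suc n. w n (Suc j) - w n j) = t - s"
        by (subst sum_lessThan_telescope) (simp add: w0)
      \<comment> \<open>Summation by parts: telescoping the squares of B - B s expresses the
        iterated sum through the quadratic variation.\<close>
      have "(\<Sum>j<Suc n. (B (w n (Suc j)) \<omega> - B s \<omega>)\<^sup>2 - (B (w n j) \<omega> - B s \<omega>)\<^sup>2) = (B t \<omega> - B s \<omega>)\<^sup>2"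
        by (subst sum_lessThan_telescope) (simp add: w0)
      also have "(\<Sum>j<Suc n. (B (w n (Suc j)) \<omega> - B s \<omega>)\<^sup>2 - (B (w n j) \<omega> - B s \<omega>)\<^sup>2)
        = (\<Sum>j<Suc n. 2 * ((B (w n j) \<omega> - B s \<omega>) * (B (w n (Suc j)) \<omega> - B (w n j) \<omega>)) + (B (w n (Suc j)) \<omega> - B (w n j) \<omega>)\<^sup>2)"
        by (intro sum.cong refl) (simp add: power2_eq_square algebra_simps)
      finally have 4: "(\<Sum>j<Suc n. (B (w n j) \<omega> - B s \<omega>) * (B (w n (Suc j)) \<omega> - B (w n j) \<omega>))
        = ((B t \<omega> - B s \<omega>)\<^sup>2 - (t - s) - V n \<omega>) / 2"
        unfolding V_def sum.distrib sum_subtractf[of _ "\<lambda>j. w n (Suc j) - w n j"] 3 sum_distrib_left[symmetric]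
        by (simp del: sum.lessThan_Suc)
      have g: "g n j \<omega> = diffusion (w n j) \<omega> - diffusion s \<omega> - \<sigma> * diffusion s \<omega> * (B (w n j) \<omega> - B s \<omega>)" for j
        unfolding g_def diffusion_def using assms by (simp add: algebra_simps)
      have 5: "(\<Sum>j<Suc n. g n j \<omega> * (B (w n (Suc j)) \<omega> - B (w n j) \<omega>))
        = (\<Sum>j<Suc n. diffusion (w n j) \<omega> * (B (w n (Suc j)) \<omega> - B (w n j) \<omega>)) - diffusion s \<omega> * (B t \<omega> - B s \<omega>)
          - \<sigma> * diffusion s \<omega> * (((B t \<omega> - B s \<omega>)\<^sup>2 - (t - s) - V n \<omega>) / 2)"
      proof -
        have "(\<Sum>j<Suc n. g n j \<omega> * (B (w n (Suc j)) \<omega> - B (w n j) \<omega>))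
          = (\<Sum>j<Suc n. diffusion (w n j) \<omega> * (B (w n (Suc j)) \<omega> - B (w n j) \<omega>)
              - diffusion s \<omega> * (B (w n (Suc j)) \<omega> - B (w n j) \<omega>)
              - \<sigma> * diffusion s \<omega> * ((B (w n j) \<omega> - B s \<omega>) * (B (w n (Suc j)) \<omega> - B (w n j) \<omega>)))"
          by (intro sum.cong refl) (simp add: g algebra_simps)
        also have "\<dots> = (\<Sum>j<Suc n. diffusion (w n j) \<omega> * (B (w n (Suc j)) \<omega> - B (w n j) \<omega>))
              - diffusion s \<omega> * (\<Sum>j<Suc n. B (w n (Suc j)) \<omega> - B (w n j) \<omega>)
              - \<sigma> * diffusion s \<omega> * (\<Sum>j<Suc n. (B (w n j) \<omega> - B s \<omega>) * (B (w n (Suc j)) \<omega> - B (w n j) \<omega>))"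
          by (simp only: sum_subtractf[of "\<lambda>j. _ j - _ j"] sum_subtractf[of "\<lambda>j. diffusion (w n j) \<omega> * _ j"] sum_distrib_left)
        finally show ?thesis unfolding 2 4 .
      qed
      show "U n \<omega> + Q n \<omega> = X s \<omega> + (\<Sum>j<Suc n. drift (uniform_grid s t n j) \<omega> * (uniform_grid s t n (Suc j) - uniform_grid s t n j))
        + (\<Sum>j<Suc n. diffusion (uniform_grid s t n j) \<omega> * (B (uniform_grid s t n (Suc j)) \<omega> - B (uniform_grid s t n j) \<omega>))
        - (X s \<omega> + (t - s) * drift s \<omega> + diffusion s \<omega> * (B t \<omega> - B s \<omega>)
         + \<sigma> * diffusion s \<omega> * (((B t \<omega> - B s \<omega>)\<^sup>2 - (t - s)) / 2))"
        unfolding U_def 5 Q_def w_def[symmetric] d_def left_diff_distrib[of "drift _ _"] sum_subtractf 1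
        by (simp add: field_simps del: sum.lessThan_Suc)
    qed
    from converges_in_probability_square_le[OF conv UQ C]
    have sqR: "square_integrable M R" and ER: "expectation (\<lambda>\<omega>. (R \<omega>)\<^sup>2) \<le> K\<^sup>2 * h ^ 3" by auto
    have "expectation (\<lambda>\<omega>. \<bar>R \<omega>\<bar>) \<le> sqrt (K\<^sup>2 * h ^ 3)"
      using expectation_abs_le_sqrt[OF sqR] ER real_sqrt_le_mono order_trans by blast
    also have "\<dots> = K * (h * sqrt h)"
      using h K2(1) K3(1) by (simp add: K_def real_sqrt_mult power3_eq_cube)
    finally show ?thesis using square_integrable_integrable[OF sqR] by (simp add: h_def)
  qed
  have "0 \<le> K" using K2(1) K3(1) by (simp add: K_def)
  then show ?thesis using main by blast
qed

text \<open>The factor \<open>f\<close> multiplying \<open>X s\<close> in a Milstein step is nonnegative for short steps, so the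
  absolute value passes through it.\<close>

lemma first_moment_step:
  assumes "\<rho> = 0"
  shows "\<exists>K\<ge>0. \<forall>s t. 0 \<le> s \<and> s \<le> t \<and> t \<le> T \<and> (t - s) * (2 * \<bar>a\<bar> + \<sigma>\<^sup>2) \<le> 1 \<longrightarrow>
     expectation (\<lambda>\<omega>. \<bar>X t \<omega>\<bar>) \<le> expectation (\<lambda>\<omega>. \<bar>X s \<omega>\<bar>)
       + (t - s) * (a * expectation (\<lambda>\<omega>. \<bar>X s \<omega>\<bar>) + \<bar>b\<bar> * expectation (\<lambda>\<omega>. \<bar>X (q * s) \<omega>\<bar>))
       + K * ((t - s) * sqrt (t - s))"
proof -
  obtain K where K: "0 \<le> K" "\<And>s t. 0 \<le> s \<Longrightarrow> s \<le> t \<Longrightarrow> t \<le> T \<Longrightarrow>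
     integrable M (\<lambda>\<omega>. X t \<omega> - (X s \<omega> + (t - s) * drift s \<omega> + diffusion s \<omega> * (B t \<omega> - B s \<omega>)
         + \<sigma> * diffusion s \<omega> * (((B t \<omega> - B s \<omega>)\<^sup>2 - (t - s)) / 2)))"
    "\<And>s t. 0 \<le> s \<Longrightarrow> s \<le> t \<Longrightarrow> t \<le> T \<Longrightarrow>
     expectation (\<lambda>\<omega>. \<bar>X t \<omega> - (X s \<omega> + (t - s) * drift s \<omega> + diffusion s \<omega> * (B t \<omega> - B s \<omega>)
         + \<sigma> * diffusion s \<omega> * (((B t \<omega> - B s \<omega>)\<^sup>2 - (t - s)) / 2))\<bar>) \<le> K * ((t - s) * sqrt (t - s))"
    using Milstein_remainder_bound[OF assms, of T] by blast
  have "expectation (\<lambda>\<omega>. \<bar>X t \<omega>\<bar>) \<le> expectation (\<lambda>\<omega>. \<bar>X s \<omega>\<bar>)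
       + (t - s) * (a * expectation (\<lambda>\<omega>. \<bar>X s \<omega>\<bar>) + \<bar>b\<bar> * expectation (\<lambda>\<omega>. \<bar>X (q * s) \<omega>\<bar>))
       + K * ((t - s) * sqrt (t - s))"
    if st: "0 \<le> s" "s \<le> t" "t \<le> T" "(t - s) * (2 * \<bar>a\<bar> + \<sigma>\<^sup>2) \<le> 1" for s t
  proof -
    define h where "h = t - s"
    have h: "0 \<le> h" "h * (2 * \<bar>a\<bar> + \<sigma>\<^sup>2) \<le> 1" using st by (auto simp: h_def)
    define R where "R \<omega> = X t \<omega> - (X s \<omega> + (t - s) * drift s \<omega> + diffusion s \<omega> * (B t \<omega> - B s \<omega>)
         + \<sigma> * diffusion s \<omega> * (((B t \<omega> - B s \<omega>)\<^sup>2 - (t - s)) / 2))" for \<omega>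
    have R: "integrable M R" "expectation (\<lambda>\<omega>. \<bar>R \<omega>\<bar>) \<le> K * (h * sqrt h)"
      unfolding R_def[abs_def] h_def using K(2,3)[OF st(1-3)] by auto
    let ?D = "\<lambda>\<omega>. B t \<omega> - B s \<omega>"
    define f where "f \<omega> = 1 + a * h + \<sigma> * ?D \<omega> + \<sigma>\<^sup>2 * ((?D \<omega>)\<^sup>2 - h) / 2" for \<omega>
    have f: "0 \<le> f \<omega>" for \<omega>
    proof -
      \<comment> \<open>Completing the square gives f = 1/2 + a h - \<sigma>^2 h / 2 + (1 + \<sigma>
        (B t - B s))^2 / 2. The restriction on the step makes the deterministic part nonnegative,
        however large the Gaussian increment is.\<close>
      have "h * (- a) \<le> h * \<bar>a\<bar>" using h(1) by (intro mult_left_mono) auto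
      then have "0 \<le> 1 / 2 + a * h - \<sigma>\<^sup>2 * h / 2" using h(2) by (simp add: algebra_simps)
      also have "\<dots> \<le> 1 / 2 + a * h - \<sigma>\<^sup>2 * h / 2 + (1 + \<sigma> * ?D \<omega>)\<^sup>2 / 2" by simp
      also have "\<dots> = f \<omega>" by (simp add: f_def power2_eq_square field_simps)
      finally show ?thesis .
    qed
    have dif: "diffusion s \<omega> = \<sigma> * X s \<omega>" for \<omega>
      unfolding diffusion_def using assms by simp
    have X_eq: "X t \<omega> = X s \<omega> * f \<omega> + b * h * X (q * s) \<omega> + R \<omega>" for \<omega>
      by (simp add: R_def f_def drift_def dif h_def power2_eq_square field_simps)
    have "\<bar>X t \<omega>\<bar> \<le> \<bar>X s \<omega>\<bar> * f \<omega> + \<bar>b\<bar> * h * \<bar>X (q * s) \<omega>\<bar> + \<bar>R \<omega>\<bar>" for \<omega>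
    proof -
      have "\<bar>X t \<omega>\<bar> \<le> \<bar>X s \<omega> * f \<omega>\<bar> + \<bar>b * h * X (q * s) \<omega>\<bar> + \<bar>R \<omega>\<bar>" unfolding X_eq by linarith
      then show ?thesis using f[of \<omega>] h(1) by (simp add: abs_mult)
    qed
    moreover have int: "integrable M (\<lambda>\<omega>. \<bar>X t \<omega>\<bar>)" "integrable M (\<lambda>\<omega>. \<bar>X s \<omega>\<bar>)" "integrable M (\<lambda>\<omega>. \<bar>X (q * s) \<omega>\<bar>)"
      using X_square_integrable[of t] X_square_integrable[of s] X_q_square_integrable[of s] st square_integrable_integrable by auto
    \<comment> \<open>The random part of \<open>f\<close> is centred and independent of
      \<open>X s\<close>, so only the drift remains in the mean; with
      \<open>\<bar>f \<omega>\<bar>\<close> in place of \<open>f \<omega>\<close> this would be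
      lost.\<close>
    moreover have Xf: "integrable M (\<lambda>\<omega>. \<bar>X s \<omega>\<bar> * f \<omega>)" "expectation (\<lambda>\<omega>. \<bar>X s \<omega>\<bar> * f \<omega>) = (1 + a * h) * expectation (\<lambda>\<omega>. \<bar>X s \<omega>\<bar>)"
    proof -
      have XF: "(\<lambda>\<omega>. \<bar>X s \<omega>\<bar>) \<in> borel_measurable (\<F> s)" using X_filtration[OF st(1)] by measurable
      note p1 = filtration_mult_increment_power[OF st(1,2) XF int(2), of 1]
      note p2 = filtration_mult_increment_power[OF st(1,2) XF int(2), of 2]
      note mom = B_increment_moments(1,2)[OF st(1,2)]
      have eq: "\<bar>X s \<omega>\<bar> * f \<omega> = (1 + a * h - \<sigma>\<^sup>2 * h / 2) * \<bar>X s \<omega>\<bar> + \<sigma> * (\<bar>X s \<omega>\<bar> * ?D \<omega> ^ 1) + \<sigma>\<^sup>2 / 2 * (\<bar>X s \<omega>\<bar> * (?D \<omega>)\<^sup>2)" for \<omega>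
        by (simp add: f_def field_simps)
      show "integrable M (\<lambda>\<omega>. \<bar>X s \<omega>\<bar> * f \<omega>)"
        unfolding eq by (intro Bochner_Integration.integrable_add integrable_mult_right p1(1) p2(1) int(2))
      have "expectation (\<lambda>\<omega>. \<bar>X s \<omega>\<bar> * f \<omega>) = (1 + a * h - \<sigma>\<^sup>2 * h / 2) * expectation (\<lambda>\<omega>. \<bar>X s \<omega>\<bar>)
        + \<sigma> * expectation (\<lambda>\<omega>. \<bar>X s \<omega>\<bar> * ?D \<omega> ^ 1) + \<sigma>\<^sup>2 / 2 * expectation (\<lambda>\<omega>. \<bar>X s \<omega>\<bar> * (?D \<omega>)\<^sup>2)"
        unfolding eq using p1(1) p2(1) int(2) by simp
      then show "expectation (\<lambda>\<omega>. \<bar>X s \<omega>\<bar> * f \<omega>) = (1 + a * h) * expectation (\<lambda>\<omega>. \<bar>X s \<omega>\<bar>)"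
        unfolding p1(2) p2(2) using mom by (simp add: h_def field_simps)
    qed
    ultimately have "expectation (\<lambda>\<omega>. \<bar>X t \<omega>\<bar>) \<le> expectation (\<lambda>\<omega>. \<bar>X s \<omega>\<bar> * f \<omega> + \<bar>b\<bar> * h * \<bar>X (q * s) \<omega>\<bar> + \<bar>R \<omega>\<bar>)"
      using R(1) by (intro integral_mono) auto
    also have "\<dots> = (1 + a * h) * expectation (\<lambda>\<omega>. \<bar>X s \<omega>\<bar>) + \<bar>b\<bar> * h * expectation (\<lambda>\<omega>. \<bar>X (q * s) \<omega>\<bar>) + expectation (\<lambda>\<omega>. \<bar>R \<omega>\<bar>)"
      using Xf int R(1) by simp
    finally show ?thesis using R(2) unfolding h_def by (simp add: algebra_simps)
  qed
  then show ?thesis using K(1) by blast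
qed

end

section \<open>Comparison with the pantograph differential inequality\<close>

lemma sqrt_modulus_imp_continuous:
  fixes y :: "real \<Rightarrow> real"
  assumes "\<And>T. \<exists>C\<ge>0. \<forall>s t. 0 \<le> s \<and> s \<le> t \<and> t \<le> T \<longrightarrow> \<bar>y t - y s\<bar> \<le> C * sqrt (t - s)"
  shows "continuous_on {0..} y"
  unfolding continuous_on_iff
proof safe
  fix x e :: real assume x: "0 \<le> x" and e: "0 < e"
  obtain C where C: "0 \<le> C" "\<And>s t. 0 \<le> s \<Longrightarrow> s \<le> t \<Longrightarrow> t \<le> x + 1 \<Longrightarrow> \<bar>y t - y s\<bar> \<le> C * sqrt (t - s)"
    using assms[of "x + 1"] by blast
  define d where "d = min 1 ((e / (C + 1))\<^sup>2)"
  have C': "\<bar>y x' - y x\<bar> \<le> C * sqrt \<bar>x' - x\<bar>" if "0 \<le> x'" "x' \<le> x + 1" for x'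
    using C(2)[of x x'] C(2)[of x' x] that x by (cases "x \<le> x'") (auto simp: abs_minus_commute)
  show "\<exists>d>0. \<forall>x'\<in>{0..}. dist x' x < d \<longrightarrow> dist (y x') (y x) < e"
  proof (intro exI conjI ballI impI)
    show "0 < d" using e C(1) by (simp add: d_def)
    fix x' assume x': "x' \<in> {0..}" "dist x' x < d"
    then have "\<bar>x' - x\<bar> < (e / (C + 1))\<^sup>2" "x' \<le> x + 1" by (auto simp: d_def dist_real_def)
    then have "sqrt \<bar>x' - x\<bar> < e / (C + 1)"
      using e C(1) by (intro real_less_lsqrt) auto
    then have "C * sqrt \<bar>x' - x\<bar> \<le> C * (e / (C + 1))"
      using C(1) by (intro mult_left_mono) auto
    also have "\<dots> < e" using e C(1) by (simp add: field_simps)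
    finally show "dist (y x') (y x) < e"
      using C'[of x'] x' \<open>x' \<le> x + 1\<close> by (simp add: dist_real_def)
  qed
qed

text \<open>From ln (1 - z) \<le> - z follows (1 - z) powr g \<le> exp (- g z) \<le> 1 / (1 + g z).
  The resulting bound is linear in z on all of [0, 1) and treats g < 1 and g > 1 alike.\<close>

lemma one_minus_powr_ge:
  fixes z g :: real
  assumes "0 \<le> z" "z < 1" "0 < g"
  shows "g / (1 + g) * z \<le> 1 - (1 - z) powr g"
proof -
  have "(1 - z) powr g = exp (g * ln (1 - z))"
    using assms by (simp add: powr_def)
  also have "\<dots> \<le> exp (- (g * z))"
    using mult_left_mono[OF ln_add_one_self_le_self2[of "- z"], of g] assms by simp
  also have "\<dots> \<le> 1 / (1 + g * z)"
    using exp_ge_add_one_self[of "g * z"] assms by (simp add: exp_minus inverse_eq_divide frac_le add_pos_nonneg)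
  also have "1 / (1 + g * z) = 1 - g * z / (1 + g * z)"
    using assms add_pos_nonneg[of 1 "g * z"] by (simp add: field_simps)
  finally have "g * z / (1 + g * z) \<le> 1 - (1 - z) powr g" by simp
  moreover have "g / (1 + g) * z \<le> g * z / (1 + g * z)"
    using assms mult_left_le[of z z] by (simp add: field_simps add_pos_nonneg mult_left_mono)
  ultimately show ?thesis by linarith
qed

text \<open>The exponent \<open>\<alpha>\<close> makes \<open>t powr \<alpha>\<close> annihilate the right-hand side; the shift by a large \<open>c\<close>
  makes up for the derivative of the power.\<close>

lemma shifted_power_supersolution:
  fixes q x \<beta> \<gamma> :: real
  assumes q: "0 < q" "q < 1" and x: "1 < x" and "0 \<le> \<beta>" "0 \<le> \<gamma>"
  defines "A \<equiv> \<gamma> * x\<^sup>2 + 2 * \<beta> * x" and "\<alpha> \<equiv> 2 * ln x / ln q"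
  assumes "0 < A"
  shows "\<exists>c\<ge>1. \<forall>t\<ge>0. - A * (t + c) powr \<alpha> + 2 * \<beta> * sqrt ((t + c) powr \<alpha> * (q * t + c) powr \<alpha>)
      + \<gamma> * (q * t + c) powr \<alpha> < \<alpha> * (t + c) powr (\<alpha> - 1)"
proof -
  have "0 < ln x" "ln q < 0" using q x by auto
  then have \<alpha>: "\<alpha> < 0" by (simp add: \<alpha>_def divide_neg_neg divide_pos_neg)
  \<comment> \<open>Half the exponent, because the term under the square root carries half of the
    delayed power.\<close>
  define g where "g = - \<alpha> / 2"
  have g: "0 < g" using \<alpha> by (simp add: g_def)
  \<comment> \<open>The shift yields a gain of at least \<mu> c / (q t + c); the choice of
    \<open>c\<close> lets it exceed the loss 2 g / (t + c) caused by the derivative.\<close>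
  define \<mu> where "\<mu> = A * (g / (1 + g)) * (1 - q)"
  have \<mu>: "0 < \<mu>" using g q \<open>0 < A\<close> by (simp add: \<mu>_def)
  define c where "c = 1 + 2 * g / \<mu>"
  have c: "1 \<le> c" using g \<mu> by (simp add: c_def)
  have \<mu>c: "2 * g < \<mu> * c" using \<mu> by (simp add: c_def field_simps)
  have q\<alpha>: "q powr \<alpha> = x\<^sup>2"
  proof -
    have "q powr \<alpha> = exp (2 * ln x)"
      using q \<open>ln q < 0\<close> by (simp add: powr_def \<alpha>_def)
    also have "\<dots> = (exp (ln x))\<^sup>2" by (rule exp_double)
    finally show ?thesis using x by simp
  qed
  have "- A * (t + c) powr \<alpha> + 2 * \<beta> * sqrt ((t + c) powr \<alpha> * (q * t + c) powr \<alpha>)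
      + \<gamma> * (q * t + c) powr \<alpha> < \<alpha> * (t + c) powr (\<alpha> - 1)" if t: "0 \<le> t" for t
  proof -
    define W where "W = (t + c) powr \<alpha>"
    have W: "0 < W" using t c by (simp add: W_def)
    \<comment> \<open>The scaled time would be q (t + c), the actual argument is q t + c.
      \<open>r\<close> is their ratio, and \<open>y\<close> below is its effect on half of the
      delayed power.\<close>
    define r where "r = q * (t + c) / (q * t + c)"
    define z where "z = c * (1 - q) / (q * t + c)"
    have qtc: "0 < q * t + c" "0 < t + c" using t c q by (auto intro: add_nonneg_pos)
    have r: "r = 1 - z" using qtc by (simp add: r_def z_def field_simps)
    have z: "0 \<le> z" using c q qtc by (simp add: z_def)
    have "0 < r" using qtc q by (simp add: r_def)
    then have z1: "z < 1" using r by simp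
    define y where "y = r powr g"
    have y: "0 < y" "y \<le> 1" using \<open>0 < r\<close> r z g by (auto simp: y_def intro: powr_le1)
    have y2: "y\<^sup>2 = r powr (- \<alpha>)"
      using \<open>0 < r\<close> by (simp add: y_def power2_eq_square powr_add[symmetric] g_def)
    have "(q * t + c) powr \<alpha> = (q * (t + c) / r) powr \<alpha>"
      using qtc q by (simp add: r_def)
    also have "\<dots> = q powr \<alpha> * W * r powr (- \<alpha>)"
      using qtc q \<open>0 < r\<close> by (simp add: powr_divide powr_mult W_def powr_minus_divide)
    finally have Wq: "(q * t + c) powr \<alpha> = x\<^sup>2 * W * y\<^sup>2" unfolding q\<alpha> y2 .
    have "sqrt (W * (x\<^sup>2 * W * y\<^sup>2)) = sqrt ((W * x * y)\<^sup>2)" by (simp add: power2_eq_square mult_ac)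
    then have sq: "sqrt (W * (x\<^sup>2 * W * y\<^sup>2)) = W * x * y" using W x y by simp
    \<comment> \<open>With \<open>y\<close> for \<open>y\<^sup>2\<close> both delayed terms carry
      the same factor and add up to A W y by the choice of \<open>A\<close>.\<close>
    have "y\<^sup>2 \<le> y" using y by (simp add: power2_eq_square mult_left_le)
    then have "\<gamma> * (x\<^sup>2 * W * y\<^sup>2) \<le> \<gamma> * (x\<^sup>2 * W * y)"
      using W \<open>0 \<le> \<gamma>\<close> by (intro mult_left_mono) auto
    then have "- A * W + 2 * \<beta> * (W * x * y) + \<gamma> * (x\<^sup>2 * W * y\<^sup>2) \<le> - (W * (A * (1 - y)))"
      by (simp add: A_def algebra_simps)
    also have "\<dots> < - (W * (2 * g / (t + c)))"
    proof -
      have "2 * g / (t + c) < \<mu> * c / (t + c)" using \<mu>c qtc by (intro divide_strict_right_mono)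
      also have "\<dots> \<le> \<mu> * c / (q * t + c)"
        using \<mu> c qtc t q by (intro divide_left_mono mult_pos_pos) (auto simp: mult_left_le_one_le)
      also have "\<dots> = A * (g / (1 + g) * z)" by (simp add: \<mu>_def z_def)
      also have "\<dots> \<le> A * (1 - y)"
        unfolding y_def r using one_minus_powr_ge[OF z z1 g] \<open>0 < A\<close> by (intro mult_left_mono) auto
      finally show ?thesis using mult_strict_left_mono[OF _ W] by (simp only: neg_less_iff_less)
    qed
    also have "\<dots> = \<alpha> * (t + c) powr (\<alpha> - 1)"
      using qtc by (simp add: g_def W_def powr_diff)
    finally show ?thesis unfolding Wq W_def[symmetric] sq .
  qed
  then show ?thesis using c by blast
qed

text \<open>At the infimum u of the times where y exceeds w the two functions agree, and at q u the
  order y \<le> w still holds. As \<beta> and \<gamma> are nonnegative, the right-hand side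
  increases with the delayed value, so the strict inequality for w separates the slopes at u, and y
  cannot exceed w immediately to the right of u.\<close>

lemma upper_Dini_comparison:
  fixes y w w' :: "real \<Rightarrow> real"
  assumes q: "0 < q" "q < 1" and "0 \<le> \<beta>" "0 \<le> \<gamma>"
    and y: "continuous_on {0..} y"
      "\<And>t \<epsilon>. 0 \<le> t \<Longrightarrow> 0 < \<epsilon> \<Longrightarrow> \<exists>d>0. \<forall>h. 0 < h \<and> h < d \<longrightarrow>
         y (t + h) \<le> y t + h * (- A * y t + 2 * \<beta> * sqrt (y t * y (q * t)) + \<gamma> * y (q * t) + \<epsilon>)"
    and w: "\<And>t. 0 \<le> t \<Longrightarrow> 0 \<le> w t" "\<And>t. 0 \<le> t \<Longrightarrow> (w has_real_derivative w' t) (at t)"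
      "\<And>t. 0 \<le> t \<Longrightarrow> - A * w t + 2 * \<beta> * sqrt (w t * w (q * t)) + \<gamma> * w (q * t) < w' t"
    and init: "y 0 \<le> w 0" and t: "0 \<le> t"
  shows "y t \<le> w t"
proof (rule ccontr)
  assume neg: "\<not> y t \<le> w t"
  have w_cont: "continuous_on {0..} w"
    using w(2) by (auto intro!: continuous_at_imp_continuous_on DERIV_isCont)
  define S where "S = {s. 0 \<le> s \<and> w s < y s}"
  have S: "S \<noteq> {}" "bdd_below S" using neg t by (auto simp: S_def intro: bdd_belowI[of _ 0])
  define u where "u = Inf S"
  have u0: "0 \<le> u" unfolding u_def using S by (intro cInf_greatest) (auto simp: S_def)
  have below: "y s \<le> w s" if "0 \<le> s" "s < u" for s
    using cInf_lower[OF _ S(2), of s] that by (force simp: S_def u_def)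
  have cont: "continuous_on {0..} (\<lambda>s. w s - y s)" using w_cont y(1) by (intro continuous_intros)
  have near: "\<exists>d>0. \<forall>s. 0 \<le> s \<and> \<bar>s - u\<bar> < d \<longrightarrow> \<bar>(w s - y s) - (w u - y u)\<bar> < e" if "0 < e" for e
    using cont[unfolded continuous_on_iff, rule_format, of u e] u0 that by (auto simp: dist_real_def)
  have le_u: "y u \<le> w u"
  proof (rule ccontr)
    assume "\<not> y u \<le> w u"
    then have gap: "0 < y u - w u" by simp
    then have "u \<noteq> 0" using init by auto
    obtain d where d: "0 < d" "\<And>s. 0 \<le> s \<Longrightarrow> \<bar>s - u\<bar> < d \<Longrightarrow> \<bar>(w s - y s) - (w u - y u)\<bar> < y u - w u"
      using near[OF gap] by blast
    define s where "s = max 0 (u - d / 2)"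
    have "0 \<le> s" "s < u" "\<bar>s - u\<bar> < d" using u0 \<open>u \<noteq> 0\<close> d(1) by (auto simp: s_def)
    then show False using below[of s] d(2)[of s] by linarith
  qed
  have ge_u: "w u \<le> y u"
  proof (rule ccontr)
    assume "\<not> w u \<le> y u"
    then have gap: "0 < w u - y u" by simp
    obtain d where d: "0 < d" "\<And>s. 0 \<le> s \<Longrightarrow> \<bar>s - u\<bar> < d \<Longrightarrow> \<bar>(w s - y s) - (w u - y u)\<bar> < w u - y u"
      using near[OF gap] by blast
    obtain s where s: "s \<in> S" "s < u + d"
      using cInf_lessD[OF S(1), of "u + d"] d(1) by (auto simp: u_def)
    have "u \<le> s" unfolding u_def by (rule cInf_lower[OF s(1) S(2)])
    then show False using d(2)[of s] s u0 by (auto simp: S_def)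
  qed
  have yu: "y u = w u" using le_u ge_u by simp
  have qu: "0 \<le> q * u" "y (q * u) \<le> w (q * u)"
  proof -
    show "0 \<le> q * u" using q u0 by simp
    show "y (q * u) \<le> w (q * u)"
    \<comment> \<open>At u = 0 the delayed time is u itself and the initial condition applies;
      otherwise q u lies strictly before u.\<close>
    proof (cases "u = 0")
      case False
      then show ?thesis using q u0 by (intro below) auto
    qed (use init in simp)
  qed
  define rate where "rate = - A * y u + 2 * \<beta> * sqrt (y u * y (q * u)) + \<gamma> * y (q * u)"
  have "sqrt (y u * y (q * u)) \<le> sqrt (w u * w (q * u))"
    unfolding yu using qu w(1)[OF u0] by (intro real_sqrt_le_mono mult_left_mono)
  then have "2 * \<beta> * sqrt (y u * y (q * u)) \<le> 2 * \<beta> * sqrt (w u * w (q * u))"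
    using \<open>0 \<le> \<beta>\<close> by (intro mult_left_mono) auto
  moreover have "\<gamma> * y (q * u) \<le> \<gamma> * w (q * u)" using qu \<open>0 \<le> \<gamma>\<close> by (intro mult_left_mono)
  ultimately have "rate < w' u" using w(3)[OF u0] unfolding rate_def yu by linarith
  \<comment> \<open>Half the gap between the slopes: one half is granted to the Dini bound, the
    other to the difference quotient of w.\<close>
  define \<eta> where "\<eta> = (w' u - rate) / 2"
  have \<eta>: "0 < \<eta>" "rate + \<eta> = w' u - \<eta>" using \<open>rate < w' u\<close> by (auto simp: \<eta>_def field_simps)
  obtain d1 where d1: "0 < d1" "\<And>h. 0 < h \<Longrightarrow> h < d1 \<Longrightarrow> y (u + h) \<le> y u + h * (rate + \<eta>)"
    using y(2)[OF u0 \<eta>(1)] unfolding rate_def by blast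
  obtain d2 where d2: "0 < d2" "\<And>h. h \<noteq> 0 \<Longrightarrow> \<bar>h\<bar> < d2 \<Longrightarrow> \<bar>(w (u + h) - w u) / h - w' u\<bar> < \<eta>"
    using w(2)[OF u0] \<eta>(1) unfolding DERIV_def LIM_def dist_real_def by (metis diff_zero)
  obtain s where s: "s \<in> S" "s < u + min d1 d2"
    using cInf_lessD[OF S(1), of "u + min d1 d2"] d1(1) d2(1) by (auto simp: u_def)
  have "u \<le> s" unfolding u_def by (rule cInf_lower[OF s(1) S(2)])
  moreover have "u \<noteq> s" using s(1) le_u by (auto simp: S_def)
  ultimately have h: "0 < s - u" "s - u < d1" "s - u < d2" using s(2) by auto
  have "w' u - \<eta> < (w s - w u) / (s - u)" using d2(2)[of "s - u"] h by auto
  then have "w u + (s - u) * (w' u - \<eta>) < w s" using h(1) by (simp add: field_simps)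
  moreover have "y s \<le> y u + (s - u) * (rate + \<eta>)" using d1(2)[OF h(1,2)] by simp
  ultimately show False using s(1) yu \<eta>(2) by (auto simp: S_def)
qed

text \<open>The comparison inequality is homogeneous of degree one, so multiples of a single
  supersolution dominate every such y, and C depends on the coefficients alone. The mean is the case
  \<beta> = 0; the second moment has both delayed terms. In either case x is fixed by the balance A
  = \<gamma> x^2 + 2 \<beta> x.\<close>

theorem pantograph_inequality_decay:
  fixes q x \<beta> \<gamma> :: real
  assumes q: "0 < q" "q < 1" and x: "1 < x" and "0 \<le> \<beta>" "0 \<le> \<gamma>"
  defines "A \<equiv> \<gamma> * x\<^sup>2 + 2 * \<beta> * x" and "\<alpha> \<equiv> 2 * ln x / ln q"
  assumes "0 < A"
  shows "\<exists>C>0. \<forall>y. continuous_on {0..} y \<and> 0 \<le> y 0 \<and>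
      (\<forall>t\<ge>0. \<forall>\<epsilon>>0. \<exists>d>0. \<forall>h. 0 < h \<and> h < d \<longrightarrow>
         y (t + h) \<le> y t + h * (- A * y t + 2 * \<beta> * sqrt (y t * y (q * t)) + \<gamma> * y (q * t) + \<epsilon>)) \<longrightarrow>
      (\<forall>t\<ge>0. y t \<le> C * y 0 * (1 + t) powr \<alpha>)"
proof -
  obtain c where c: "1 \<le> c" and super: "\<And>t. 0 \<le> t \<Longrightarrow> - A * (t + c) powr \<alpha>
      + 2 * \<beta> * sqrt ((t + c) powr \<alpha> * (q * t + c) powr \<alpha>) + \<gamma> * (q * t + c) powr \<alpha> < \<alpha> * (t + c) powr (\<alpha> - 1)"
    using shifted_power_supersolution[OF q x \<open>0 \<le> \<beta>\<close> \<open>0 \<le> \<gamma>\<close>] \<open>0 < A\<close> unfolding A_def \<alpha>_def by blast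
  have "\<alpha> < 0" using q x by (simp add: \<alpha>_def divide_pos_neg)
  have "y t \<le> c powr (- \<alpha>) * y 0 * (1 + t) powr \<alpha>"
    if y: "continuous_on {0..} y" "0 \<le> y 0" "\<forall>t\<ge>0. \<forall>\<epsilon>>0. \<exists>d>0. \<forall>h. 0 < h \<and> h < d \<longrightarrow>
         y (t + h) \<le> y t + h * (- A * y t + 2 * \<beta> * sqrt (y t * y (q * t)) + \<gamma> * y (q * t) + \<epsilon>)"
      and t: "0 \<le> t" for y t
  proof -
    \<comment> \<open>A multiple of a strict supersolution is strict only for a positive factor, and
      y 0 may vanish; hence the extra e, which is removed afterwards.\<close>
    have le: "y t \<le> (y 0 + e) * (c powr (- \<alpha>) * (t + c) powr \<alpha>)" if e: "0 < e" for e
    proof -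
      define K where "K = (y 0 + e) * c powr (- \<alpha>)"
      have K: "0 < K" using y(2) e c by (simp add: K_def add_nonneg_pos)
      have "y t \<le> K * (t + c) powr \<alpha>"
      proof (rule upper_Dini_comparison[OF q \<open>0 \<le> \<beta>\<close> \<open>0 \<le> \<gamma>\<close> y(1) y(3)[rule_format], where w = "\<lambda>t. K * (t + c) powr \<alpha>"
            and w' = "\<lambda>t. K * (\<alpha> * (t + c) powr (\<alpha> - 1))"])
        fix s :: real assume s: "0 \<le> s"
        show "0 \<le> K * (s + c) powr \<alpha>" using K by simp
        show "((\<lambda>t. K * (t + c) powr \<alpha>) has_real_derivative K * (\<alpha> * (s + c) powr (\<alpha> - 1))) (at s)"
          using s c by (auto intro!: derivative_eq_intros simp: powr_diff)
        have "sqrt (K * (s + c) powr \<alpha> * (K * (q * s + c) powr \<alpha>))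
          = K * sqrt ((s + c) powr \<alpha> * (q * s + c) powr \<alpha>)"
        proof -
          have "K * (s + c) powr \<alpha> * (K * (q * s + c) powr \<alpha>) = K\<^sup>2 * ((s + c) powr \<alpha> * (q * s + c) powr \<alpha>)"
            by (simp add: power2_eq_square)
          then show ?thesis using K by (simp only: real_sqrt_mult real_sqrt_abs abs_of_pos)
        qed
        then show "- A * (K * (s + c) powr \<alpha>) + 2 * \<beta> * sqrt (K * (s + c) powr \<alpha> * (K * (q * s + c) powr \<alpha>))
            + \<gamma> * (K * (q * s + c) powr \<alpha>) < K * (\<alpha> * (s + c) powr (\<alpha> - 1))"
          using mult_strict_left_mono[OF super[OF s] K] by (simp add: algebra_simps)
      next
        have "K * (0 + c) powr \<alpha> = y 0 + e"
          using c by (simp add: K_def powr_minus)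
        then show "y 0 \<le> K * (0 + c) powr \<alpha>" using e by simp
      qed (use t in auto)
      then show ?thesis by (simp add: K_def mult.assoc)
    qed
    have "y t \<le> y 0 * (c powr (- \<alpha>) * (t + c) powr \<alpha>)"
    proof (rule field_le_epsilon)
      fix e :: real assume e: "0 < e"
      define D where "D = c powr (- \<alpha>) * (t + c) powr \<alpha>"
      have D: "0 < D" using c t by (simp add: D_def)
      show "y t \<le> y 0 * (c powr (- \<alpha>) * (t + c) powr \<alpha>) + e"
        using le[of "e / D"] e D unfolding D_def[symmetric] by (simp add: algebra_simps)
    qed
    \<comment> \<open>Since \<alpha> < 0 and c \<ge> 1, the power only grows when c is replaced by
      1.\<close>
    also have "\<dots> \<le> y 0 * (c powr (- \<alpha>) * (1 + t) powr \<alpha>)"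
      using y(2) c t \<open>\<alpha> < 0\<close> by (intro mult_left_mono powr_mono2') auto
    finally show ?thesis by (simp add: mult_ac)
  qed
  moreover have "0 < c powr (- \<alpha>)" using c by simp
  ultimately show ?thesis by blast
qed

text \<open>Converts the quantitative remainder K h^(3/2) of a single step into the \<epsilon> of a
  Dini derivative, together with the restrictions on the step length.\<close>

lemma exists_step_below:
  fixes K L \<epsilon> :: real
  assumes "0 \<le> K" "0 < \<epsilon>" "0 \<le> L"
  shows "\<exists>d>0. \<forall>h. 0 < h \<and> h < d \<longrightarrow> h \<le> 1 \<and> h * L \<le> 1 \<and> K * (h * sqrt h) \<le> h * \<epsilon>"
proof -
  define d where "d = Min {1, 1 / (L + 1), (\<epsilon> / (K + 1))\<^sup>2}"
  have "0 < d" using assms by (simp add: d_def add_nonneg_pos)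
  moreover have "h \<le> 1 \<and> h * L \<le> 1 \<and> K * (h * sqrt h) \<le> h * \<epsilon>" if h: "0 < h" "h < d" for h
  proof -
    have hd: "h \<le> 1" "h \<le> 1 / (L + 1)" "h < (\<epsilon> / (K + 1))\<^sup>2" using h by (auto simp: d_def)
    have "h * L \<le> h * (L + 1)" using h by simp
    also have "\<dots> \<le> 1" using hd(2) assms by (simp add: field_simps)
    finally have "h * L \<le> 1" .
    moreover have "sqrt h < \<epsilon> / (K + 1)" using hd(3) assms by (intro real_less_lsqrt) auto
    then have "K * sqrt h \<le> K * (\<epsilon> / (K + 1))" using assms by (intro mult_left_mono) auto
    moreover have "K * (\<epsilon> / (K + 1)) \<le> \<epsilon>" using assms by (simp add: field_simps)
    ultimately show ?thesis using hd(1) mult_left_mono[of "K * sqrt h" \<epsilon> h] h by (simp add: mult_ac)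
  qed
  ultimately show ?thesis by blast
qed

section \<open>Decay of the moments of the solution\<close>

context pantograph
begin

definition first_moment :: "real \<Rightarrow> real" where
  "first_moment t = expectation (\<lambda>\<omega>. \<bar>X t \<omega>\<bar>)"

definition second_moment :: "real \<Rightarrow> real" where
  "second_moment t = expectation (\<lambda>\<omega>. (X t \<omega>)\<^sup>2)"

lemma first_moment_0: "first_moment 0 = expectation (\<lambda>\<omega>. \<bar>X0 \<omega>\<bar>)"
  unfolding first_moment_def
  by (rule integral_cong_AE) (use X_0 in \<open>auto elim: eventually_mono\<close>)

lemma second_moment_0: "second_moment 0 = expectation (\<lambda>\<omega>. (X0 \<omega>)\<^sup>2)"
  unfolding second_moment_def by (rule X0_second_moment)

lemma first_moment_nonneg: "0 \<le> first_moment t"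
  by (simp add: first_moment_def)

lemma second_moment_nonneg: "0 \<le> second_moment t"
  by (simp add: second_moment_def)

lemma X_integrable: "0 \<le> t \<Longrightarrow> integrable M (X t)"
  using X_square_integrable square_integrable_integrable by blast

lemma first_moment_continuous: "continuous_on {0..} first_moment"
proof (rule sqrt_modulus_imp_continuous)
  fix T
  obtain K where K: "0 \<le> K" "\<And>s t. 0 \<le> s \<Longrightarrow> s \<le> t \<Longrightarrow> t \<le> T \<Longrightarrow> expectation (\<lambda>\<omega>. (X t \<omega> - X s \<omega>)\<^sup>2) \<le> K * (t - s)"
    using X_increment_bound[of T] by blast
  have "\<bar>first_moment t - first_moment s\<bar> \<le> sqrt K * sqrt (t - s)" if st: "0 \<le> s" "s \<le> t" "t \<le> T" for s t
  proof -
    have t: "0 \<le> t" using st by simp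
    note int = X_integrable[OF t] X_integrable[OF st(1)]
    have "\<bar>first_moment t - first_moment s\<bar> = \<bar>expectation (\<lambda>\<omega>. \<bar>X t \<omega>\<bar> - \<bar>X s \<omega>\<bar>)\<bar>"
      unfolding first_moment_def using int by simp
    also have "\<dots> \<le> expectation (\<lambda>\<omega>. \<bar>\<bar>X t \<omega>\<bar> - \<bar>X s \<omega>\<bar>\<bar>)" by (rule integral_abs_bound)
    also have "\<dots> \<le> expectation (\<lambda>\<omega>. \<bar>X t \<omega> - X s \<omega>\<bar>)"
      using int by (intro integral_mono) auto
    also have "\<dots> \<le> sqrt (expectation (\<lambda>\<omega>. (X t \<omega> - X s \<omega>)\<^sup>2))"
      by (intro expectation_abs_le_sqrt square_integrable_diff X_square_integrable t st)
    also have "\<dots> \<le> sqrt (K * (t - s))" by (intro real_sqrt_le_mono K st)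
    finally show ?thesis by (simp add: real_sqrt_mult)
  qed
  then show "\<exists>C\<ge>0. \<forall>s t. 0 \<le> s \<and> s \<le> t \<and> t \<le> T \<longrightarrow> \<bar>first_moment t - first_moment s\<bar> \<le> C * sqrt (t - s)"
    using K(1) by (intro exI[of _ "sqrt K"]) auto
qed

lemma second_moment_continuous: "continuous_on {0..} second_moment"
proof (rule sqrt_modulus_imp_continuous)
  fix T
  obtain K where K: "0 \<le> K" "\<And>s t. 0 \<le> s \<Longrightarrow> s \<le> t \<Longrightarrow> t \<le> T \<Longrightarrow> expectation (\<lambda>\<omega>. (X t \<omega> - X s \<omega>)\<^sup>2) \<le> K * (t - s)"
    using X_increment_bound[of T] by blast
  obtain C where C: "0 \<le> C" "\<And>t. 0 \<le> t \<Longrightarrow> t \<le> T \<Longrightarrow> expectation (\<lambda>\<omega>. (X t \<omega>)\<^sup>2) \<le> C"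
    using second_moment_bound[of T] by blast
  have "\<bar>second_moment t - second_moment s\<bar> \<le> sqrt K * sqrt (4 * C) * sqrt (t - s)" if st: "0 \<le> s" "s \<le> t" "t \<le> T" for s t
  proof -
    have t: "0 \<le> t" and sT: "s \<le> T" using st by auto
    note sq = X_square_integrable[OF t] X_square_integrable[OF st(1)]
    have "second_moment t - second_moment s = expectation (\<lambda>\<omega>. (X t \<omega>)\<^sup>2 - (X s \<omega>)\<^sup>2)"
      unfolding second_moment_def using square_integrableD(2)[OF sq(1)] square_integrableD(2)[OF sq(2)] by simp
    also have "\<dots> = expectation (\<lambda>\<omega>. (X t \<omega> - X s \<omega>) * (X t \<omega> + X s \<omega>))"
      by (intro Bochner_Integration.integral_cong) (auto simp: power2_eq_square algebra_simps)
    finally have "\<bar>second_moment t - second_moment s\<bar>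
      \<le> sqrt (expectation (\<lambda>\<omega>. (X t \<omega> - X s \<omega>)\<^sup>2)) * sqrt (expectation (\<lambda>\<omega>. (X t \<omega> + X s \<omega>)\<^sup>2))"
      using Cauchy_Schwarz_expectation[OF square_integrable_diff[OF sq] square_integrable_add[OF sq]] by simp
    also have "\<dots> \<le> sqrt (K * (t - s)) * sqrt (4 * C)"
      using K(2)[OF st] expectation_square_add_le[OF sq] C(2)[OF t st(3)] C(2)[OF st(1) sT] K(1) C(1) st
      by (intro mult_mono real_sqrt_le_mono) auto
    finally show ?thesis by (simp add: real_sqrt_mult mult_ac)
  qed
  then show "\<exists>C\<ge>0. \<forall>s t. 0 \<le> s \<and> s \<le> t \<and> t \<le> T \<longrightarrow> \<bar>second_moment t - second_moment s\<bar> \<le> C * sqrt (t - s)"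
    using K(1) C(1) by (intro exI[of _ "sqrt K * sqrt (4 * C)"]) auto
qed

lemma first_moment_Dini:
  assumes "\<rho> = 0" "0 \<le> t" "0 < \<epsilon>"
  shows "\<exists>d>0. \<forall>h. 0 < h \<and> h < d \<longrightarrow>
    first_moment (t + h) \<le> first_moment t + h * (a * first_moment t + \<bar>b\<bar> * first_moment (q * t) + \<epsilon>)"
proof -
  obtain K where K: "0 \<le> K" "\<And>s u. 0 \<le> s \<Longrightarrow> s \<le> u \<Longrightarrow> u \<le> t + 1 \<Longrightarrow> (u - s) * (2 * \<bar>a\<bar> + \<sigma>\<^sup>2) \<le> 1 \<Longrightarrow>
     first_moment u \<le> first_moment s + (u - s) * (a * first_moment s + \<bar>b\<bar> * first_moment (q * s)) + K * ((u - s) * sqrt (u - s))"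
    using first_moment_step[OF assms(1), of "t + 1"] unfolding first_moment_def by blast
  have "0 \<le> 2 * \<bar>a\<bar> + \<sigma>\<^sup>2" by simp
  then obtain d where d: "0 < d" "\<And>h. 0 < h \<Longrightarrow> h < d \<Longrightarrow> h \<le> 1 \<and> h * (2 * \<bar>a\<bar> + \<sigma>\<^sup>2) \<le> 1 \<and> K * (h * sqrt h) \<le> h * \<epsilon>"
    using exists_step_below[OF K(1) assms(3)] by blast
  show ?thesis
  proof (intro exI[of _ d] conjI allI impI)
    fix h assume h: "0 < h \<and> h < d"
    have "first_moment (t + h) \<le> first_moment t + (t + h - t) * (a * first_moment t + \<bar>b\<bar> * first_moment (q * t))
        + K * ((t + h - t) * sqrt (t + h - t))"
      using d(2)[of h] h assms(2) by (intro K(2)) auto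
    moreover have "K * (h * sqrt h) \<le> h * \<epsilon>" using d(2) h by blast
    ultimately show "first_moment (t + h) \<le> first_moment t + h * (a * first_moment t + \<bar>b\<bar> * first_moment (q * t) + \<epsilon>)"
      unfolding add_diff_cancel_left' distrib_left[of h "_ + _" \<epsilon>] by linarith
  qed fact
qed

lemma second_moment_Dini:
  assumes "0 \<le> t" "0 < \<epsilon>"
  shows "\<exists>d>0. \<forall>h. 0 < h \<and> h < d \<longrightarrow>
    second_moment (t + h) \<le> second_moment t + h * ((2 * a + \<sigma>\<^sup>2) * second_moment t
      + 2 * \<bar>b + \<sigma> * \<rho>\<bar> * sqrt (second_moment t * second_moment (q * t)) + \<rho>\<^sup>2 * second_moment (q * t) + \<epsilon>)"
proof -
  obtain K where K: "0 \<le> K" "\<And>s u. 0 \<le> s \<Longrightarrow> s \<le> u \<Longrightarrow> u \<le> t + 1 \<Longrightarrow> u - s \<le> 1 \<Longrightarrow>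
     second_moment u \<le> second_moment s + (u - s) * (2 * expectation (\<lambda>\<omega>. X s \<omega> * drift s \<omega>)
       + expectation (\<lambda>\<omega>. (diffusion s \<omega>)\<^sup>2)) + K * ((u - s) * sqrt (u - s))"
    using second_moment_step[of "t + 1"] unfolding second_moment_def by blast
  obtain d where d: "0 < d" "\<And>h. 0 < h \<Longrightarrow> h < d \<Longrightarrow> h \<le> 1 \<and> h * 0 \<le> 1 \<and> K * (h * sqrt h) \<le> h * \<epsilon>"
    using exists_step_below[OF K(1) assms(2) order_refl] by blast
  define G where "G = 2 * expectation (\<lambda>\<omega>. X t \<omega> * drift t \<omega>) + expectation (\<lambda>\<omega>. (diffusion t \<omega>)\<^sup>2)"
  define G' where "G' = (2 * a + \<sigma>\<^sup>2) * second_moment t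
      + 2 * \<bar>b + \<sigma> * \<rho>\<bar> * sqrt (second_moment t * second_moment (q * t)) + \<rho>\<^sup>2 * second_moment (q * t)"
  have "G \<le> G'" unfolding G_def G'_def second_moment_def by (rule second_moment_generator[OF assms(1)])
  show ?thesis
  proof (intro exI[of _ d] conjI allI impI)
    fix h assume h: "0 < h \<and> h < d"
    have "second_moment (t + h) \<le> second_moment t + (t + h - t) * G + K * ((t + h - t) * sqrt (t + h - t))"
      unfolding G_def using d(2)[of h] h assms(1) by (intro K(2)) auto
    moreover have "K * (h * sqrt h) \<le> h * \<epsilon>" using d(2) h by blast
    moreover have "h * G \<le> h * G'" using \<open>G \<le> G'\<close> h by (intro mult_left_mono) auto
    ultimately show "second_moment (t + h) \<le> second_moment t + h * ((2 * a + \<sigma>\<^sup>2) * second_moment t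
      + 2 * \<bar>b + \<sigma> * \<rho>\<bar> * sqrt (second_moment t * second_moment (q * t)) + \<rho>\<^sup>2 * second_moment (q * t) + \<epsilon>)"
      unfolding G'_def[symmetric] add_diff_cancel_left' distrib_left by linarith
  qed fact
qed

text \<open>\<open>\<gamma>\<close> stands for the absolute value of b and may exceed it; this
  covers b = 0, where the quotient defines no exponent. With \<beta> = 0 the balance reads \<gamma>
  x^2 = - a, so the 2 in the general exponent cancels against the square root in x.\<close>

lemma first_moment_decay:
  assumes "\<rho> = 0" "\<bar>b\<bar> \<le> \<gamma>" "0 < \<gamma>" "\<gamma> < - a"
  shows "\<exists>C>0. \<forall>t\<ge>0. first_moment t \<le> C * first_moment 0 * (1 + t) powr (1 / ln q * ln (- a / \<gamma>))"
proof -
  define x where "x = sqrt (- a / \<gamma>)"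
  have r: "1 < - a / \<gamma>" using assms(3,4) by (simp only: pos_less_divide_eq mult_1)
  then have x: "1 < x" unfolding x_def by (simp only: real_sqrt_gt_1_iff)
  have "x\<^sup>2 = - a / \<gamma>" unfolding x_def using r by (intro real_sqrt_pow2) linarith
  then have A: "\<gamma> * x\<^sup>2 + 2 * 0 * x = - a" using assms(3) by simp
  have "2 * ln x = ln (x\<^sup>2)" using x by (simp add: ln_realpow)
  then have "2 * ln x = ln (- a / \<gamma>)" unfolding \<open>x\<^sup>2 = - a / \<gamma>\<close> .
  then have \<alpha>: "2 * ln x / ln q = 1 / ln q * ln (- a / \<gamma>)" by simp
  have Dini: "\<exists>d>0. \<forall>h. 0 < h \<and> h < d \<longrightarrow> first_moment (t + h) \<le> first_moment t + h * (- (- a) * first_moment t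
      + 2 * 0 * sqrt (first_moment t * first_moment (q * t)) + \<gamma> * first_moment (q * t) + \<epsilon>)" if t: "0 \<le> t" "0 < \<epsilon>" for t \<epsilon>
  proof -
    obtain d where d: "0 < d" "\<And>h. 0 < h \<Longrightarrow> h < d \<Longrightarrow>
      first_moment (t + h) \<le> first_moment t + h * (a * first_moment t + \<bar>b\<bar> * first_moment (q * t) + \<epsilon>)"
      using first_moment_Dini[OF assms(1) t] by blast
    have le: "\<bar>b\<bar> * first_moment (q * t) \<le> \<gamma> * first_moment (q * t)"
      using assms(2) first_moment_nonneg by (intro mult_right_mono) auto
    show ?thesis
    proof (intro exI[of _ d] conjI allI impI)
      fix h assume h: "0 < h \<and> h < d"
      have "h * (a * first_moment t + \<bar>b\<bar> * first_moment (q * t) + \<epsilon>) \<le> h * (a * first_moment t + \<gamma> * first_moment (q * t) + \<epsilon>)"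
        using le h by (intro mult_left_mono) auto
      then have "first_moment (t + h) \<le> first_moment t + h * (a * first_moment t + \<gamma> * first_moment (q * t) + \<epsilon>)"
        using d(2)[of h] h by linarith
      then show "first_moment (t + h) \<le> first_moment t + h * (- (- a) * first_moment t
        + 2 * 0 * sqrt (first_moment t * first_moment (q * t)) + \<gamma> * first_moment (q * t) + \<epsilon>)"
        by simp
    qed fact
  qed
  have "0 < - a" using assms by linarith
  show ?thesis
    by (rule ex_forward[OF pantograph_inequality_decay[OF q x order_refl less_imp_le[OF assms(3)], unfolded A \<alpha>, OF \<open>0 < - a\<close>]],
        erule conjE, rule conjI, assumption, erule allE[where x = first_moment], erule mp)
      (intro conjI allI impI first_moment_continuous first_moment_nonneg Dini)
qed

text \<open>The number x is the positive root of \<rho>^2 x^2 + 2 \<beta> x = A, where \<beta> is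
  the absolute value of b + \<sigma> \<rho> and A = - (2 a + \<sigma>^2). The stability condition
  says that the left-hand side at 1 lies below A, that is, that the root exceeds 1 and the exponent
  is negative.\<close>

lemma second_moment_decay:
  assumes "\<rho> \<noteq> 0" "2 * a + \<sigma>\<^sup>2 + \<rho>\<^sup>2 + 2 * \<bar>b + \<sigma> * \<rho>\<bar> < 0"
  defines "x \<equiv> 1 / \<rho>\<^sup>2 * (sqrt (\<bar>b + \<sigma> * \<rho>\<bar>\<^sup>2 - \<rho>\<^sup>2 * (2 * a + \<sigma>\<^sup>2)) - \<bar>b + \<sigma> * \<rho>\<bar>)"
  shows "1 < x" "\<exists>C>0. \<forall>t\<ge>0. second_moment t \<le> C * second_moment 0 * (1 + t) powr (2 / ln q * ln x)"
proof -
  define \<beta> where "\<beta> = \<bar>b + \<sigma> * \<rho>\<bar>"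
  define A where "A = - (2 * a + \<sigma>\<^sup>2)"
  define S where "S = sqrt (\<beta>\<^sup>2 + \<rho>\<^sup>2 * A)"
  have \<rho>: "0 < \<rho>\<^sup>2" using assms(1) by simp
  have \<beta>: "0 \<le> \<beta>" by (simp add: \<beta>_def)
  have A: "2 * \<beta> + \<rho>\<^sup>2 < A" using assms(2) by (simp add: A_def \<beta>_def)
  then have A0: "0 < A" using \<beta> \<rho> by linarith
  have "S = sqrt (\<bar>b + \<sigma> * \<rho>\<bar>\<^sup>2 - \<rho>\<^sup>2 * (2 * a + \<sigma>\<^sup>2))"
    unfolding S_def A_def \<beta>_def mult_minus_right by (simp only: diff_conv_add_uminus)
  then have x_eq: "x * \<rho>\<^sup>2 = S - \<beta>"
    using assms(1) by (simp add: x_def \<beta>_def)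
  \<comment> \<open>After cancelling \<beta>^2 this is \<rho>^2 times the stability
    condition.\<close>
  have "(\<beta> + \<rho>\<^sup>2)\<^sup>2 < \<beta>\<^sup>2 + \<rho>\<^sup>2 * A"
    using mult_strict_left_mono[OF A \<rho>] by (simp add: power2_eq_square algebra_simps)
  then have "\<beta> + \<rho>\<^sup>2 < S" unfolding S_def by (rule real_less_rsqrt)
  then have "1 * \<rho>\<^sup>2 < x * \<rho>\<^sup>2" unfolding x_eq by simp
  then show x: "1 < x" using \<rho> by (simp only: mult_less_cancel_right_pos)
  have "S\<^sup>2 = \<beta>\<^sup>2 + \<rho>\<^sup>2 * A" using A0 by (simp add: S_def)
  then have "\<rho>\<^sup>2 * (\<rho>\<^sup>2 * x\<^sup>2 + 2 * \<beta> * x) = \<rho>\<^sup>2 * A"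
  proof -
    have "\<rho>\<^sup>2 * (\<rho>\<^sup>2 * x\<^sup>2 + 2 * \<beta> * x) = (x * \<rho>\<^sup>2)\<^sup>2 + 2 * \<beta> * (x * \<rho>\<^sup>2)"
      by (simp add: power2_eq_square algebra_simps)
    also have "\<dots> = S\<^sup>2 - \<beta>\<^sup>2" unfolding x_eq by (simp add: power2_eq_square algebra_simps)
    finally show ?thesis using \<open>S\<^sup>2 = \<beta>\<^sup>2 + \<rho>\<^sup>2 * A\<close> by simp
  qed
  then have eq: "\<rho>\<^sup>2 * x\<^sup>2 + 2 * \<beta> * x = A" using \<rho> by simp
  have \<alpha>: "2 * ln x / ln q = 2 / ln q * ln x" by simp
  have Dini: "\<exists>d>0. \<forall>h. 0 < h \<and> h < d \<longrightarrow> second_moment (t + h) \<le> second_moment t + h * (- A * second_moment t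
      + 2 * \<beta> * sqrt (second_moment t * second_moment (q * t)) + \<rho>\<^sup>2 * second_moment (q * t) + \<epsilon>)"
    if "0 \<le> t" "0 < \<epsilon>" for t \<epsilon>
    unfolding \<beta>_def A_def minus_minus by (rule second_moment_Dini[OF that])
  show "\<exists>C>0. \<forall>t\<ge>0. second_moment t \<le> C * second_moment 0 * (1 + t) powr (2 / ln q * ln x)"
    by (rule ex_forward[OF pantograph_inequality_decay[OF q x \<beta> less_imp_le[OF \<rho>], unfolded eq \<alpha>, OF A0]],
        erule conjE, rule conjI, assumption, erule allE[where x = second_moment], erule mp)
      (intro conjI allI impI second_moment_continuous second_moment_nonneg Dini)
qed

end

theorem theorem4:
  fixes M :: "'a measure"
    and B X :: "real \<Rightarrow> 'a \<Rightarrow> real"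
    and X0 :: "'a \<Rightarrow> real"
    and a b \<sigma> \<rho> q :: real
  assumes "prob_space M"
    and "wiener_process M B"
    and "X0 \<in> borel_measurable M"
    and "independent_of_process M X0 B"
    and "integrable M (\<lambda>\<omega>. \<bar>X0 \<omega>\<bar>\<^sup>2)"
    and "0 < q" and "q < 1"
    and "pantograph_solution M B X0 a b \<sigma> \<rho> q X"
  shows "(\<rho> = 0 \<and> a + \<bar>b\<bar> < 0 \<longrightarrow>
            (\<exists>C>0. \<exists>\<alpha><0.
               (b \<noteq> 0 \<longrightarrow> \<alpha> = 1 / ln q * ln (- a / \<bar>b\<bar>)) \<and>
               (\<forall>t\<ge>0. integrable M (\<lambda>\<omega>. \<bar>X t \<omega>\<bar>) \<and>
                  prob_space.expectation M (\<lambda>\<omega>. \<bar>X t \<omega>\<bar>)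
                    \<le> C * prob_space.expectation M (\<lambda>\<omega>. \<bar>X0 \<omega>\<bar>) * (1 + t) powr \<alpha>))) \<and>
         (\<rho> \<noteq> 0 \<and> integrable M (\<lambda>\<omega>. \<bar>X0 \<omega>\<bar> ^ 4) \<and>
          2 * a + \<sigma>\<^sup>2 + \<rho>\<^sup>2 + 2 * \<bar>b + \<sigma> * \<rho>\<bar> < 0 \<longrightarrow>
            (\<exists>C>0. \<exists>\<alpha><0.
               \<alpha> = 2 / ln q *
                 ln (1 / \<rho>\<^sup>2 * (sqrt (\<bar>b + \<sigma> * \<rho>\<bar>\<^sup>2 - \<rho>\<^sup>2 * (2 * a + \<sigma>\<^sup>2)) - \<bar>b + \<sigma> * \<rho>\<bar>)) \<and>
               (\<forall>t\<ge>0. integrable M (\<lambda>\<omega>. \<bar>X t \<omega>\<bar>\<^sup>2) \<and>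
                  prob_space.expectation M (\<lambda>\<omega>. \<bar>X t \<omega>\<bar>\<^sup>2)
                    \<le> C * prob_space.expectation M (\<lambda>\<omega>. \<bar>X0 \<omega>\<bar>\<^sup>2) * (1 + t) powr \<alpha>)))"
proof -
  interpret prob_space M by fact
  interpret wiener_with_initial M B X0
    by unfold_locales fact+
  interpret pantograph M B X0 a b \<sigma> \<rho> q X
    by unfold_locales (use assms in simp_all)
  have lnq: "ln q < 0" using assms(6,7) by simp
  show ?thesis
  proof (intro conjI impI)
    assume *: "\<rho> = 0 \<and> a + \<bar>b\<bar> < 0"
    \<comment> \<open>For b = 0 any value strictly between 0 and - a is admissible; this one gives
      \<alpha> = ln 2 / ln q.\<close>
    define \<gamma> where "\<gamma> = (if b = 0 then - a / 2 else \<bar>b\<bar>)"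
    define \<alpha> where "\<alpha> = 1 / ln q * ln (- a / \<gamma>)"
    have \<gamma>: "\<bar>b\<bar> \<le> \<gamma>" "0 < \<gamma>" "\<gamma> < - a" using * by (auto simp: \<gamma>_def)
    then have "1 < - a / \<gamma>" by (simp only: pos_less_divide_eq mult_1)
    then have "0 < ln (- a / \<gamma>)" by (rule ln_gt_zero)
    then have "\<alpha> < 0" using lnq unfolding \<alpha>_def by (simp add: divide_pos_neg)
    moreover obtain C where "0 < C" "\<And>t. 0 \<le> t \<Longrightarrow> first_moment t \<le> C * first_moment 0 * (1 + t) powr \<alpha>"
      using first_moment_decay[OF _ \<gamma>] * unfolding \<alpha>_def by blast
    moreover have "b \<noteq> 0 \<longrightarrow> \<alpha> = 1 / ln q * ln (- a / \<bar>b\<bar>)" by (simp add: \<alpha>_def \<gamma>_def)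
    ultimately show "\<exists>C>0. \<exists>\<alpha><0. (b \<noteq> 0 \<longrightarrow> \<alpha> = 1 / ln q * ln (- a / \<bar>b\<bar>)) \<and>
               (\<forall>t\<ge>0. integrable M (\<lambda>\<omega>. \<bar>X t \<omega>\<bar>) \<and>
                  expectation (\<lambda>\<omega>. \<bar>X t \<omega>\<bar>) \<le> C * expectation (\<lambda>\<omega>. \<bar>X0 \<omega>\<bar>) * (1 + t) powr \<alpha>)"
      unfolding first_moment_0[symmetric] unfolding first_moment_def
      using X_integrable by (intro exI[of _ C] conjI exI[of _ \<alpha>]) auto
  next
    assume *: "\<rho> \<noteq> 0 \<and> integrable M (\<lambda>\<omega>. \<bar>X0 \<omega>\<bar> ^ 4) \<and> 2 * a + \<sigma>\<^sup>2 + \<rho>\<^sup>2 + 2 * \<bar>b + \<sigma> * \<rho>\<bar> < 0"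
    define x where "x = 1 / \<rho>\<^sup>2 * (sqrt (\<bar>b + \<sigma> * \<rho>\<bar>\<^sup>2 - \<rho>\<^sup>2 * (2 * a + \<sigma>\<^sup>2)) - \<bar>b + \<sigma> * \<rho>\<bar>)"
    have x: "1 < x" and "\<exists>C>0. \<forall>t\<ge>0. second_moment t \<le> C * second_moment 0 * (1 + t) powr (2 / ln q * ln x)"
      using second_moment_decay * unfolding x_def by blast+
    then obtain C where C: "0 < C" "\<And>t. 0 \<le> t \<Longrightarrow> second_moment t \<le> C * second_moment 0 * (1 + t) powr (2 / ln q * ln x)"
      by blast
    have neg: "2 / ln q * ln x < 0" using x lnq by (simp add: divide_pos_neg)
    show "\<exists>C>0. \<exists>\<alpha><0. \<alpha> = 2 / ln q *
                 ln (1 / \<rho>\<^sup>2 * (sqrt (\<bar>b + \<sigma> * \<rho>\<bar>\<^sup>2 - \<rho>\<^sup>2 * (2 * a + \<sigma>\<^sup>2)) - \<bar>b + \<sigma> * \<rho>\<bar>)) \<and>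
               (\<forall>t\<ge>0. integrable M (\<lambda>\<omega>. \<bar>X t \<omega>\<bar>\<^sup>2) \<and>
                  expectation (\<lambda>\<omega>. \<bar>X t \<omega>\<bar>\<^sup>2) \<le> C * expectation (\<lambda>\<omega>. \<bar>X0 \<omega>\<bar>\<^sup>2) * (1 + t) powr \<alpha>)"
      unfolding x_def[symmetric] unfolding power2_abs second_moment_0[symmetric] second_moment_def[symmetric]
      by (rule exI[of _ C], rule conjI, rule C, rule exI[of _ "2 / ln q * ln x"])
        (intro conjI allI impI refl C neg square_integrableD(2)[OF X_square_integrable])
  qed
qed

end
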